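(* Let $q\in(0,1)$, $u\in\mathbb C$ with $|u|=1$, $k,m,n\in\mathbb N$, $s,t>0$, $x\in-q^{\mathbb N-n}\cup sq^{\mathbb N-n}$, $\xi\in\{-1,s\}$, $\lambda\in\{-1,t\}$, and set $r=k-m+n$. Then $$\begin{aligned}\int_{-q^{-k}}^{tq^{-k}}& p_k\big(\mu_u;-\xi\sqrt{qt/s},\xi\sqrt{q/st},\tfrac z\xi\sqrt{qs/t};q\big)\,L_m\big(-\lambda zq^{1+r}/t;-\lambda q^{n-m},\lambda q^{n-m}/t;q\big)\\ &\times\phi_{\xi xq^r/s}\big(\lambda zq^r/t;-\tfrac{uq^{-r}}{\lambda\xi}\sqrt{qst},-\tfrac{q^{-r}}{u\lambda\xi}\sqrt{qst};q\big)\,\frac{(-zq^{1+k},zq^{1+k}/t;q)_\infty}{(\tfrac{zu^{\pm1}}{\xi}\sqrt{qs/t};q)_\infty}\,d_qz\\ =\;&(1-q)\,|\lambda|\,q^{(m+\frac12)(n-k)}q^{-\frac12r(r+1)}(\lambda\xi)^{-r}(\lambda/\xi)^m(st)^{r/2}(s/t)^{m/2}\\ &\times\frac{(q,xq^{1+n}/s,-xq^{1+n};q)_\infty\,\theta(-\lambda^2q/t;q)}{(-\xi xq^{1+r}/s,\tfrac{\lambda u^{\pm1}}{\xi}\sqrt{qs/t},-\tfrac{u^{\pm1}q^{-r}}{\lambda\xi}\sqrt{qst};q)_\infty}\;\frac{(-\xi q^{k-m+1},\xi q^{k-m+1}/s;q)_m}{(-\lambda q^{n-m+1},\lambda q^{n-m+1}/t;q)_m}\\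 &\times p_n\big(\mu_u;-\lambda\sqrt{qs/t},\lambda\sqrt{q/st},\tfrac x\lambda\sqrt{qt/s};q\big)\,L_m\big(-\xi xq^{1+r}/s;-\xi q^{k-m},\xi q^{k-m}/s;q\big).\end{aligned}$$
   Context: $\mathbb N=\{0,1,\dots\}$, $q^{\mathbb N-n}=\{q^{j-n}:j\in\mathbb N\}$, $\mu_u=\frac12(u+u^{-1})$. $(a;q)_\infty=\prod_{j\ge0}(1-aq^j)$, $(a;q)_n=(a;q)_\infty/(aq^n;q)_\infty$, $(a_1,\dots,a_r;q)_n=\prod_i(a_i;q)_n$, $(au^{\pm1};q)_n=(au,a/u;q)_n$, $\theta(a;q)=(a;q)_\infty(q/a;q)_\infty$; ${}_r\varphi_s(a_1,\dots,a_r;b_1,\dots,b_s;q,z)=\sum_{n\ge0}\frac{(a_1,\dots,a_r;q)_n}{(q,b_1,\dots,b_s;q)_n}((-1)^nq^{n(n-1)/2})^{1+s-r}z^n$. Jackson $q$-integral: $\int_0^\alpha f(z)\,d_qz=(1-q)\sum_{j\ge0}f(\alpha q^j)\alpha q^j$, $\int_\beta^\alpha=\int_0^\alpha-\int_0^\beta$. Continuous dual $q$-Hahn polynomials: $p_n(\mu_u;a,b,c;q)=a^{-n}(ab,ac;q)_n\,{}_3\varphi_2(q^{-n},au,a/u;ab,ac;q,q)$. Big $q$-Laguerre polynomials: $L_n(x;a,b;q)={}_3\varphi_2(q^{-n},0,x;aq,bq;q,q)$. $q$-Meixner functions: $\phi_\gamma(x;a,b;q)={}_2\varphi_2(-1/x,-1/\gamma;a,b;q,ab\gamma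 x)$.
   Formalization: For m>n or m>k an L_m has a vanishing lower parameter, so the display is undefined; it is proved literally for m≤min(k,n) and for all k,m,n after multiplying by the (.;q)_m denominator and cancelling zeros. p_n is read as a polynomial; denominators are assumed nonzero (matters only for u=±1). *)

theory Defs
  imports "HOL-Analysis.Analysis"
begin

text \<open>
  The base \<open>q\<close> is a real number throughout, with \<open>0 < q < 1\<close> in all applications; parameters are
  complex.
\<close>

definition qpoch_inf :: "complex \<Rightarrow> real \<Rightarrow> complex"
  where "qpoch_inf a q = (\<Prod>j. 1 - a * of_real q ^ j)"

text \<open>
  The finite symbol is the product of its factors. The quotient of infinite symbols, which is also
  used to define it, reads \<open>0 / 0\<close> for \<open>a = q\<^sup>-\<^sup>k\<close> and \<open>n \<le> k\<close>, a case that occurs in every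
  terminating series; elsewhere the two agree (\<open>qpoch_eq_ratio\<close>).
\<close>

definition qpoch :: "complex \<Rightarrow> real \<Rightarrow> nat \<Rightarrow> complex"
  where "qpoch a q n = (\<Prod>j<n. 1 - a * of_real q ^ j)"

definition qpochs_inf :: "complex list \<Rightarrow> real \<Rightarrow> complex"
  where "qpochs_inf as q = (\<Prod>a\<leftarrow>as. qpoch_inf a q)"

definition qpochs :: "complex list \<Rightarrow> real \<Rightarrow> nat \<Rightarrow> complex"
  where "qpochs as q n = (\<Prod>a\<leftarrow>as. qpoch a q n)"

definition qtheta :: "complex \<Rightarrow> real \<Rightarrow> complex"
  where "qtheta a q = qpoch_inf a q * qpoch_inf (of_real q / a) q"

definition qhyp :: "complex list \<Rightarrow> complex list \<Rightarrow> real \<Rightarrow> complex \<Rightarrow> complex"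
  where "qhyp as bs q z =
    (\<Sum>n. qpochs as q n / qpochs (of_real q # bs) q n
          * ((- 1) ^ n * of_real q ^ (n * (n - 1) div 2)) powi (1 + int (length bs) - int (length as))
          * z ^ n)"

definition jackson_integral0 :: "real \<Rightarrow> (real \<Rightarrow> complex) \<Rightarrow> real \<Rightarrow> complex"
  where "jackson_integral0 q f \<alpha> = of_real (1 - q) * (\<Sum>j. f (\<alpha> * q ^ j) * of_real (\<alpha> * q ^ j))"

definition jackson_integral :: "real \<Rightarrow> (real \<Rightarrow> complex) \<Rightarrow> real \<Rightarrow> real \<Rightarrow> complex"
  where "jackson_integral q f \<beta> \<alpha> = jackson_integral0 q f \<alpha> - jackson_integral0 q f \<beta>"

definition jackson_integrable :: "real \<Rightarrow> (real \<Rightarrow> complex) \<Rightarrow> real \<Rightarrow> real \<Rightarrow> bool"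
  where "jackson_integrable q f \<beta> \<alpha> \<longleftrightarrow>
    (\<forall>\<gamma>\<in>{\<alpha>, \<beta>}. summable (\<lambda>j. norm (f (\<gamma> * q ^ j) * of_real (\<gamma> * q ^ j))))"

definition qlattice :: "real \<Rightarrow> nat \<Rightarrow> real set"
  where "qlattice q n = {q powi (int j - int n) | j. True}"

text \<open>
  The continuous dual \<open>q\<close>-Hahn polynomial \<open>p\<^sub>n(\<mu>; a, b, c; q)\<close> at \<open>\<mu> = (u + 1/u) / 2\<close>.
  It is \<open>a\<^sup>-\<^sup>n (ab, ac; q)\<^sub>n\<close> times a terminating \<open>\<^sub>3\<phi>\<^sub>2\<close> series with lower parameters
  \<open>ab, ac\<close> (\<open>cdq_hahn_eq\<close>). The product is a polynomial in \<open>b\<close> and \<open>c\<close>, and it is that polynomial which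
  is needed: at the points \<open>-q\<^sup>j\<^sup>-\<^sup>n\<close> with \<open>j < n\<close> one has \<open>ac = q\<^sup>j\<^sup>-\<^sup>n\<^sup>+\<^sup>1\<close>, where the prefactor
  vanishes and terms of the series have a vanishing denominator. The definition therefore cancels
  \<open>(ab, ac; q)\<^sub>j\<close> termwise.
\<close>

definition cdq_hahn :: "nat \<Rightarrow> complex \<Rightarrow> complex \<Rightarrow> complex \<Rightarrow> complex \<Rightarrow> real \<Rightarrow> complex"
  where "cdq_hahn n u a b c q = inverse a ^ n *
    (\<Sum>j\<le>n. qpochs [of_real (q powi (- int n)), a * u, a / u] q j / qpoch (of_real q) q j * of_real q ^ j
           * qpochs [a * b * of_real q ^ j, a * c * of_real q ^ j] q (n - j))"

definition big_q_laguerre :: "nat \<Rightarrow> complex \<Rightarrow> complex \<Rightarrow> complex \<Rightarrow> real \<Rightarrow> complex"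
  where "big_q_laguerre m x a b q =
    qhyp [of_real (q powi (- int m)), 0, x] [a * of_real q, b * of_real q] q (of_real q)"

text \<open>
  If \<open>aq\<close> or \<open>bq\<close> is \<open>q\<^sup>-\<^sup>i\<close> with \<open>0 \<le> i < m\<close>, the big \<open>q\<close>-Laguerre polynomial does not exist, but its
  product with \<open>(aq, bq; q)\<^sub>m\<close> does. This is \<open>big_q_laguerre_cleared\<close>: the same cancellation as above.
  The third version is that product divided by \<open>(x; q)\<^sub>\<infinity>\<close>, again with the common factor
  \<open>(x; q)\<^sub>i\<close> of the \<open>i\<close>-th term cancelled. It is used where \<open>(x; q)\<^sub>\<infinity>\<close> vanishes but all terms
  with \<open>(xq\<^sup>i; q)\<^sub>\<infinity> = 0\<close> have coefficient \<open>0\<close>, so that the singularity in \<open>x\<close> is removable (the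
  terms in question are \<open>0 * (1 / 0) = 0\<close> in HOL, which is their limit).
\<close>

definition big_q_laguerre_cleared :: "nat \<Rightarrow> complex \<Rightarrow> complex \<Rightarrow> complex \<Rightarrow> real \<Rightarrow> complex"
  where "big_q_laguerre_cleared m x a b q =
    (\<Sum>i\<le>m. qpochs [of_real (q powi (- int m)), x] q i / qpoch (of_real q) q i * of_real q ^ i
           * qpochs [a * of_real q ^ (i + 1), b * of_real q ^ (i + 1)] q (m - i))"

definition big_q_laguerre_cleared_quot :: "nat \<Rightarrow> complex \<Rightarrow> complex \<Rightarrow> complex \<Rightarrow> real \<Rightarrow> complex"
  where "big_q_laguerre_cleared_quot m x a b q =
    (\<Sum>i\<le>m. qpoch (of_real (q powi (- int m))) q i / qpoch (of_real q) q i * of_real q ^ i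
           * qpochs [a * of_real q ^ (i + 1), b * of_real q ^ (i + 1)] q (m - i)
           / qpoch_inf (x * of_real q ^ i) q)"

definition q_meixner :: "complex \<Rightarrow> complex \<Rightarrow> complex \<Rightarrow> complex \<Rightarrow> real \<Rightarrow> complex"
  where "q_meixner \<gamma> x a b q = qhyp [- 1 / x, - 1 / \<gamma>] [a, b] q (a * b * \<gamma> * x)"


lemma qpoch_split: "j \<le> n \<Longrightarrow> qpoch a q n = qpoch a q j * qpoch (a * of_real q ^ j) q (n - j)"
proof (induction n)
  case (Suc n)
  show ?case
  proof (cases "j = Suc n")
    case False
    with Suc.prems have "j \<le> n" by simp
    with Suc.IH show ?thesis
      by (simp add: qpoch_def Suc_diff_le mult.assoc flip: power_add)
  qed (simp add: qpoch_def)
qed (simp add: qpoch_def)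

lemma qpoch_inf_split:
  assumes "\<bar>q\<bar> < 1"
  shows "qpoch_inf a q = qpoch a q n * qpoch_inf (a * of_real q ^ n) q"
proof -
  have "summable (\<lambda>j. norm (- a * of_real q ^ j))"
    using assms by (auto simp: norm_mult norm_power intro!: summable_mult summable_geometric)
  then have "abs_convergent_prod (\<lambda>j. 1 + (- a * of_real q ^ j))"
    by (intro summable_imp_abs_convergent_prod) simp
  then have "convergent_prod (\<lambda>j. 1 - a * of_real q ^ j)"
    by (simp add: abs_convergent_prod_imp_convergent_prod)
  then have conv': "convergent_prod (\<lambda>j. 1 - a * of_real q ^ (j + n))"
    by (rule convergent_prod_ignore_initial_segment)
  have "(\<lambda>N. \<Prod>j\<le>N. 1 - a * of_real q ^ j) \<longlonglongrightarrow> qpoch_inf a q"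
    unfolding qpoch_inf_def
    using \<open>convergent_prod (\<lambda>j. 1 - a * of_real q ^ j)\<close> by (rule convergent_prod_LIMSEQ)
  then have lim1: "(\<lambda>N. qpoch a q (Suc N)) \<longlonglongrightarrow> qpoch_inf a q"
    by (simp add: qpoch_def lessThan_Suc_atMost)
  have "(\<lambda>N. \<Prod>j\<le>N. 1 - (a * of_real q ^ n) * of_real q ^ j) \<longlonglongrightarrow> qpoch_inf (a * of_real q ^ n) q"
    unfolding qpoch_inf_def
    by (rule convergent_prod_LIMSEQ) (use conv' in \<open>simp add: power_add mult_ac\<close>)
  then have "(\<lambda>N. qpoch a q n * qpoch (a * of_real q ^ n) q (Suc N))
      \<longlonglongrightarrow> qpoch a q n * qpoch_inf (a * of_real q ^ n) q"
    by (intro tendsto_mult_left) (simp add: qpoch_def lessThan_Suc_atMost)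
  moreover have "qpoch a q n * qpoch (a * of_real q ^ n) q (Suc N) = qpoch a q (Suc (N + n))" for N
    using qpoch_split[of n "Suc (N + n)" a q] by (simp add: Suc_diff_le)
  ultimately show ?thesis
    using LIMSEQ_unique[OF LIMSEQ_ignore_initial_segment[OF lim1, of n]] by simp
qed

lemma qpoch_eq_ratio:
  assumes "\<bar>q\<bar> < 1" "qpoch_inf (a * of_real q ^ n) q \<noteq> 0"
  shows "qpoch a q n = qpoch_inf a q / qpoch_inf (a * of_real q ^ n) q"
  using assms by (simp add: qpoch_inf_split[of q a n])

lemma qpoch_minus_eq_0:
  assumes "q \<noteq> 0" "n < j"
  shows "qpoch (of_real (q powi (- int n))) q j = 0"
proof -
  have "1 - complex_of_real (q powi (- int n)) * of_real q ^ n = 0"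
    using assms by (simp add: power_int_minus flip: of_real_power of_real_mult)
  with assms(2) show ?thesis unfolding qpoch_def by (intro prod_zero) auto
qed

lemma qhyp32_terminating:
  assumes "q \<noteq> 0"
  shows "qhyp [of_real (q powi (- int n)), a, b] [c, d] q z =
    (\<Sum>j\<le>n. qpochs [of_real (q powi (- int n)), a, b] q j / qpochs [of_real q, c, d] q j * z ^ j)"
  unfolding qhyp_def
  by (subst suminf_finite[of "{..n}"])
    (auto simp: qpochs_def qpoch_minus_eq_0[OF assms] simp del: of_real_power_int)

theorem cdq_hahn_eq:
  assumes "q \<noteq> 0" "qpochs [a * b, a * c] q n \<noteq> 0"
  shows "cdq_hahn n u a b c q = inverse a ^ n * qpochs [a * b, a * c] q n
    * qhyp [of_real (q powi (- int n)), a * u, a / u] [a * b, a * c] q (of_real q)"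
  unfolding cdq_hahn_def qhyp32_terminating[OF assms(1)] sum_distrib_left
proof (intro sum.cong refl, goal_cases)
  case (1 j)
  then have j: "j \<le> n" by simp
  show ?case using assms(2) by (simp add: qpochs_def qpoch_split[OF j])
qed

lemma qpoch_q_nonzero: "\<bar>q\<bar> < 1 \<Longrightarrow> qpoch (of_real q) q n \<noteq> 0"
proof
  assume q: "\<bar>q\<bar> < 1" and "qpoch (of_real q) q n = 0"
  then obtain j where "complex_of_real q ^ Suc j = 1" by (auto simp: qpoch_def)
  then have "norm (complex_of_real q ^ Suc j) = 1" by simp
  with q power_less_one_iff[of "\<bar>q\<bar>" "Suc j"] show False by (simp add: norm_power norm_mult)
qed

theorem continuous_cdq_hahn:
  assumes "\<bar>q\<bar> < 1"
  shows "continuous_on UNIV (\<lambda>(b, c). cdq_hahn n u a b c q)"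
proof -
  have *: "continuous_on UNIV (\<lambda>p. qpoch (g p) q j)" if "continuous_on UNIV g"
    for g :: "complex \<times> complex \<Rightarrow> complex" and j
    unfolding qpoch_def by (intro continuous_intros that)
  show ?thesis
    unfolding cdq_hahn_def qpochs_def case_prod_unfold
    by (auto intro!: continuous_intros * simp: qpoch_q_nonzero[OF assms])
qed

theorem big_q_laguerre_cleared_eq:
  assumes "q \<noteq> 0" "qpochs [a * of_real q, b * of_real q] q m \<noteq> 0"
  shows "big_q_laguerre_cleared m x a b q
    = qpochs [a * of_real q, b * of_real q] q m * big_q_laguerre m x a b q"
  unfolding big_q_laguerre_cleared_def big_q_laguerre_def qhyp32_terminating[OF assms(1)] sum_distrib_left
proof (intro sum.cong refl, goal_cases)
  case (1 j)
  then have j: "j \<le> m" by simp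
  have "qpoch 0 q j = 1" by (simp add: qpoch_def)
  moreover have shift: "c * of_real q ^ (j + 1) = c * of_real q * of_real q ^ j" for c :: complex
    by simp
  ultimately show ?case using assms(2)
    unfolding qpochs_def shift by (simp add: qpoch_split[OF j])
qed

theorem continuous_big_q_laguerre_cleared:
  assumes "\<bar>q\<bar> < 1"
  shows "continuous_on UNIV (\<lambda>(x, a, b). big_q_laguerre_cleared m x a b q)"
proof -
  have *: "continuous_on UNIV (\<lambda>p. qpoch (g p) q j)" if "continuous_on UNIV g"
    for g :: "complex \<times> complex \<times> complex \<Rightarrow> complex" and j
    unfolding qpoch_def by (intro continuous_intros that)
  show ?thesis
    unfolding big_q_laguerre_cleared_def qpochs_def case_prod_unfold
    by (auto intro!: continuous_intros * simp: qpoch_q_nonzero[OF assms])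
qed

theorem big_q_laguerre_cleared_quot_eq:
  assumes "\<bar>q\<bar> < 1" "qpoch_inf x q \<noteq> 0"
  shows "big_q_laguerre_cleared_quot m x a b q = big_q_laguerre_cleared m x a b q / qpoch_inf x q"
  unfolding big_q_laguerre_cleared_quot_def big_q_laguerre_cleared_def sum_divide_distrib
proof (intro sum.cong refl, goal_cases)
  case (1 i)
  then show ?case using assms(2)
    by (simp add: qpochs_def qpoch_inf_split[OF assms(1), of x i] divide_simps)
qed

end

theory Submission
  imports Defs
begin

text \<open>
  Write \<open>\<xi>' = -s/\<xi>\<close>, \<open>\<lambda>' = -t/\<lambda>\<close>, \<open>\<sigma> = \<xi>'/\<xi>\<close>, \<open>\<tau> = \<lambda>'/\<lambda>\<close>, \<open>X = x/\<xi>'\<close>, \<open>Z = z/\<lambda>'\<close> and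
  \<open>\<kappa> = -\<surd>(qst)/(\<lambda>\<xi>)\<close>, so that \<open>\<kappa>\<^sup>2 = q\<sigma>\<tau>\<close>. All choices of \<open>\<xi>\<close> and \<open>\<lambda>\<close> then become one identity in
  \<open>\<sigma>, \<tau>, \<kappa>, X, Z\<close>, with the \<open>z\<close>-dependent parameter of \<open>p\<^sub>k\<close> equal to \<open>\<kappa>Z\<close> and the Meixner kernel symmetric in \<open>X\<close> and \<open>Z\<close>.

  With the weight absorbed, the continuous dual \<open>q\<close>-Hahn polynomials have a Rodrigues-type structure:
  the \<open>q\<close>-derivative in \<open>Z\<close> raises \<open>k\<close> by one. The adjoint of this operator (summation by parts)
  lowers the kernel's parameter \<open>r\<close> and, by the \<open>q\<close>-Leibniz rule, turns the factor \<open>L\<^sub>m\<close> into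
  two contiguous ones. This reduces the integral for \<open>k + 1\<close> to two integrals for \<open>k\<close>; a raising operator
  in \<open>X\<close> does the same for \<open>n\<close>. The right-hand side obeys the same recurrences. In the base case
  \<open>k = n = 0\<close> the integral \<open>B(X)\<close> satisfies \<open>B(X) = (1 - q\<sigma>X) B(qX)\<close> if \<open>m = 0\<close>, its value at \<open>X = 1\<close> is an
  Andrews-Askey \<open>q\<close>-beta integral, and lowering \<open>r\<close> in \<open>X\<close> gives all \<open>m\<close>.
\<close>

text \<open>The recurrences lead through cases such as \<open>k = n = 0 < m\<close>, in which the
  big q-Laguerre polynomial inside the integral has vanishing denominators. Hence every object is
  carried with its denominators multiplied out; the only denominator left that depends on
  \<open>Z\<close> is \<open>pochpair Z\<close>, which is required to be nonzero on the lattice of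
  summation.

  The recurrences in \<open>Z\<close> and in \<open>X\<close> arise differently. In
  \<open>Z\<close>, summation by parts leaves no boundary term because the weighted polynomial
  vanishes one lattice step outside the range of the sum. In \<open>X\<close> nothing is summed by
  parts: a relation between the kernels at \<open>X\<close> and \<open>qX\<close> is integrated as
  it stands, and a contiguous relation of \<open>L_m\<close> adjusts the other factor. Solving for
  the next member means dividing by \<kappa> in the first case and by a multiple of \<open>X\<close>
  in the second, whence \<open>X\<close> must be nonzero.\<close>

locale qbase =
  fixes q :: real
  assumes q_pos: "0 < q" and q_less_1: "q < 1"
begin

abbreviation Q :: complex where "Q \<equiv> of_real q"

lemma Q_nz [simp]: "Q \<noteq> 0" "q \<noteq> 0"
  using q_pos by auto

lemma abs_q_less_1 [simp]: "\<bar>q\<bar> < 1"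
  using q_pos q_less_1 by simp

lemma norm_Q_power [simp]: "norm (Q ^ n) = q ^ n"
  using q_pos by (simp add: norm_power)

lemma Q_power_nz_1: "n > 0 \<Longrightarrow> Q ^ n \<noteq> 1"
proof
  assume n: "n > 0" and "Q ^ n = 1"
  then have "q ^ n = 1" using norm_Q_power[of n] by simp
  with n q_pos q_less_1 power_less_one_iff[of q n] show False by simp
qed

lemma Q_powi_add: "Q powi (i + j) = Q powi i * Q powi j"
  by (simp add: power_int_add)

lemma Q_powi_Suc: "Q powi (i + 1) = Q powi i * Q"
  by (simp add: power_int_add)

lemma Q_powi_pred: "Q powi (i - 1) = Q powi i / Q"
  by (simp add: power_int_diff)

lemma Q_power_powi_minus: "Q ^ m * Q powi (- int m) = 1"
  by (simp add: power_int_minus)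

subsection \<open>Shifted factorials\<close>

lemma qpoch_0 [simp]: "qpoch a q 0 = 1"
  by (simp add: qpoch_def)

lemma qpoch_Suc: "qpoch a q (Suc n) = qpoch a q n * (1 - a * Q ^ n)"
  by (simp add: qpoch_def)

lemma qpoch_Suc_left: "qpoch a q (Suc n) = (1 - a) * qpoch (a * Q) q n"
  using qpoch_split[of 1 "Suc n" a q] by (simp add: qpoch_Suc)

lemma qpoch_shift: "(1 - a) * qpoch (a * Q) q n = qpoch a q n * (1 - a * Q ^ n)"
  using qpoch_Suc qpoch_Suc_left by metis

lemma qpoch_Q_nz [simp]: "qpoch Q q n \<noteq> 0"
  by (rule qpoch_q_nonzero) simp

lemma qpoch_inf_unfold: "qpoch_inf a q = (1 - a) * qpoch_inf (a * Q) q"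
  using qpoch_inf_split[of q a 1] by (simp add: qpoch_Suc)

lemma convergent_prod_qpoch: "convergent_prod (\<lambda>j. 1 - a * Q ^ j)"
proof -
  have "summable (\<lambda>j. norm (- a * Q ^ j))"
    by (auto simp: norm_mult norm_power intro!: summable_mult summable_geometric)
  then have "abs_convergent_prod (\<lambda>j. 1 + (- a * Q ^ j))"
    by (intro summable_imp_abs_convergent_prod) simp
  then show ?thesis
    by (simp add: abs_convergent_prod_imp_convergent_prod)
qed

lemma qpoch_LIMSEQ: "(\<lambda>n. qpoch a q n) \<longlonglongrightarrow> qpoch_inf a q"
proof -
  have "(\<lambda>N. \<Prod>j\<le>N. 1 - a * Q ^ j) \<longlonglongrightarrow> qpoch_inf a q"
    unfolding qpoch_inf_def by (intro convergent_prod_LIMSEQ convergent_prod_qpoch)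
  then have "(\<lambda>N. qpoch a q (Suc N)) \<longlonglongrightarrow> qpoch_inf a q"
    by (simp add: qpoch_def lessThan_Suc_atMost)
  then show ?thesis by (rule LIMSEQ_imp_Suc)
qed

lemma qpoch_inf_0 [simp]: "qpoch_inf 0 q = 1"
  by (simp add: qpoch_inf_def)

lemma qpoch_inf_nz: "(\<And>j. a * Q ^ j \<noteq> 1) \<Longrightarrow> qpoch_inf a q \<noteq> 0"
  unfolding qpoch_inf_def by (intro prodinf_nonzero convergent_prod_qpoch) (metis right_minus_eq)

lemma qpoch_inf_shift_nz: "qpoch_inf a q \<noteq> 0 \<Longrightarrow> qpoch_inf (a * Q ^ n) q \<noteq> 0"
  using qpoch_inf_split[of q a n] by auto

lemma qpoch_inf_Q_nz: "qpoch_inf Q q \<noteq> 0"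
  using Q_power_nz_1[of "Suc _"] by (intro qpoch_inf_nz) simp

lemma prod_one_plus_le_exp:
  assumes "c \<ge> 0"
  shows "(\<Prod>j<n. 1 + c * q ^ j) \<le> exp (c / (1 - q))"
proof -
  have "(\<Prod>j<n. 1 + c * q ^ j) \<le> exp (\<Sum>j<n. c * q ^ j)"
    using assms q_pos by (intro prod_le_exp_sum) auto
  also have "(\<Sum>j<n. c * q ^ j) \<le> (\<Sum>j. c * q ^ j)"
    using assms q_pos q_less_1 by (intro sum_le_suminf summable_mult summable_geometric) auto
  also have "\<dots> = c / (1 - q)"
    using q_pos q_less_1 by (subst suminf_mult) (auto simp: suminf_geometric summable_geometric)
  finally show ?thesis by simp
qed

lemma norm_qpoch_le: "norm (qpoch a q n) \<le> exp (norm a / (1 - q))"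
proof -
  have "norm (qpoch a q n) \<le> (\<Prod>j<n. 1 + norm a * q ^ j)"
    unfolding qpoch_def prod_norm[symmetric]
  proof (intro prod_mono conjI)
    fix j
    show "norm (1 - a * Q ^ j) \<le> 1 + norm a * q ^ j"
      using norm_triangle_ineq4[of 1 "a * Q ^ j"] by (simp add: norm_mult)
  qed simp
  then show ?thesis using prod_one_plus_le_exp[of "norm a" n] by simp
qed

lemma norm_qpoch_inf_minus_1_le: "norm (qpoch_inf a q - 1) \<le> exp (norm a / (1 - q)) - 1"
proof (rule LIMSEQ_le_const2)
  show "(\<lambda>n. norm (qpoch a q n - 1)) \<longlonglongrightarrow> norm (qpoch_inf a q - 1)"
    by (intro tendsto_intros qpoch_LIMSEQ)
  have "norm (qpoch a q n - 1) \<le> (\<Prod>j<n. 1 + norm a * q ^ j) - 1" for n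
    using norm_prod_minus1_le_prod_minus1[of "\<lambda>j. - a * Q ^ j" "{..<n}"] q_pos
    by (simp add: qpoch_def norm_mult norm_power)
  then show "\<exists>N. \<forall>n\<ge>N. norm (qpoch a q n - 1) \<le> exp (norm a / (1 - q)) - 1"
    using prod_one_plus_le_exp[of "norm a"] by (meson diff_right_mono norm_ge_zero order_trans)
qed

text \<open>Zero is the only accumulation point of the lattices that are summed over, so continuity
  at this one point is what the summability and telescoping arguments ask of an integrand.\<close>

lemma isCont_qpoch_inf_0: "isCont (\<lambda>a. qpoch_inf a q) 0"
proof -
  have "((\<lambda>a. exp (norm (a::complex) / (1 - q)) - 1) \<longlongrightarrow> exp (norm (0::complex) / (1 - q)) - 1) (at 0)"
    using q_less_1 by (intro tendsto_intros) auto
  then have "((\<lambda>a. exp (norm (a::complex) / (1 - q)) - 1) \<longlongrightarrow> 0) (at 0)"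
    by simp
  then have "((\<lambda>a. qpoch_inf a q - 1) \<longlongrightarrow> 0) (at 0)"
    by (rule Lim_null_comparison[rotated]) (auto intro: always_eventually norm_qpoch_inf_minus_1_le)
  then have "((\<lambda>a. qpoch_inf a q) \<longlongrightarrow> 1) (at 0)"
    by (simp add: LIM_zero_iff)
  then show ?thesis by (simp add: isCont_def)
qed

lemma isCont_qpoch_inf_mult [continuous_intros]: "isCont (\<lambda>z. qpoch_inf (a * z) q) 0"
  using isCont_o2[of 0 "\<lambda>z. a * z" "\<lambda>a. qpoch_inf a q"] isCont_qpoch_inf_0 by simp

lemma Q_power_tendsto_0: "(\<lambda>n. Q ^ n) \<longlonglongrightarrow> 0"
  by (intro LIMSEQ_power_zero) (use q_pos q_less_1 in simp)

lemma isCont_0_lattice: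
  assumes "isCont f (0::complex)"
  shows "(\<lambda>n. f (a * Q ^ n)) \<longlonglongrightarrow> (f 0 :: complex)"
proof (rule isCont_tendsto_compose[OF assms])
  show "(\<lambda>n. a * Q ^ n) \<longlonglongrightarrow> 0"
    using tendsto_mult_right_zero[OF Q_power_tendsto_0] by simp
qed

subsection \<open>Big \<open>q\<close>-Laguerre polynomials\<close>

text \<open>
  The sums defining \<open>big_q_laguerre_cleared\<close> and its quotient version, with summation index
  \<open>h = m - i\<close>. In \<open>laguerre_quot\<close> the quotient of infinite products is already cancelled; there the truncated
  \<open>k - h\<close> is harmless because \<open>laguerre_fac \<sigma> k h = 0\<close> for \<open>h > k\<close>.
\<close>

definition laguerre_coef :: "nat \<Rightarrow> nat \<Rightarrow> complex" where
  "laguerre_coef m h = qpoch (Q powi (- int m)) q (m - h) / qpoch Q q (m - h) * Q ^ (m - h)"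

text \<open>With \<open>a = q^(n-m)\<close> and \<open>b = a/\<tau>\<close> this is the symbol
  \<open>(a q^(m-h+1), b q^(m-h+1); q)_h\<close> with its factors in reverse order. Reversal removes
  \<open>m\<close> from the formula, so sums with different \<open>m\<close> share these
  factors.\<close>

definition laguerre_fac :: "complex \<Rightarrow> nat \<Rightarrow> nat \<Rightarrow> complex" where
  "laguerre_fac \<tau> n h = (\<Prod>j<h. (1 - Q powi (int n - int j)) * (1 - Q powi (int n - int j) / \<tau>))"

definition laguerre_sum :: "complex \<Rightarrow> nat \<Rightarrow> nat \<Rightarrow> complex \<Rightarrow> complex" where
  "laguerre_sum \<tau> m n y = (\<Sum>h\<le>m. laguerre_coef m h * laguerre_fac \<tau> n h * qpoch y q (m - h))"

definition laguerre_quot :: "complex \<Rightarrow> nat \<Rightarrow> nat \<Rightarrow> complex \<Rightarrow> complex" where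
  "laguerre_quot \<sigma> k m w = (\<Sum>h\<le>m. laguerre_coef m h * laguerre_fac \<sigma> k h * qpoch w q (k - h))"

lemma laguerre_fac_0 [simp]: "laguerre_fac \<tau> n 0 = 1"
  by (simp add: laguerre_fac_def)

lemma laguerre_fac_Suc: "laguerre_fac \<tau> n (Suc h) =
    laguerre_fac \<tau> n h * ((1 - Q powi (int n - int h)) * (1 - Q powi (int n - int h) / \<tau>))"
  by (simp add: laguerre_fac_def)

lemma laguerre_fac_Suc_Suc: "laguerre_fac \<tau> (Suc n) (Suc h) = (1 - Q ^ Suc n) * (1 - Q ^ Suc n / \<tau>) * laguerre_fac \<tau> n h"
  unfolding laguerre_fac_def
  by (subst prod.lessThan_Suc_shift) (simp add: power_int_def nat_add_distrib)

lemma laguerre_fac_eq_0: "n < h \<Longrightarrow> laguerre_fac \<tau> n h = 0"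
  unfolding laguerre_fac_def by (rule prod_zero) (auto intro!: bexI[of _ n])

text \<open>Both coefficients contain a product of \<open>m - h\<close> factors, starting at
  \<open>q^(-m-1)\<close> and at \<open>q^(-m)\<close>. Moving the start by one exchanges the first
  factor of one product for the last factor of the other, which is
  \<open>1 - q^(-h-1)\<close>.\<close>

lemma laguerre_coef_Suc_Suc:
  assumes "h \<le> m"
  shows "laguerre_coef (Suc m) (Suc h) * (1 - Q ^ Suc h)
    = - (Q ^ Suc h) * (1 - Q powi (- int (Suc m))) * laguerre_coef m h"
proof -
  define a where "a = Q powi (- int (Suc m))"
  have aQ: "a * Q = Q powi (- int m)"
    by (simp add: a_def power_int_diff power_int_minus_divide)
  have "a * Q ^ (m - h) = 1 / Q ^ Suc h"
    using assms by (simp add: a_def power_int_diff power_int_minus field_simps flip: power_add power_Suc)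
  with qpoch_shift[of a "m - h"]
  have "(1 - a) * qpoch (Q powi (- int m)) q (m - h) = qpoch a q (m - h) * (1 - 1 / Q ^ Suc h)"
    by (simp add: aQ)
  then have "qpoch a q (m - h) * (1 - Q ^ Suc h) = - (Q ^ Suc h) * ((1 - a) * qpoch (Q powi (- int m)) q (m - h))"
    by (simp add: field_simps del: power_Suc)
  then have "qpoch a q (m - h) * (1 - Q ^ Suc h) / qpoch Q q (m - h) * Q ^ (m - h)
      = - (Q ^ Suc h) * ((1 - a) * qpoch (Q powi (- int m)) q (m - h)) / qpoch Q q (m - h) * Q ^ (m - h)"
    by simp
  then show ?thesis
    unfolding laguerre_coef_def diff_Suc_Suc a_def[symmetric] by (simp only: times_divide_eq_left times_divide_eq_right mult_ac)
qed

lemma laguerre_coef_Suc_left: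
  assumes "h \<le> m"
  shows "laguerre_coef (Suc m) h * (1 - Q powi (int h - int (Suc m)))
    = - (Q powi (int h - int m)) * (1 - Q powi (- int (Suc m))) * laguerre_coef m h"
proof -
  define a where "a = Q powi (- int (Suc m))"
  define j where "j = m - h"
  have m: "Suc m - h = Suc j" "m - h = j" "int h - int (Suc m) = - int (Suc j)" "int h - int m = - int j"
    using assms by (auto simp: j_def)
  have aQ: "a * Q = Q powi (- int m)"
    by (simp add: a_def power_int_diff power_int_minus_divide)
  have 1: "Q ^ Suc j \<noteq> 1" by (rule Q_power_nz_1) simp
  have "qpoch Q q (Suc j) = qpoch Q q j * (1 - Q ^ Suc j)"
    by (simp add: qpoch_Suc)
  moreover have "qpoch a q (Suc j) = (1 - a) * qpoch (Q powi (- int m)) q j"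
    by (simp add: qpoch_Suc_left aQ)
  moreover have "1 - Q powi (- int (Suc j)) = - (1 - Q ^ Suc j) / Q ^ Suc j"
    by (simp add: power_int_minus power_int_of_nat field_simps del: of_nat_Suc power_Suc)
  moreover have "Q powi (- int j) = Q / Q ^ Suc j"
    by (simp add: power_int_minus field_simps)
  ultimately have "laguerre_coef (Suc m) h * (1 - Q powi (int h - int (Suc m)))
      = (1 - a) * qpoch (Q powi (- int m)) q j / (qpoch Q q j * (1 - Q ^ Suc j)) * Q ^ Suc j
        * (- (1 - Q ^ Suc j) / Q ^ Suc j)"
    unfolding laguerre_coef_def m a_def[symmetric] by (simp only:)
  also have "\<dots> = - ((1 - a) * qpoch (Q powi (- int m)) q j / qpoch Q q j)"
  proof -
    have "x / (D * c) * p * (- c / p) = - (x / D)" if "c \<noteq> 0" "p \<noteq> 0" for x D c p :: complex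
      using that by simp
    from this[of "1 - Q ^ Suc j" "Q ^ Suc j"] 1 show ?thesis by (simp del: power_Suc)
  qed
  also have "\<dots> = - ((1 - a) * qpoch (Q powi (- int m)) q j / qpoch Q q j) * (Q ^ j * Q powi (- int j))"
    by (simp add: Q_power_powi_minus)
  finally show ?thesis
    unfolding laguerre_coef_def m a_def[symmetric] by (simp add: mult_ac)
qed

text \<open>
  The shared coefficient identity behind the contiguous relations of \<open>laguerre_sum\<close> and \<open>laguerre_quot\<close>; only the
  basis \<open>v\<close> differs.
\<close>

lemma laguerre_coef_recombine:
  fixes v :: "nat \<Rightarrow> complex"
  assumes "\<sigma> \<noteq> 0"
  shows "Q ^ m * (\<Sum>h\<le>m. laguerre_coef m h * laguerre_fac \<sigma> n h *
             (Q powi (int h - int m) * v h + (1 - Q powi (int h - int m)) * v (Suc h)))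
    = (\<Sum>h\<le>m. laguerre_coef m h * laguerre_fac \<sigma> (Suc n) h * v h)
      - (1 - Q powi (- int m)) * (Q ^ (2 * Suc n) / \<sigma>)
        * (\<Sum>h\<le>m - 1. laguerre_coef (m - 1) h * laguerre_fac \<sigma> n h * v (Suc h))"
proof (cases m)
  case 0
  then show ?thesis by simp
next
  case (Suc M)
  define g where "g = (1 - Q powi (- int (Suc M)))"
  have qm: "Q ^ Suc M * Q powi (int h - int (Suc M)) = Q ^ h" for h
    by (simp add: power_int_diff power_int_of_nat field_simps del: of_nat_Suc power_Suc)
  \<comment> \<open>Comparison of the coefficients of \<open>v (Suc h)\<close>. The term
    \<open>v 0\<close> has the coefficient \<open>laguerre_coef (Suc M) 0\<close> on both
    sides.\<close>
  have coef: "laguerre_coef (Suc M) (Suc h) * laguerre_fac \<sigma> n (Suc h) * Q ^ Suc h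
      + Q ^ Suc M * (laguerre_coef (Suc M) h * (1 - Q powi (int h - int (Suc M)))) * laguerre_fac \<sigma> n h
     = laguerre_coef (Suc M) (Suc h) * laguerre_fac \<sigma> (Suc n) (Suc h) - g * (Q ^ (2 * Suc n) / \<sigma>) * (laguerre_coef M h * laguerre_fac \<sigma> n h)"
    if h: "h \<le> M" for h
  proof -
    define a b p where "a = Q ^ Suc n" and "b = a / \<sigma>" and "p = Q ^ Suc h"
    have p: "p \<noteq> 0" by (simp add: p_def)
    have e: "Q powi (int n - int h) = a / p"
      by (simp add: a_def p_def power_int_diff field_simps)
    have A1: "laguerre_coef (Suc M) (Suc h) * (1 - p) = - p * g * laguerre_coef M h"
      using laguerre_coef_Suc_Suc[OF h] by (simp add: p_def g_def)
    have A2: "Q ^ Suc M * (laguerre_coef (Suc M) h * (1 - Q powi (int h - int (Suc M)))) = - p * g * laguerre_coef M h"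
    proof -
      have "Q ^ Suc M * Q powi (int h - int M) = p"
        using h by (simp add: p_def power_int_diff power_int_of_nat field_simps)
      then show ?thesis
        unfolding laguerre_coef_Suc_left[OF h] g_def by (simp add: mult.assoc[symmetric] del: of_nat_Suc power_Suc)
    qed
    \<comment> \<open>The factor \<open>1 - p\<close> split off here is the one that
      \<open>laguerre_coef_Suc_Suc\<close> converts into a coefficient for \<open>M\<close>. Of the
      remaining \<open>1 - a b / p\<close>, the part \<open>1\<close> cancels against the second sum
      and the part \<open>a b / p\<close> gives the term with \<open>m - 1\<close>.\<close>
    have k: "(1 - a) * (1 - b) - p * ((1 - a / p) * (1 - b / p)) = (1 - p) * (1 - a * b / p)"
      using p by (simp add: field_simps)
    have ab: "Q ^ (2 * Suc n) / \<sigma> = a * b"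
      by (simp only: a_def b_def mult_2 power_add times_divide_eq_right)
    have "laguerre_coef (Suc M) (Suc h) * laguerre_fac \<sigma> (Suc n) (Suc h) - laguerre_coef (Suc M) (Suc h) * laguerre_fac \<sigma> n (Suc h) * p
        = laguerre_coef (Suc M) (Suc h) * ((1 - a) * (1 - b) - p * ((1 - a / p) * (1 - b / p))) * laguerre_fac \<sigma> n h"
      unfolding laguerre_fac_Suc_Suc unfolding laguerre_fac_Suc e by (simp add: a_def b_def algebra_simps)
    also have "\<dots> = (laguerre_coef (Suc M) (Suc h) * (1 - p)) * (1 - a * b / p) * laguerre_fac \<sigma> n h"
      unfolding k by simp
    also have "\<dots> = - g * (p - a * b) * laguerre_coef M h * laguerre_fac \<sigma> n h"
      unfolding A1 using p by (simp add: field_simps)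
    finally show ?thesis
      unfolding A2 ab p_def[symmetric] by (simp add: algebra_simps)
  qed
  have "Q ^ m * (\<Sum>h\<le>m. laguerre_coef m h * laguerre_fac \<sigma> n h *
             (Q powi (int h - int m) * v h + (1 - Q powi (int h - int m)) * v (Suc h)))
     = (\<Sum>h\<le>Suc M. laguerre_coef (Suc M) h * laguerre_fac \<sigma> n h * Q ^ h * v h)
       + (\<Sum>h\<le>Suc M. Q ^ Suc M * (laguerre_coef (Suc M) h * (1 - Q powi (int h - int (Suc M)))) * laguerre_fac \<sigma> n h * v (Suc h))"
    unfolding Suc sum_distrib_left sum.distrib[symmetric]
  proof (intro sum.cong refl)
    fix h
    show "Q ^ Suc M * (laguerre_coef (Suc M) h * laguerre_fac \<sigma> n h *
        (Q powi (int h - int (Suc M)) * v h + (1 - Q powi (int h - int (Suc M))) * v (Suc h)))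
      = laguerre_coef (Suc M) h * laguerre_fac \<sigma> n h * Q ^ h * v h
        + Q ^ Suc M * (laguerre_coef (Suc M) h * (1 - Q powi (int h - int (Suc M)))) * laguerre_fac \<sigma> n h * v (Suc h)"
      using qm[of h, symmetric] by (simp add: algebra_simps del: power_Suc of_nat_Suc)
  qed
  also have "(\<Sum>h\<le>Suc M. Q ^ Suc M * (laguerre_coef (Suc M) h * (1 - Q powi (int h - int (Suc M)))) * laguerre_fac \<sigma> n h * v (Suc h))
     = (\<Sum>h\<le>M. Q ^ Suc M * (laguerre_coef (Suc M) h * (1 - Q powi (int h - int (Suc M)))) * laguerre_fac \<sigma> n h * v (Suc h))"
    by (subst sum.atMost_Suc) simp
  also have "(\<Sum>h\<le>Suc M. laguerre_coef (Suc M) h * laguerre_fac \<sigma> n h * Q ^ h * v h)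
     = laguerre_coef (Suc M) 0 * v 0 + (\<Sum>h\<le>M. laguerre_coef (Suc M) (Suc h) * laguerre_fac \<sigma> n (Suc h) * Q ^ Suc h * v (Suc h))"
    by (subst sum.atMost_Suc_shift) simp
  also have "\<dots> + (\<Sum>h\<le>M. Q ^ Suc M * (laguerre_coef (Suc M) h * (1 - Q powi (int h - int (Suc M)))) * laguerre_fac \<sigma> n h * v (Suc h))
     = laguerre_coef (Suc M) 0 * v 0 + (\<Sum>h\<le>M. (laguerre_coef (Suc M) (Suc h) * laguerre_fac \<sigma> n (Suc h) * Q ^ Suc h
      + Q ^ Suc M * (laguerre_coef (Suc M) h * (1 - Q powi (int h - int (Suc M)))) * laguerre_fac \<sigma> n h) * v (Suc h))"
    unfolding distrib_right sum.distrib by (simp only: add.assoc)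
  also have "\<dots> = laguerre_coef (Suc M) 0 * v 0 + (\<Sum>h\<le>M. (laguerre_coef (Suc M) (Suc h) * laguerre_fac \<sigma> (Suc n) (Suc h)
        - g * (Q ^ (2 * Suc n) / \<sigma>) * (laguerre_coef M h * laguerre_fac \<sigma> n h)) * v (Suc h))"
    by (intro arg_cong2[of _ _ _ _ "(+)"] refl sum.cong) (simp only: coef atMost_iff)
  also have "\<dots> = (laguerre_coef (Suc M) 0 * v 0 + (\<Sum>h\<le>M. laguerre_coef (Suc M) (Suc h) * laguerre_fac \<sigma> (Suc n) (Suc h) * v (Suc h)))
        - g * (Q ^ (2 * Suc n) / \<sigma>) * (\<Sum>h\<le>M. laguerre_coef M h * laguerre_fac \<sigma> n h * v (Suc h))"
    unfolding left_diff_distrib sum_subtractf sum_distrib_left by (simp only: mult.assoc add_diff_eq)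
  also have "laguerre_coef (Suc M) 0 * v 0 + (\<Sum>h\<le>M. laguerre_coef (Suc M) (Suc h) * laguerre_fac \<sigma> (Suc n) (Suc h) * v (Suc h))
     = (\<Sum>h\<le>Suc M. laguerre_coef (Suc M) h * laguerre_fac \<sigma> (Suc n) h * v h)"
    by (subst sum.atMost_Suc_shift) simp
  finally show ?thesis by (simp only: Suc g_def diff_Suc_1)
qed

text \<open>The factor \<open>1 - y/q\<close> equals
  \<open>q^(-j-1) (1 - y q^j) + (1 - q^(-j-1))\<close>, so \<open>(y/q; q)_(j+1)\<close> is a
  combination of \<open>(y; q)_(j+1)\<close> and \<open>(y; q)_j\<close> with weights free of
  \<open>y\<close>. These are the weights of \<open>laguerre_coef_recombine\<close>.\<close>

lemma laguerre_sum_contiguous: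
  assumes "\<tau> \<noteq> 0"
  shows "Q ^ m * laguerre_sum \<tau> m n (y / Q) = laguerre_sum \<tau> m (Suc n) y
    - (1 - Q powi (- int m)) * (Q ^ (2 * Suc n) / \<tau>) * laguerre_sum \<tau> (m - 1) n y"
proof -
  have g: "qpoch (y / Q) q (m - h) = Q powi (int h - int m) * qpoch y q (m - h)
      + (1 - Q powi (int h - int m)) * qpoch y q (m - Suc h)" if h: "h \<le> m" for h
  proof (cases "h = m")
    case False
    then obtain j where j: "m - h = Suc j" "m - Suc h = j" "int h - int m = - int (Suc j)"
      using h by (cases "m - h") auto
    show ?thesis
      unfolding j qpoch_Suc_left[of "y / Q"] qpoch_Suc[of y]
      by (simp add: power_int_minus power_int_of_nat field_simps del: of_nat_Suc)
  qed simp
  have "laguerre_sum \<tau> m n (y / Q) = (\<Sum>h\<le>m. laguerre_coef m h * laguerre_fac \<tau> n h * (Q powi (int h - int m) * qpoch y q (m - h)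
      + (1 - Q powi (int h - int m)) * qpoch y q (m - Suc h)))"
    unfolding laguerre_sum_def by (intro sum.cong refl) (simp only: g atMost_iff)
  then show ?thesis
    using laguerre_coef_recombine[OF assms, of m n "\<lambda>h. qpoch y q (m - h)"] by (simp add: laguerre_sum_def)
qed

text \<open>Here \<open>1 - w q^(k-m)\<close> splits as
  \<open>q^(h-m) (1 - w q^(k-h)) + (1 - q^(h-m))\<close>, which produces the same weights as in
  \<open>laguerre_sum_contiguous\<close>. For \<open>h > k\<close> the factor
  \<open>laguerre_fac\<close> vanishes, so the truncated \<open>k - h\<close> does no harm.\<close>

lemma laguerre_quot_contiguous:
  assumes "\<sigma> \<noteq> 0"
  shows "Q ^ m * (1 - w * Q powi (int k - int m)) * laguerre_quot \<sigma> k m w = laguerre_quot \<sigma> (Suc k) m w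
    - (1 - Q powi (- int m)) * (Q ^ (2 * Suc k) / \<sigma>) * laguerre_quot \<sigma> k (m - 1) w"
proof -
  have "laguerre_coef m h * laguerre_fac \<sigma> k h * ((1 - w * Q powi (int k - int m)) * qpoch w q (k - h)) =
    laguerre_coef m h * laguerre_fac \<sigma> k h * (Q powi (int h - int m) * qpoch w q (Suc k - h)
      + (1 - Q powi (int h - int m)) * qpoch w q (Suc k - Suc h))" for h
  proof (cases "h \<le> k")
    case True
    have "Q powi (int h - int m) * Q ^ (k - h) = Q powi (int k - int m)"
      using True by (simp add: power_int_add[symmetric] flip: power_int_of_nat)
    then have "(1 - w * Q powi (int k - int m)) * qpoch w q (k - h)
        = Q powi (int h - int m) * qpoch w q (Suc k - h)
      + (1 - Q powi (int h - int m)) * qpoch w q (k - h)"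
      using True by (simp add: Suc_diff_le qpoch_Suc algebra_simps)
    then show ?thesis by simp
  qed (simp add: laguerre_fac_eq_0)
  then have "(1 - w * Q powi (int k - int m)) * laguerre_quot \<sigma> k m w =
      (\<Sum>h\<le>m. laguerre_coef m h * laguerre_fac \<sigma> k h * (Q powi (int h - int m) * qpoch w q (Suc k - h)
      + (1 - Q powi (int h - int m)) * qpoch w q (Suc k - Suc h)))"
    unfolding laguerre_quot_def sum_distrib_left by (intro sum.cong refl) (simp add: mult.commute mult.left_commute)
  then show ?thesis
    using laguerre_coef_recombine[OF assms, of m k "\<lambda>h. qpoch w q (Suc k - h)"] by (simp add: laguerre_quot_def mult.assoc)
qed

text \<open>The q-difference lowers each \<open>(y; q)_(j+1)\<close> to a multiple of
  \<open>(y; q)_j\<close>. By \<open>laguerre_coef_Suc_left\<close> the multiplier, combined with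
  the coefficient, depends on \<open>h\<close> only through \<open>laguerre_coef\<close> for
  \<open>m - 1\<close>, so the whole sum is lowered.\<close>

lemma laguerre_sum_diff:
  "laguerre_sum \<tau> m n y - laguerre_sum \<tau> m n (y / Q) = y * (1 - Q powi (- int m)) * laguerre_sum \<tau> (m - 1) n y"
proof (cases m)
  case 0
  then show ?thesis by (simp add: laguerre_sum_def)
next
  case (Suc M)
  have t: "laguerre_coef (Suc M) h * (qpoch y q (Suc M - h) - qpoch (y / Q) q (Suc M - h))
     = y * (1 - Q powi (- int (Suc M))) * (laguerre_coef M h * qpoch y q (M - h))" if "h \<le> M" for h
  proof -
    define j where "j = M - h"
    have j: "Suc M - h = Suc j" "M - h = j" "int h - int (Suc M) = - int (Suc j)" "int h - int M = - int j"
      using that by (auto simp: j_def)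
    have "qpoch y q (Suc j) - qpoch (y / Q) q (Suc j) = - (y * Q ^ j * (1 - Q powi (- int (Suc j)))) * qpoch y q j"
      unfolding qpoch_Suc_left[of "y / Q"] qpoch_Suc[of y]
      by (simp add: power_int_minus power_int_of_nat field_simps del: of_nat_Suc)
    then have "laguerre_coef (Suc M) h * (qpoch y q (Suc M - h) - qpoch (y / Q) q (Suc M - h))
      = - y * Q ^ j * (laguerre_coef (Suc M) h * (1 - Q powi (- int (Suc j)))) * qpoch y q j"
      unfolding j by (simp only: mult_ac mult_minus_left mult_minus_right)
    also have "\<dots> = y * (Q ^ j * Q powi (- int j)) * (1 - Q powi (- int (Suc M))) * (laguerre_coef M h * qpoch y q j)"
      using laguerre_coef_Suc_left[OF that] unfolding j by (simp only: mult_ac mult_minus_left mult_minus_right minus_minus)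
    finally show ?thesis by (simp add: j Q_power_powi_minus del: of_nat_Suc)
  qed
  have "laguerre_sum \<tau> m n y - laguerre_sum \<tau> m n (y / Q)
     = (\<Sum>h\<le>M. laguerre_fac \<tau> n h * (laguerre_coef (Suc M) h * (qpoch y q (Suc M - h) - qpoch (y / Q) q (Suc M - h))))"
    unfolding laguerre_sum_def Suc sum_subtractf[symmetric] sum.atMost_Suc
    by (simp add: algebra_simps sum_subtractf)
  also have "\<dots> = (\<Sum>h\<le>M. laguerre_fac \<tau> n h * (y * (1 - Q powi (- int (Suc M))) * (laguerre_coef M h * qpoch y q (M - h))))"
    by (intro sum.cong refl) (simp only: t atMost_iff)
  also have "\<dots> = y * (1 - Q powi (- int m)) * laguerre_sum \<tau> (m - 1) n y"
    unfolding laguerre_sum_def Suc sum_distrib_left diff_Suc_1 by (intro sum.cong refl) (simp only: mult_ac)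
  finally show ?thesis .
qed

text \<open>Counterpart of \<open>laguerre_sum_diff\<close> for the right-hand side of the theorem:
  \<open>(1 - w) (wq; q)_(k-h) = (w; q)_(k-h) (1 - w q^(k-h))\<close>, and the difference of the two
  linear factors carries the \<open>1 - q^(h-m)\<close> that lowers \<open>m\<close>.\<close>

lemma laguerre_quot_diff:
  "(1 - w * Q powi (int k - int m)) * laguerre_quot \<sigma> k m w - (1 - w) * laguerre_quot \<sigma> k m (w * Q)
    = - w * Q powi (int k - int m + 1) * (1 - Q powi (- int m)) * laguerre_quot \<sigma> k (m - 1) w"
proof (cases m)
  case 0
  then show ?thesis using qpoch_shift[of w k] by (simp add: laguerre_quot_def laguerre_coef_def mult.commute)
next
  case (Suc M)
  have kill: "laguerre_fac \<sigma> k h * (qpoch w q (k - h) * (1 - w * Q powi (int k - int m)) - (1 - w) * qpoch (w * Q) q (k - h))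
     = laguerre_fac \<sigma> k h * (qpoch w q (k - h) * (w * Q powi (int k - int h) * (1 - Q powi (int h - int m))))" for h
  proof (cases "h \<le> k")
    case True
    have "Q powi (int k - int h) * Q powi (int h - int m) = Q powi (int k - int m)"
      by (simp add: power_int_add[symmetric])
    moreover have "Q ^ (k - h) = Q powi (int k - int h)"
      using True by (simp flip: power_int_of_nat)
    moreover from this have "(1 - w) * qpoch (w * Q) q (k - h) = qpoch w q (k - h) * (1 - w * Q powi (int k - int h))"
      by (simp add: qpoch_shift)
    ultimately show ?thesis
      by (simp only:) (simp add: algebra_simps)
  qed (simp add: laguerre_fac_eq_0)
  have t: "laguerre_coef (Suc M) h * (Q powi (int k - int h) * (1 - Q powi (int h - int (Suc M))))
     = - (Q powi (int k - int M)) * (1 - Q powi (- int (Suc M))) * laguerre_coef M h" if "h \<le> M" for h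
  proof -
    have "Q powi (int k - int h) * Q powi (int h - int M) = Q powi (int k - int M)"
      by (simp add: power_int_add[symmetric])
    moreover have "laguerre_coef (Suc M) h * (Q powi (int k - int h) * (1 - Q powi (int h - int (Suc M))))
       = - (Q powi (int k - int h) * Q powi (int h - int M)) * (1 - Q powi (- int (Suc M))) * laguerre_coef M h"
      using arg_cong[OF laguerre_coef_Suc_left[OF that], of "\<lambda>x. Q powi (int k - int h) * x"]
      by (simp only: mult_ac mult_minus_left mult_minus_right)
    ultimately show ?thesis by simp
  qed
  have e: "int k - int M = int k - int m + 1"
    using Suc by simp
  have "(1 - w * Q powi (int k - int m)) * laguerre_quot \<sigma> k m w - (1 - w) * laguerre_quot \<sigma> k m (w * Q)
    = (\<Sum>h\<le>m. laguerre_coef m h * (laguerre_fac \<sigma> k h * (qpoch w q (k - h) * (1 - w * Q powi (int k - int m)) - (1 - w) * qpoch (w * Q) q (k - h))))"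
    unfolding laguerre_quot_def sum_distrib_left sum_subtractf[symmetric]
    by (intro sum.cong refl) (simp add: algebra_simps)
  also have "\<dots> = (\<Sum>h\<le>m. w * (laguerre_coef m h * (Q powi (int k - int h) * (1 - Q powi (int h - int m)))) * (laguerre_fac \<sigma> k h * qpoch w q (k - h)))"
    unfolding kill by (intro sum.cong refl) (simp add: algebra_simps)
  also have "\<dots> = (\<Sum>h\<le>M. w * (laguerre_coef m h * (Q powi (int k - int h) * (1 - Q powi (int h - int m)))) * (laguerre_fac \<sigma> k h * qpoch w q (k - h)))"
    unfolding Suc sum.atMost_Suc by simp
  also have "\<dots> = (\<Sum>h\<le>M. w * (- (Q powi (int k - int M)) * (1 - Q powi (- int (Suc M))) * laguerre_coef M h) * (laguerre_fac \<sigma> k h * qpoch w q (k - h)))"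
    unfolding Suc by (intro sum.cong refl) (simp only: t atMost_iff)
  also have "\<dots> = - w * Q powi (int k - int M) * (1 - Q powi (- int m)) * laguerre_quot \<sigma> k (m - 1) w"
    unfolding laguerre_quot_def Suc sum_distrib_left diff_Suc_1 by (intro sum.cong refl) (simp only: mult_ac mult_minus_left mult_minus_right)
  finally show ?thesis unfolding e by simp
qed

end

context qbase
begin

subsection \<open>Continuous dual \<open>q\<close>-Hahn polynomials\<close>

lemma cdq_hahn_alt:
  "cdq_hahn n u a b c q = inverse a ^ n * (\<Sum>j\<le>n.
     qpoch (Q powi (- int n)) q j / qpoch Q q j * Q ^ j * qpoch (a * b * Q ^ j) q (n - j)
     * (qpoch (a * u) q j * qpoch (a / u) q j) * qpoch (a * c * Q ^ j) q (n - j))"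
  unfolding cdq_hahn_def qpochs_def by (simp add: mult_ac)

text \<open>The numbers \<open>\<beta> n j\<close> are the coefficients of \<open>p_n\<close> in the
  functions \<open>(au, a/u; q)_j (ac q^j; q)_(n-j)\<close>, up to the common factor
  \<open>a^(-n)\<close>; \<open>d\<close> stands for \<open>ab\<close>. Their recurrence in
  \<open>n\<close> is what the raising relation reduces to.\<close>

lemma cdq_hahn_coef_rec:
  fixes n :: nat and d :: complex
  defines "\<beta> \<equiv> \<lambda>n j. qpoch (Q powi (- int n)) q j / qpoch Q q j * Q ^ j * qpoch (d * Q ^ j) q (n - j)"
  assumes "j \<le> n"
  shows "\<beta> (Suc n) (Suc j) = \<beta> n (Suc j) / Q ^ Suc j * (1 - d * Q ^ (n + Suc j)) - \<beta> n j / Q ^ j"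
proof -
  define M where "M = Q powi (- int (Suc n))"
  have MQ: "Q powi (- int n) = M * Q"
    by (simp add: M_def power_int_diff power_int_minus_divide)
  have M1: "M * Q ^ Suc n = 1"
    using Q_power_powi_minus[of "Suc n"] by (simp add: M_def mult.commute del: power_Suc of_nat_Suc)
  define x where "x = qpoch (M * Q) q j / qpoch Q q j / (1 - Q ^ Suc j)"
  have nz: "1 - Q ^ Suc j \<noteq> 0" using Q_power_nz_1[of "Suc j"] by simp
  have L: "\<beta> (Suc n) (Suc j) = x * (1 - M) * Q ^ Suc j * qpoch (d * Q ^ Suc j) q (n - j)"
    unfolding \<beta>_def M_def[symmetric] qpoch_Suc[of Q] qpoch_Suc_left[of M] by (simp add: x_def)
  have R1: "\<beta> n j / Q ^ j = x * (1 - Q ^ Suc j) * qpoch (d * Q ^ j) q (n - j)"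
    using nz by (simp add: \<beta>_def MQ x_def del: power_Suc)
  have R2: "\<beta> n (Suc j) / Q ^ Suc j = x * (1 - M * Q * Q ^ j) * qpoch (d * Q ^ Suc j) q (n - Suc j)"
    unfolding \<beta>_def MQ qpoch_Suc by (simp add: x_def)
  show ?thesis
  proof (cases "j = n")
    case True
    have "M * Q * Q ^ j = 1" using M1 True by (simp add: mult_ac)
    moreover have "(1 - M) * Q ^ Suc j = - (1 - Q ^ Suc j)"
      using M1 True by (simp add: algebra_simps)
    ultimately show ?thesis
      unfolding L R1 R2 mult.assoc using True by simp (simp add: algebra_simps)
  next
    case False
    with assms obtain i where i: "n - j = Suc i" "n - Suc j = i"
      by (metis Suc_diff_le diff_Suc_Suc le_neq_implies_less Suc_leI)
    have n: "n = Suc j + i" using i assms by linarith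
    define R where "R = qpoch (d * Q ^ Suc j) q i"
    have e1: "qpoch (d * Q ^ j) q (n - j) = (1 - d * Q ^ j) * R"
      unfolding i qpoch_Suc_left R_def by (simp add: mult_ac)
    have e2: "qpoch (d * Q ^ Suc j) q (n - j) = R * (1 - d * Q ^ n)"
      unfolding i qpoch_Suc R_def by (simp add: n power_add mult_ac)
    \<comment> \<open>\<open>N\<close>, \<open>P\<close>, \<open>J\<close> stand for
      \<open>Q^n\<close>, \<open>Q^(j+1)\<close>, \<open>Q^j\<close>, and \<open>M\<close> for
      \<open>Q^(-n-1)\<close>. After substitution of \<open>M N Q = 1\<close> both sides are the
      same polynomial.\<close>
    have key: "(1 - M) * P * (1 - d * N) = (1 - M * P) * (1 - d * (N * P)) - (1 - P) * (1 - d * J)"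
      if "M * N * Q = 1" "P = J * Q" for P N J :: complex
      using that by algebra
    have "(1 - M) * Q ^ Suc j * (1 - d * Q ^ n)
       = (1 - M * Q ^ Suc j) * (1 - d * (Q ^ n * Q ^ Suc j)) - (1 - Q ^ Suc j) * (1 - d * Q ^ j)"
      by (rule key) (use M1 in \<open>simp_all add: mult_ac\<close>)
    from arg_cong[OF this, of "\<lambda>v. x * R * v"] show ?thesis
      unfolding L R1 R2 e1 e2 i(2) R_def[symmetric] power_add
      by (simp only: right_diff_distrib[of "x * R"]) (simp only: mult_ac power_Suc)
  qed
qed

text \<open>Both terms on the left, expanded in the basis for \<open>p_n\<close>, become
  combinations of the basis functions \<open>W j\<close> and \<open>W (j+1)\<close> for
  \<open>p_(n+1)\<close>; collecting them by index gives \<open>cdq_hahn_coef_rec\<close>. No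
  denominator depends on \<open>c\<close>, so the relation also holds where the hypergeometric form
  of \<open>p_n\<close> breaks down.\<close>

theorem cdq_hahn_raise:
  assumes "a \<noteq> 0" "u \<noteq> 0"
  shows "(1 - a * c * Q ^ n) * (1 - b * c * Q ^ n) * cdq_hahn n u a b c q
      - (1 - c * u) * (1 - c / u) * cdq_hahn n u a b (c * Q) q = c * cdq_hahn (Suc n) u a b c q"
proof -
  define d where "d = a * b"
  define \<beta> where "\<beta> = (\<lambda>n j. qpoch (Q powi (- int n)) q j / qpoch Q q j * Q ^ j * qpoch (d * Q ^ j) q (n - j))"
  define T where "T = (\<lambda>j. qpoch (a * u) q j * qpoch (a / u) q j)"
  define W where "W = (\<lambda>j. T j * qpoch (a * c * Q ^ j) q (Suc n - j))"
  have rec: "\<beta> (Suc n) (Suc j) = \<beta> n (Suc j) / Q ^ Suc j * (1 - d * Q ^ (n + Suc j)) - \<beta> n j / Q ^ j"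
    if "j \<le> n" for j
    using cdq_hahn_coef_rec[OF that, of d] by (simp add: \<beta>_def)
  have \<beta>0: "\<beta> (Suc n) 0 = \<beta> n 0 * (1 - d * Q ^ n)"
    by (simp add: \<beta>_def qpoch_Suc)
  have \<beta>n: "\<beta> n (Suc n) = 0"
    using qpoch_minus_eq_0[of q n "Suc n"] by (simp add: \<beta>_def)
  have term_eq: "(1 - a * c * Q ^ n) * (1 - b * c * Q ^ n) * (T j * qpoch (a * c * Q ^ j) q (n - j))
      - (1 - c * u) * (1 - c / u) * (T j * qpoch (a * (c * Q) * Q ^ j) q (n - j))
    = c / a * (1 / Q ^ j) * ((1 - d * Q ^ (n + j)) * W j - W (Suc j))" if j: "j \<le> n" for j
  proof -
    define p where "p = Q ^ j"
    have p: "p \<noteq> 0" by (simp add: p_def)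
    have U1: "qpoch (a * c * Q ^ j) q (n - j) * (1 - a * c * Q ^ n) = qpoch (a * c * Q ^ j) q (Suc n - j)"
      using j by (simp add: Suc_diff_le qpoch_Suc mult.assoc flip: power_add)
    have U2: "(1 - a * c * p) * qpoch (a * (c * Q) * Q ^ j) q (n - j) = qpoch (a * c * Q ^ j) q (Suc n - j)"
      using j by (simp add: Suc_diff_le qpoch_Suc_left p_def mult_ac)
    have U3: "qpoch (a * c * Q ^ Suc j) q (Suc n - Suc j) = qpoch (a * (c * Q) * Q ^ j) q (n - j)"
      by (simp add: mult_ac)
    have T1: "T (Suc j) = T j * ((1 - a * u * p) * (1 - a / u * p))"
      by (simp add: T_def qpoch_Suc p_def)
    \<comment> \<open>Both \<open>(1 - cu)(1 - c/u)\<close> and \<open>(1 - apu)(1 - ap/u)\<close>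
      are affine in \<open>u + 1/u\<close>. Matching that coefficient forces the weight
      \<open>c/(ap)\<close>, and the remainder happens to factor.\<close>
    have id: "(1 - c * u) * (1 - c / u) = c / (a * p) * ((1 - a * u * p) * (1 - a / u * p))
        + (1 - c / (a * p)) * (1 - a * c * p)"
      using assms p by (simp add: field_simps) 
    define w where "w = c / (a * p)"
    have "(1 - c * u) * (1 - c / u) * (T j * qpoch (a * (c * Q) * Q ^ j) q (n - j))
       = w * W (Suc j) + (1 - w) * W j"
      unfolding id w_def[symmetric] W_def U3 T1 U2[symmetric] by (simp only: distrib_right distrib_left mult_ac)
    moreover have "(1 - a * c * Q ^ n) * (1 - b * c * Q ^ n) * (T j * qpoch (a * c * Q ^ j) q (n - j))
       = (1 - b * c * Q ^ n) * W j"
      unfolding W_def U1[symmetric] by (simp only: mult_ac)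
    moreover have "1 - b * c * Q ^ n = (1 - w) + w * (1 - d * Q ^ (n + j))"
      using assms p by (simp add: w_def d_def p_def power_add field_simps)
    moreover have "c / a * (1 / Q ^ j) = w" by (simp add: w_def p_def)
    ultimately show ?thesis by (simp only:) (simp only: distrib_right right_diff_distrib left_diff_distrib, simp)
  qed
  have "(1 - a * c * Q ^ n) * (1 - b * c * Q ^ n) * cdq_hahn n u a b c q
      - (1 - c * u) * (1 - c / u) * cdq_hahn n u a b (c * Q) q
    = inverse a ^ n * (\<Sum>j\<le>n. \<beta> n j * ((1 - a * c * Q ^ n) * (1 - b * c * Q ^ n) * (T j * qpoch (a * c * Q ^ j) q (n - j))
      - (1 - c * u) * (1 - c / u) * (T j * qpoch (a * (c * Q) * Q ^ j) q (n - j))))"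
    unfolding cdq_hahn_alt \<beta>_def T_def d_def right_diff_distrib sum_subtractf sum_distrib_left
    by (simp only: mult_ac)
  also have "\<dots> = inverse a ^ n * (c / a) * (\<Sum>j\<le>n. \<beta> n j / Q ^ j * ((1 - d * Q ^ (n + j)) * W j - W (Suc j)))"
    unfolding sum_distrib_left
    by (intro sum.cong refl) (simp add: term_eq)
  also have "(\<Sum>j\<le>n. \<beta> n j / Q ^ j * ((1 - d * Q ^ (n + j)) * W j - W (Suc j)))
    = (\<Sum>j\<le>n. \<beta> n j / Q ^ j * (1 - d * Q ^ (n + j)) * W j) - (\<Sum>j\<le>n. \<beta> n j / Q ^ j * W (Suc j))"
    unfolding sum_subtractf[symmetric]
    by (intro sum.cong refl) (simp only: right_diff_distrib left_diff_distrib mult.assoc)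
  also have "(\<Sum>j\<le>n. \<beta> n j / Q ^ j * (1 - d * Q ^ (n + j)) * W j)
    = (\<Sum>j\<le>Suc n. \<beta> n j / Q ^ j * (1 - d * Q ^ (n + j)) * W j)"
    by (simp add: \<beta>n)
  also have "\<dots> = \<beta> (Suc n) 0 * W 0 + (\<Sum>j\<le>n. \<beta> n (Suc j) / Q ^ Suc j * (1 - d * Q ^ (n + Suc j)) * W (Suc j))"
    by (subst sum.atMost_Suc_shift) (simp add: \<beta>0)
  also have "\<dots> - (\<Sum>j\<le>n. \<beta> n j / Q ^ j * W (Suc j))
     = \<beta> (Suc n) 0 * W 0 + (\<Sum>j\<le>n. (\<beta> n (Suc j) / Q ^ Suc j * (1 - d * Q ^ (n + Suc j)) - \<beta> n j / Q ^ j) * W (Suc j))"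
    by (simp only: left_diff_distrib sum_subtractf add_diff_eq)
  also have "\<dots> = \<beta> (Suc n) 0 * W 0 + (\<Sum>j\<le>n. \<beta> (Suc n) (Suc j) * W (Suc j))"
    by (intro arg_cong2[of _ _ _ _ "(+)"] sum.cong refl) (simp only: rec atMost_iff)
  also have "\<dots> = (\<Sum>j\<le>Suc n. \<beta> (Suc n) j * W j)"
    by (subst sum.atMost_Suc_shift) simp
  also have "inverse a ^ n * (c / a) * \<dots> = c * cdq_hahn (Suc n) u a b c q"
    unfolding cdq_hahn_alt \<beta>_def T_def W_def d_def
    by (simp only: power_Suc divide_inverse mult_ac)
  finally show ?thesis .
qed

end

subsection \<open>The \<open>q\<close>-Meixner kernel\<close>

locale qmeix = qbase +
  fixes ka sg ta u :: complex
  assumes u_nz [simp]: "u \<noteq> 0"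
    and ta_nz [simp]: "ta \<noteq> 0" and sg_nz [simp]: "sg \<noteq> 0"
    and ka_sq: "ka\<^sup>2 = of_real q * sg * ta"
begin

lemma ka_nz [simp]: "ka \<noteq> 0"
  using ka_sq by auto

definition pochpair :: "complex \<Rightarrow> complex" where
  "pochpair x = qpoch_inf (ka * x * u) q * qpoch_inf (ka * x / u) q"

text \<open>
  \<open>psi r X Z\<close> is the \<open>q\<close>-Meixner function with \<open>-1/x = q\<^sup>-\<^sup>r/Z\<close> and \<open>-1/\<gamma> = q\<^sup>-\<^sup>r/X\<close>, multiplied by
  \<open>(\<kappa>q\<^sup>-\<^sup>ru, \<kappa>q\<^sup>-\<^sup>r/u; q)\<^sub>\<infinity>\<close>, which clears all denominators; \<open>epol r l Z\<close> is
  \<open>(q\<^sup>-\<^sup>r/Z; q)\<^sub>l Z\<^sup>l\<close>.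
\<close>

definition epol :: "int \<Rightarrow> nat \<Rightarrow> complex \<Rightarrow> complex" where
  "epol r l Z = (\<Prod>i<l. Z - Q powi (int i - r))"

definition ccoef :: "nat \<Rightarrow> complex" where
  "ccoef l = (\<Prod>j<l. - (Q ^ j * ka\<^sup>2) / (1 - Q ^ Suc j))"

definition pterm :: "int \<Rightarrow> complex \<Rightarrow> complex \<Rightarrow> nat \<Rightarrow> complex" where
  "pterm r X Z l = ccoef l * pochpair (Q powi (int l - r)) * epol r l X * epol r l Z"

definition psi :: "int \<Rightarrow> complex \<Rightarrow> complex \<Rightarrow> complex" where
  "psi r X Z = (\<Sum>l. pterm r X Z l)"

lemma psi_commute: "psi r X Z = psi r Z X"
  by (simp add: psi_def pterm_def mult_ac)

lemma pochpair_unfold: "pochpair x = (1 - ka * x * u) * (1 - ka * x / u) * pochpair (x * Q)"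
  unfolding pochpair_def
  by (subst qpoch_inf_unfold[of "ka * x * u"], subst qpoch_inf_unfold[of "ka * x / u"]) (simp add: mult_ac)

lemma epol_0 [simp]: "epol r 0 Z = 1"
  by (simp add: epol_def)

lemma epol_Suc: "epol r (Suc l) Z = epol r l Z * (Z - Q powi (int l - r))"
  by (simp add: epol_def)

lemma epol_Suc_left: "epol r (Suc l) Z = (Z - Q powi (- r)) * epol (r - 1) l Z"
  unfolding epol_def by (subst prod.lessThan_Suc_shift) (simp add: algebra_simps)

lemma epol_mult_Q: "epol r l (Z * Q) = Q ^ l * epol (r + 1) l Z"
proof (induction l)
  case (Suc l)
  have "Q powi (int l - r) = Q * Q powi (int l - (r + 1))"
    using Q_powi_Suc[of "int l - (r + 1)"] by (simp add: mult.commute)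
  with Suc show ?case by (simp add: epol_Suc algebra_simps)
qed simp

lemma epol_divide_Q: "epol r l (Z / Q) = epol (r - 1) l Z / Q ^ l"
  using epol_mult_Q[of "r - 1" l "Z / Q"] epol_mult_Q[of r l "Z / Q"] epol_mult_Q[of "r - 1" l "Z / Q"]
  by (simp add: field_simps)

lemma ccoef_Suc: "ccoef (Suc l) = ccoef l * (- (Q ^ l * ka\<^sup>2) / (1 - Q ^ Suc l))"
  by (simp add: ccoef_def)

lemma isCont_pochpair_mult [continuous_intros]: "isCont (\<lambda>z. pochpair (a * z)) 0"
  unfolding pochpair_def
  using isCont_qpoch_inf_mult[of "ka * a * u"] isCont_qpoch_inf_mult[of "ka * a / u"]
  by (intro isCont_mult) (simp_all add: mult_ac)

lemma pochpair_0 [simp]: "pochpair 0 = 1"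
  by (simp add: pochpair_def)

lemma norm_epol_le:
  assumes "norm Z \<le> R"
  shows "norm (epol r l Z) \<le> (R + q powi (- r)) ^ l"
proof -
  have "norm (Z - Q powi (int i - r)) \<le> R + q powi (- r)" for i
  proof -
    have "norm (Q powi (int i - r)) = q powi (int i - r)"
      using q_pos by (simp add: norm_power_int)
    also have "\<dots> = q ^ i * q powi (- r)"
      by (simp add: power_int_diff power_int_minus field_simps)
    also have "\<dots> \<le> 1 * q powi (- r)"
      using q_pos q_less_1 by (intro mult_right_mono power_le_one zero_le_power_int) auto
    finally show ?thesis
      using norm_triangle_ineq4[of Z "Q powi (int i - r)"] assms by simp
  qed
  then have "norm (epol r l Z) \<le> (\<Prod>i<l. R + q powi (- r))"
    unfolding epol_def prod_norm[symmetric] by (intro prod_mono) auto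
  then show ?thesis by simp
qed

text \<open>The ratio of consecutive \<open>ccoef\<close> contains \<open>q^l\<close>, which beats
  the geometric growth of the two \<open>epol\<close> factors. The majorant depends on
  \<open>X\<close> and \<open>Z\<close> through \<open>R\<close> alone and therefore gives uniform
  convergence on discs.\<close>

lemma pterm_majorant:
  obtains M where "summable M"
    "\<And>X Z l. norm X \<le> R \<Longrightarrow> norm Z \<le> R \<Longrightarrow> norm (pterm r X Z l) \<le> M l"
proof -
  define T where "T = \<bar>R\<bar> + q powi (- r)"
  have "T > 0" using q_pos by (simp add: T_def add_nonneg_pos)
  have "(\<lambda>l. pochpair (Q powi (- r) * Q ^ l)) \<longlonglongrightarrow> pochpair (Q powi (- r) * 0)"
    using isCont_0_lattice[OF isCont_pochpair_mult[of "Q powi (- r)"], of 1] by simp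
  then have "Bseq (\<lambda>l. pochpair (Q powi (- r) * Q ^ l))"
    by (intro convergent_imp_Bseq convergentI)
  then obtain B where B: "B > 0" "\<And>l. norm (pochpair (Q powi (- r) * Q ^ l)) \<le> B"
    by (auto simp: Bseq_def)
  have G: "Q powi (int l - r) = Q powi (- r) * Q ^ l" for l
    by (simp add: power_int_diff power_int_minus field_simps)
  define M where "M = (\<lambda>l. norm (ccoef l) * B * T ^ l * T ^ l)"
  have bound: "norm (pterm r X Z l) \<le> M l" if "norm X \<le> R" "norm Z \<le> R" for X Z l
  proof -
    have *: "norm (epol r l Y) \<le> T ^ l" if "norm Y \<le> R" for Y
      using norm_epol_le[of Y "\<bar>R\<bar>" r l] that by (simp add: T_def)
    show ?thesis
      unfolding pterm_def norm_mult M_def G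
      using B \<open>T > 0\<close> *[OF that(1)] *[OF that(2)] by (intro mult_mono mult_nonneg_nonneg) auto
  qed
  define C where "C = norm (ka\<^sup>2) * T\<^sup>2 / (1 - q)"
  have "(\<lambda>l. q ^ l * C) \<longlonglongrightarrow> 0"
    by (intro tendsto_mult_left_zero LIMSEQ_power_zero) simp
  then have "eventually (\<lambda>l. q ^ l * C < 1 / 2) sequentially"
    by (rule order_tendstoD) simp
  then obtain N where N: "\<And>l. l \<ge> N \<Longrightarrow> q ^ l * C < 1 / 2"
    by (auto simp: eventually_sequentially)
  have "summable M"
  proof (rule summable_ratio_test)
    show "norm (M (Suc l)) \<le> 1 / 2 * norm (M l)" if "l \<ge> N" for l
    proof -
      have d: "norm (1 - Q ^ Suc l) \<ge> 1 - q"
      proof -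
        have "q ^ Suc l \<le> q ^ 1" using q_pos q_less_1 by (intro power_decreasing) auto
        then show ?thesis using norm_triangle_ineq2[of 1 "Q ^ Suc l"] by (simp del: power_Suc)
      qed
      have "norm (M (Suc l)) = norm (M l) * (q ^ l * norm (ka\<^sup>2) * T\<^sup>2 / norm (1 - Q ^ Suc l))"
      proof -
        have "M l \<ge> 0" for l using \<open>T > 0\<close> B by (simp add: M_def)
        moreover have "M (Suc l) = M l * (q ^ l * norm (ka\<^sup>2) * T\<^sup>2 / norm (1 - Q ^ Suc l))"
          unfolding M_def ccoef_Suc by (simp add: norm_mult norm_divide power2_eq_square)
        ultimately show ?thesis by (metis real_norm_def abs_of_nonneg)
      qed
      also have "\<dots> \<le> norm (M l) * (q ^ l * norm (ka\<^sup>2) * T\<^sup>2 / (1 - q))"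
        using d q_pos q_less_1 by (intro mult_left_mono divide_left_mono mult_pos_pos) auto
      also have "\<dots> = norm (M l) * (q ^ l * C)" by (simp add: C_def)
      also have "\<dots> \<le> norm (M l) * (1 / 2)"
        using N[OF that] by (intro mult_left_mono) auto
      finally show ?thesis by simp
    qed
  qed simp
  with bound that show thesis by blast
qed

lemma summable_pterm [simp]: "summable (pterm r X Z)"
proof -
  obtain M where "summable M"
    "\<And>X' Z' l. norm X' \<le> max (norm X) (norm Z) \<Longrightarrow> norm Z' \<le> max (norm X) (norm Z) \<Longrightarrow> norm (pterm r X' Z' l) \<le> M l"
    by (rule pterm_majorant) blast
  then show ?thesis
    by (intro summable_comparison_test'[of M 0 "pterm r X Z"]) auto
qed

lemma psi_bounded:
  obtains K where "K > 0" "\<And>X Z. norm X \<le> R \<Longrightarrow> norm Z \<le> R \<Longrightarrow> norm (psi r X Z) \<le> K"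
proof -
  obtain M where M: "summable M"
    "\<And>X' Z' l. norm X' \<le> R \<Longrightarrow> norm Z' \<le> R \<Longrightarrow> norm (pterm r X' Z' l) \<le> M l"
    by (rule pterm_majorant) blast
  have "norm (psi r X Z) \<le> \<bar>suminf M\<bar> + 1" if "norm X \<le> R" "norm Z \<le> R" for X Z
  proof -
    have "norm (psi r X Z) \<le> suminf M"
      unfolding psi_def using M that by (intro norm_suminf_le) auto
    then show ?thesis by linarith
  qed
  then show thesis by (intro that[of "\<bar>suminf M\<bar> + 1"]) auto
qed

lemma isCont_psi: "isCont (psi r X) 0"
proof -
  define R where "R = norm X + 1"
  obtain M where M: "summable M"
    "\<And>X' Z' l. norm X' \<le> R \<Longrightarrow> norm Z' \<le> R \<Longrightarrow> norm (pterm r X' Z' l) \<le> M l"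
    by (rule pterm_majorant) blast
  have R: "R > 0" "norm X \<le> R" by (auto simp: R_def add_nonneg_pos)
  have "uniform_limit (cball 0 R) (\<lambda>n Z. \<Sum>l<n. pterm r X Z l) (\<lambda>Z. \<Sum>l. pterm r X Z l) sequentially"
    using M R by (intro Weierstrass_m_test[of _ _ M]) auto
  moreover have "continuous_on (cball 0 R) (\<lambda>Z. \<Sum>l<n. pterm r X Z l)" for n
    unfolding pterm_def epol_def by (intro continuous_intros)
  ultimately have "continuous_on (cball 0 R) (\<lambda>Z. \<Sum>l. pterm r X Z l)"
    by (intro uniform_limit_theorem) auto
  then show ?thesis
    using R(1) by (intro continuous_on_interior[of "cball 0 R"]) (auto simp: psi_def[abs_def])
qed

text \<open>This holds term by term after an index shift: the q-difference takes
  \<open>epol r (l+1) Z\<close> to a multiple of \<open>Z * epol (r-1) l Z\<close>, the first factor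
  of \<open>epol r (l+1) X\<close> splits off as \<open>X - q^(-r)\<close>, and the argument of
  \<open>pochpair\<close> is the same for \<open>(r, l+1)\<close> and
  \<open>(r-1, l)\<close>.\<close>

lemma psi_lower:
  "psi r X Z - psi r X (Z / Q) = Z * ((X - Q powi (- r)) * (ka\<^sup>2 / Q) * psi (r - 1) X Z)"
proof -
  have t: "pterm r X Z (Suc l) - pterm r X (Z / Q) (Suc l)
      = Z * (X - Q powi (- r)) * (ka\<^sup>2 / Q) * pterm (r - 1) X Z l" for l
  proof -
    define p where "p = Q ^ Suc l"
    have p: "p \<noteq> 0" "1 - p \<noteq> 0" using Q_power_nz_1[of "Suc l"] by (auto simp: p_def)
    have pl: "Q ^ l = p / Q" by (simp add: p_def)
    have pw: "Q powi (int (Suc l) - r) = Q powi (int l - (r - 1))" by (simp add: algebra_simps)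
    have "int l - (r - 1) = int (Suc l) + - r" by simp
    then have "Q powi (int l - (r - 1)) = p * Q powi (- r)"
      by (simp only: p_def Q_powi_add power_int_of_nat)
    then have "epol r (Suc l) Z - epol r (Suc l) (Z / Q) = epol (r - 1) l Z * (Z * (1 - 1 / p))"
      unfolding epol_divide_Q epol_Suc_left[of r l Z] epol_Suc[of "r - 1" l Z] p_def[symmetric]
      using p by (simp only:) (simp add: field_simps)
    then have "pterm r X Z (Suc l) - pterm r X (Z / Q) (Suc l)
      = ccoef (Suc l) * pochpair (Q powi (int l - (r - 1))) * ((X - Q powi (- r)) * epol (r - 1) l X)
        * (epol (r - 1) l Z * (Z * (1 - 1 / p)))"
      unfolding pterm_def pw epol_Suc_left[of r l X] right_diff_distrib[symmetric] by simp
    also have "\<dots> = (ccoef (Suc l) * (1 - 1 / p)) * pochpair (Q powi (int l - (r - 1))) * ((X - Q powi (- r)) * epol (r - 1) l X)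
        * (epol (r - 1) l Z * Z)"
      by (simp only: mult_ac)
    also have "ccoef (Suc l) * (1 - 1 / p) = ccoef l * (ka\<^sup>2 / Q)"
      unfolding ccoef_Suc p_def[symmetric] pl using p by (simp add: divide_simps) (simp add: algebra_simps)
    finally show ?thesis by (simp add: pterm_def mult_ac)
  qed
  have "psi r X Z - psi r X (Z / Q) = (\<Sum>l. pterm r X Z l - pterm r X (Z / Q) l)"
    unfolding psi_def by (intro suminf_diff summable_pterm)
  also have "\<dots> = (\<Sum>l. pterm r X Z (Suc l) - pterm r X (Z / Q) (Suc l)) + (pterm r X Z 0 - pterm r X (Z / Q) 0)"
    using suminf_split_head[OF summable_diff[OF summable_pterm summable_pterm], of r X Z r X "Z / Q"]
    by simp
  also have "\<dots> = (\<Sum>l. Z * (X - Q powi (- r)) * (ka\<^sup>2 / Q) * pterm (r - 1) X Z l)"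
    unfolding t by (simp add: pterm_def)
  also have "\<dots> = Z * (X - Q powi (- r)) * (ka\<^sup>2 / Q) * psi (r - 1) X Z"
    unfolding psi_def by (intro suminf_mult summable_pterm)
  finally show ?thesis by (simp add: mult_ac)
qed

text \<open>Unlike \<open>psi_lower\<close>, this does not hold term by term. The factors
  \<open>(1 - \<kappa>Xu)(1 - \<kappa>X/u)\<close> must be balanced against the factors
  \<open>(1 - \<kappa>yu)(1 - \<kappa>y/u)\<close> that \<open>pochpair\<close> gains when
  \<open>r\<close> rises, and these vary with \<open>l\<close>; the discrepancy telescopes.\<close>

lemma psi_raise:
  "(1 - X * Q powi (1 + r)) * psi r X Z - (1 - ka * X * u) * (1 - ka * X / u) * psi r (X * Q) Z
    = - (Q powi (1 + r)) * X * psi (r + 1) X Z"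
proof -
  define \<rho> where "\<rho> = Q powi (1 + r)"
  have \<rho>: "\<rho> \<noteq> 0" by (simp add: \<rho>_def)
  define H where "H = (\<lambda>l. case l of 0 \<Rightarrow> 0 | Suc l \<Rightarrow>
      - (ka\<^sup>2) * X * (X - Q powi (int l - r - 1)) * pterm r (X * Q) Z l)"
  \<comment> \<open>The parts containing \<open>u + 1/u\<close> cancel, since both have the
    coefficient \<kappa> times \<open>X y\<close>. The rest is divisible by \<open>X - y\<close>,
    which is the factor needed to pass from \<open>epol (r + 1) l X\<close> to the next
    index.\<close>
  have id: "- (X - y) - (1 - ka * X * u) * (1 - ka * X / u) * y + X * ((1 - ka * y * u) * (1 - ka * y / u))
     = - (ka\<^sup>2) * X * (X - y) * y" for y
    by (simp add: field_simps power2_eq_square)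
  \<comment> \<open>\<open>H\<close> is a telescoping certificate: it collects what remains after expanding in \<open>epol (r + 1) l X\<close>.\<close>
  have tel: "(1 - X * \<rho>) * pterm r X Z l - (1 - ka * X * u) * (1 - ka * X / u) * pterm r (X * Q) Z l
      - (- \<rho> * X * pterm (r + 1) X Z l) = H (Suc l) - H l" for l
  proof -
    define y where "y = Q powi (int l - r - 1)"
    define p where "p = Q ^ l"
    have \<rho>y: "\<rho> * y = p"
      by (simp add: \<rho>_def y_def p_def flip: power_int_add power_int_of_nat)
    have yQ: "Q powi (int l - r) = y * Q"
      using Q_powi_Suc[of "int l - r - 1"] by (simp add: y_def)
    have y': "Q powi (int l - (r + 1)) = y" by (simp add: y_def algebra_simps)
    have rho_inv: "Q powi (- (r + 1)) = 1 / \<rho>"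
      unfolding \<rho>_def by (simp only: power_int_minus_divide add.commute)
    define g where "g = (1 - ka * y * u) * (1 - ka * y / u)"
    define A where "A = (1 - ka * X * u) * (1 - ka * X / u)"
    have id': "- (X - y) - A * y + X * g = - (ka\<^sup>2) * X * (X - y) * y"
      unfolding A_def g_def by (rule id)
    define E where "E = epol (r + 1) l X"
    define G where "G = pochpair (y * Q)"
    have Gy: "pochpair y = g * G" unfolding g_def G_def by (rule pochpair_unfold)
    have "(X - 1 / \<rho>) * epol r l X = E * (X - y)"
      using epol_Suc_left[of "r + 1" l X] unfolding epol_Suc y' E_def rho_inv by simp
    then have eX: "(1 - X * \<rho>) * epol r l X = - \<rho> * (E * (X - y))"
      using \<rho> by (simp add: field_simps)
    have t1: "(1 - X * \<rho>) * pterm r X Z l = - \<rho> * (X - y) * (ccoef l * G * E * epol r l Z)"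
    proof -
      have "(1 - X * \<rho>) * pterm r X Z l = ccoef l * G * ((1 - X * \<rho>) * epol r l X) * epol r l Z"
        by (simp add: pterm_def yQ G_def mult_ac)
      then show ?thesis unfolding eX by (simp add: mult_ac)
    qed
    have t2: "pterm r (X * Q) Z l = p * (ccoef l * G * E * epol r l Z)"
      by (simp add: pterm_def yQ G_def epol_mult_Q p_def E_def mult_ac)
    have t3: "pterm (r + 1) X Z l = g * (ccoef l * G * E * epol (r + 1) l Z)"
      by (simp add: pterm_def y' Gy E_def mult_ac)
    have H1: "H (Suc l) = - (ka\<^sup>2) * X * (X - y) * p * (ccoef l * G * E * epol r l Z)"
      by (simp add: H_def t2 y_def)
    show ?thesis
    proof (cases l)
      case 0
      then have e: "epol r l Z = 1" "epol (r + 1) l Z = 1" "H l = 0" by (simp_all add: H_def)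
      define C where "C = ccoef l * G * E"
      have "- \<rho> * (X - y) * C - A * (p * C) - - \<rho> * X * (g * C) = - (ka\<^sup>2) * X * (X - y) * p * C"
        using id' \<rho>y by algebra
      then show ?thesis
        unfolding t1 t2 t3 H1 e C_def A_def by simp
    next
      case (Suc l')
      have "y = Q powi (int l' - r)" by (simp add: y_def Suc)
      define F where "F = epol r l' Z"
      have F1: "epol r l Z = F * (Z - y)"
        by (simp add: F_def Suc epol_Suc y_def)
      have F2: "epol (r + 1) l Z = (Z - 1 / \<rho>) * F"
        using epol_Suc_left[of "r + 1" l' Z] rho_inv by (simp add: Suc F_def)
      have E: "E = epol (r + 1) l' X * (X - Q powi (int l' - r - 1))"
        by (simp add: E_def Suc epol_Suc algebra_simps)
      have cc: "ka\<^sup>2 * Q ^ l' * ccoef l' = - ((1 - p) * ccoef l)"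
      proof -
        have "1 - Q ^ Suc l' \<noteq> 0" using Q_power_nz_1[of "Suc l'"] by simp
        then show ?thesis
          unfolding p_def Suc ccoef_Suc by (simp del: power_Suc) 
      qed
      have "H l = - (ka\<^sup>2 * Q ^ l' * ccoef l') * X * pochpair y * (epol (r + 1) l' X * (X - Q powi (int l' - r - 1))) * F"
        by (simp add: H_def Suc pterm_def epol_mult_Q F_def y_def mult_ac)
      then have H0: "H l = X * (1 - p) * g * (ccoef l * G * E * F)"
        unfolding cc Gy E[symmetric] by (simp add: mult_ac)
      define C where "C = ccoef l * G * E * F"
      have "- \<rho> * (X - y) * (C * (Z - y)) - A * (p * (C * (Z - y))) - - \<rho> * X * (g * (C * (Z - 1 / \<rho>)))
          = - (ka\<^sup>2) * X * (X - y) * p * (C * (Z - y)) - X * (1 - p) * g * C"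
      proof -
        define w where "w = 1 / \<rho>"
        have "\<rho> * w = 1" using \<rho> by (simp add: w_def)
        then show ?thesis unfolding w_def[symmetric] using id' \<rho>y by algebra
      qed
      then show ?thesis
        unfolding t1 t2 t3 H1 H0 F1 F2 C_def A_def by (simp only: mult_ac)
    qed
  qed
  have "H \<longlonglongrightarrow> 0"
  proof (rule LIMSEQ_imp_Suc)
    have "(\<lambda>l. pterm r (X * Q) Z l) \<longlonglongrightarrow> 0"
      by (intro summable_LIMSEQ_zero summable_pterm)
    moreover have "(\<lambda>l. Q powi (int l - r - 1)) \<longlonglongrightarrow> 0"
    proof -
      have "Q powi (int l - r - 1) = Q powi (- r - 1) * Q ^ l" for l
        by (simp add: algebra_simps flip: power_int_add power_int_of_nat)
      then show ?thesis using tendsto_mult_right_zero[OF Q_power_tendsto_0] by simp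
    qed
    ultimately have "(\<lambda>l. - (ka\<^sup>2) * X * (X - Q powi (int l - r - 1)) * pterm r (X * Q) Z l) \<longlonglongrightarrow> - (ka\<^sup>2) * X * (X - 0) * 0"
      by (intro tendsto_intros)
    then show "(\<lambda>l. H (Suc l)) \<longlonglongrightarrow> 0" by (simp add: H_def)
  qed
  then have "(\<lambda>l. H (Suc l) - H l) sums (0 - H 0)"
    by (rule telescope_sums)
  then have "(\<lambda>l. (1 - X * \<rho>) * pterm r X Z l - (1 - ka * X * u) * (1 - ka * X / u) * pterm r (X * Q) Z l
      - (- \<rho> * X * pterm (r + 1) X Z l)) sums 0"
    unfolding tel by (simp add: H_def)
  moreover have "(\<lambda>l. (1 - X * \<rho>) * pterm r X Z l - (1 - ka * X * u) * (1 - ka * X / u) * pterm r (X * Q) Z l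
      - (- \<rho> * X * pterm (r + 1) X Z l)) sums
     ((1 - X * \<rho>) * psi r X Z - (1 - ka * X * u) * (1 - ka * X / u) * psi r (X * Q) Z
      - (- \<rho> * X * psi (r + 1) X Z))"
    unfolding psi_def by (intro sums_diff sums_mult summable_sums summable_pterm)
  ultimately have "(1 - X * \<rho>) * psi r X Z - (1 - ka * X * u) * (1 - ka * X / u) * psi r (X * Q) Z
      - (- \<rho> * X * psi (r + 1) X Z) = 0"
    by (rule sums_unique2[symmetric])
  then show ?thesis by (simp add: \<rho>_def eq_neg_iff_add_eq_0)
qed

end

context qbase
begin

subsection \<open>Jackson sums\<close>

definition qsum :: "(complex \<Rightarrow> complex) \<Rightarrow> complex \<Rightarrow> complex" where
  "qsum f a = (\<Sum>j. f (a * Q ^ j) * (a * Q ^ j))"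

lemma isCont_0_lattice_bounded:
  assumes "isCont f (0::complex)"
  obtains K where "K > 0" "\<And>j. norm (f (a * Q ^ j) :: complex) \<le> K"
proof -
  have "(\<lambda>j. f (a * Q ^ j)) \<longlonglongrightarrow> f 0"
    by (rule isCont_0_lattice[OF assms])
  then have "Bseq (\<lambda>j. f (a * Q ^ j))"
    by (intro convergent_imp_Bseq convergentI)
  then show thesis using that by (auto simp: Bseq_def)
qed

lemma qsum_abs_summable:
  assumes "isCont f 0"
  shows "summable (\<lambda>j. norm (f (a * Q ^ j) * (a * Q ^ j)))"
proof -
  obtain K where K: "K > 0" "\<And>j. norm (f (a * Q ^ j)) \<le> K"
    using isCont_0_lattice_bounded[OF assms, of a] by blast
  show ?thesis
  proof (rule summable_comparison_test')
    show "summable (\<lambda>j. K * norm a * q ^ j)"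
      by (intro summable_mult summable_geometric) simp
    show "norm (norm (f (a * Q ^ j) * (a * Q ^ j))) \<le> K * norm a * q ^ j" if "j \<ge> 0" for j
      using K q_pos by (simp add: norm_mult mult.assoc mult_mono)
  qed
qed

lemma qsum_summable:
  assumes "isCont f 0"
  shows "summable (\<lambda>j. f (a * Q ^ j) * (a * Q ^ j))"
  using qsum_abs_summable[OF assms] by (rule summable_norm_cancel)

lemma qsum_cong: "(\<And>j. f (a * Q ^ j) = g (a * Q ^ j)) \<Longrightarrow> qsum f a = qsum g a"
  by (simp add: qsum_def)

lemma qsum_add: "isCont f 0 \<Longrightarrow> isCont g 0 \<Longrightarrow> qsum (\<lambda>z. f z + g z) a = qsum f a + qsum g a"
  unfolding qsum_def by (simp add: suminf_add[OF qsum_summable qsum_summable] distrib_right)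

lemma qsum_cmult: "isCont f 0 \<Longrightarrow> qsum (\<lambda>z. c * f z) a = c * qsum f a"
  unfolding qsum_def by (simp add: suminf_mult[OF qsum_summable, symmetric] mult.assoc)

text \<open>Dominated convergence: the factor \<open>a q^j\<close> of the Jackson sum supplies a
  geometric majorant, so a uniform bound on the lattice is enough.\<close>

lemma qsum_tendsto:
  assumes lim: "\<And>j. (\<lambda>n. f n (a * Q ^ j)) \<longlonglongrightarrow> g (a * Q ^ j)"
    and bnd: "\<And>n j. norm (f n (a * Q ^ j)) \<le> K"
  shows "(\<lambda>n. qsum (f n) a) \<longlonglongrightarrow> qsum g a"
proof -
  have "K \<ge> 0" using bnd[of 0 0] norm_ge_zero order_trans by blast
  have "summable (\<lambda>j. K * norm a * q ^ j)"
    by (intro summable_mult summable_geometric) simp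
  moreover have "norm (f n (a * Q ^ j) * (a * Q ^ j)) \<le> K * norm a * q ^ j" for n j
    using bnd[of n j] q_pos by (simp add: norm_mult mult.assoc mult_right_mono)
  ultimately show ?thesis
    unfolding qsum_def
    by (intro tannerys_theorem[where M = "\<lambda>j. K * norm a * q ^ j", THEN conjunct2, THEN conjunct2]
        tendsto_mult tendsto_const lim) (auto intro!: always_eventually)
qed

lemma qsum_exact:
  assumes "isCont g 0" "\<And>j. F (a * Q ^ j) * (a * Q ^ j) = g (a * Q ^ j) - g (a * Q ^ Suc j)"
  shows "qsum F a = g a - g 0"
proof -
  have "(\<lambda>j. g (a * Q ^ j)) \<longlonglongrightarrow> g 0"
    by (rule isCont_0_lattice[OF assms(1)])
  then have "(\<lambda>j. g (a * Q ^ j) - g (a * Q ^ Suc j)) sums (g (a * Q ^ 0) - g 0)"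
    by (rule telescope_sums')
  then show ?thesis
    unfolding qsum_def assms(2) by (metis sums_unique mult.right_neutral power_0)
qed

text \<open>Telescoping of \<open>f * g\<close>. The second sum starts at \<open>a * Q\<close>
  because \<open>G\<close> compares \<open>g\<close> at a point with \<open>g\<close> one step
  further out. The outer boundary term vanishes by \<open>f a = 0\<close>; the inner one,
  \<open>f 0 * g 0\<close>, does not depend on \<open>a\<close> and cancels between the two end
  points in \<open>J\<close>.\<close>

lemma qsum_by_parts:
  assumes "isCont f 0" "isCont g 0" "isCont F 0" "isCont G 0"
    and F: "\<And>j. F (a * Q ^ j) * (a * Q ^ j) = f (a * Q ^ j) - f (a * Q ^ Suc j)"
    and G: "\<And>j. G (a * Q ^ Suc j) * (a * Q ^ Suc j) = g (a * Q ^ Suc j) - g (a * Q ^ j)"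
    and "f a = 0"
  shows "qsum (\<lambda>z. F z * g z) a = qsum (\<lambda>z. f z * G z) (a * Q) - f 0 * g 0"
proof -
  have Fg: "isCont (\<lambda>z. F z * g z) 0" and fG: "isCont (\<lambda>z. f z * G z) 0" and fg: "isCont (\<lambda>z. f z * g z) 0"
    using assms by (auto intro!: continuous_intros)
  have "(\<lambda>j. f (a * Q ^ j) * g (a * Q ^ j)) \<longlonglongrightarrow> f 0 * g 0"
    by (rule isCont_0_lattice[OF fg])
  then have "(\<lambda>j. f (a * Q ^ j) * g (a * Q ^ j) - f (a * Q ^ Suc j) * g (a * Q ^ Suc j))
      sums (f (a * Q ^ 0) * g (a * Q ^ 0) - f 0 * g 0)"
    by (rule telescope_sums')
  moreover have "f (a * Q ^ j) * g (a * Q ^ j) - f (a * Q ^ Suc j) * g (a * Q ^ Suc j)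
     = F (a * Q ^ j) * g (a * Q ^ j) * (a * Q ^ j) - f (a * Q * Q ^ j) * G (a * Q * Q ^ j) * (a * Q * Q ^ j)" for j
  proof -
    have "F (a * Q ^ j) * g (a * Q ^ j) * (a * Q ^ j) = (f (a * Q ^ j) - f (a * Q ^ Suc j)) * g (a * Q ^ j)"
      using arg_cong[OF F[of j], of "\<lambda>v. v * g (a * Q ^ j)"] by (simp only: mult_ac)
    moreover have "f (a * Q * Q ^ j) * G (a * Q * Q ^ j) * (a * Q * Q ^ j)
      = f (a * Q ^ Suc j) * (g (a * Q ^ Suc j) - g (a * Q ^ j))"
      using arg_cong[OF G[of j], of "\<lambda>v. f (a * Q ^ Suc j) * v"] by (simp only: mult.assoc power_Suc)
    ultimately show ?thesis by (simp only:) (simp add: algebra_simps)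
  qed
  ultimately have "(\<lambda>j. F (a * Q ^ j) * g (a * Q ^ j) * (a * Q ^ j)
      - f (a * Q * Q ^ j) * G (a * Q * Q ^ j) * (a * Q * Q ^ j)) sums (- (f 0 * g 0))"
    using \<open>f a = 0\<close> by simp
  moreover have "(\<lambda>j. F (a * Q ^ j) * g (a * Q ^ j) * (a * Q ^ j)
      - f (a * Q * Q ^ j) * G (a * Q * Q ^ j) * (a * Q * Q ^ j)) sums
      (qsum (\<lambda>z. F z * g z) a - qsum (\<lambda>z. f z * G z) (a * Q))"
    unfolding qsum_def
    using qsum_summable[OF Fg] qsum_summable[OF fG] by (intro sums_diff summable_sums)
  ultimately have "qsum (\<lambda>z. F z * g z) a - qsum (\<lambda>z. f z * G z) (a * Q) = - (f 0 * g 0)"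
    by (rule sums_unique2[symmetric])
  then show ?thesis by (simp add: algebra_simps)
qed

lemma isCont_qpoch [continuous_intros]: "isCont f x \<Longrightarrow> isCont (\<lambda>z. qpoch (f z) q n) (x::complex)"
  unfolding qpoch_def by (intro continuous_intros)

end

context qmeix
begin

text \<open>
  The Jackson integral over \<open>Z\<close> from \<open>q\<^sup>-\<^sup>k\<close> to \<open>q\<^sup>-\<^sup>k/\<tau>\<close>, without the factor \<open>1 - q\<close>.
\<close>

definition J :: "nat \<Rightarrow> (complex \<Rightarrow> complex) \<Rightarrow> complex" where
  "J k f = qsum f (Q powi (- int k) / ta) - qsum f (Q powi (- int k))"

definition lattice :: "nat \<Rightarrow> complex set" where
  "lattice k = {Q powi (- int k) * Q ^ j | j. True} \<union> {Q powi (- int k) / ta * Q ^ j | j. True}"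

lemma lattice_mono: "lattice k \<subseteq> lattice (Suc k)"
proof -
  have "Q powi (- int k) = Q powi (- int (Suc k)) * Q"
    using Q_powi_Suc[of "- int (Suc k)"] by simp
  then have "Q powi (- int k) * Q ^ j = Q powi (- int (Suc k)) * Q ^ Suc j"
     "Q powi (- int k) / ta * Q ^ j = Q powi (- int (Suc k)) / ta * Q ^ Suc j" for j
    by simp_all
  then show ?thesis unfolding lattice_def by blast
qed

lemma J_cong: "(\<And>Z. Z \<in> lattice k \<Longrightarrow> f Z = g Z) \<Longrightarrow> J k f = J k g"
  unfolding J_def by (intro arg_cong2[of _ _ _ _ "(-)"] qsum_cong) (auto simp: lattice_def)

lemma J_add: "isCont f 0 \<Longrightarrow> isCont g 0 \<Longrightarrow> J k (\<lambda>z. f z + g z) = J k f + J k g"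
  by (simp add: J_def qsum_add)

lemma J_cmult: "isCont f 0 \<Longrightarrow> J k (\<lambda>z. c * f z) = c * J k f"
  by (simp add: J_def qsum_cmult right_diff_distrib)

lemma J_diff: "isCont f 0 \<Longrightarrow> isCont g 0 \<Longrightarrow> J k (\<lambda>z. f z - g z) = J k f - J k g"
  using J_add[of f "\<lambda>z. - 1 * g z" k] J_cmult[of g k "- 1"] by simp

lemma J_tendsto:
  assumes "\<And>Z. Z \<in> lattice k \<Longrightarrow> (\<lambda>n. f n Z) \<longlonglongrightarrow> g Z"
    and "\<And>n Z. Z \<in> lattice k \<Longrightarrow> norm (f n Z) \<le> K"
  shows "(\<lambda>n. J k (f n)) \<longlonglongrightarrow> J k g"
  unfolding J_def
  by (intro tendsto_diff qsum_tendsto[where K = K] assms) (auto simp: lattice_def)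

lemma J_exact:
  assumes "isCont g 0" "\<And>Z. Z \<in> lattice k \<Longrightarrow> F Z * Z = g Z - g (Z * Q)"
    and "g (Q powi (- int k)) = 0" "g (Q powi (- int k) / ta) = 0"
  shows "J k F = 0"
proof -
  have "qsum F a = g a - g 0" if "a \<in> {Q powi (- int k), Q powi (- int k) / ta}" for a
  proof (rule qsum_exact[OF assms(1)])
    fix j
    have "a * Q ^ j \<in> lattice k" using that by (auto simp: lattice_def)
    then show "F (a * Q ^ j) * (a * Q ^ j) = g (a * Q ^ j) - g (a * Q ^ Suc j)"
      using assms(2)[of "a * Q ^ j"] by (simp add: mult_ac)
  qed
  then show ?thesis using assms(3,4) by (simp add: J_def)
qed

lemma J_by_parts:
  assumes "isCont f 0" "isCont g 0" "isCont F 0" "isCont G 0"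
    and F: "\<And>Z. Z \<in> lattice (Suc k) \<Longrightarrow> F Z * Z = f Z - f (Z * Q)"
    and G: "\<And>Z. Z \<in> lattice k \<Longrightarrow> G Z * Z = g Z - g (Z / Q)"
    and "f (Q powi (- int (Suc k))) = 0" "f (Q powi (- int (Suc k)) / ta) = 0"
  shows "J (Suc k) (\<lambda>z. F z * g z) = J k (\<lambda>z. f z * G z)"
proof -
  have k: "Q powi (- int k) = Q powi (- int (Suc k)) * Q"
    using Q_powi_Suc[of "- int (Suc k)"] by simp
  have *: "qsum (\<lambda>z. F z * g z) a = qsum (\<lambda>z. f z * G z) (a * Q) - f 0 * g 0"
    if a: "a \<in> {Q powi (- int (Suc k)), Q powi (- int (Suc k)) / ta}" for a
  proof (rule qsum_by_parts)
    fix j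
    have "a * Q ^ j \<in> lattice (Suc k)" using a by (auto simp: lattice_def)
    then show "F (a * Q ^ j) * (a * Q ^ j) = f (a * Q ^ j) - f (a * Q ^ Suc j)"
      using F[of "a * Q ^ j"] by (simp add: mult_ac)
    have "a * Q ^ Suc j \<in> lattice k" using a unfolding lattice_def k by auto
    then show "G (a * Q ^ Suc j) * (a * Q ^ Suc j) = g (a * Q ^ Suc j) - g (a * Q ^ j)"
      using G[of "a * Q ^ Suc j"] by simp
  qed (use assms a in auto)
  show ?thesis
    unfolding J_def k using *[of "Q powi (- int (Suc k))"] *[of "Q powi (- int (Suc k)) / ta"] by simp
qed

lemma isCont_bounded_lattice:
  assumes "isCont f 0"
  obtains K where "K > 0" "\<And>Z. Z \<in> lattice k \<Longrightarrow> norm (f Z :: complex) \<le> K"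
proof -
  obtain K1 where K1: "K1 > 0" "\<And>j. norm (f (Q powi (- int k) * Q ^ j)) \<le> K1"
    using isCont_0_lattice_bounded[OF assms] by blast
  obtain K2 where K2: "K2 > 0" "\<And>j. norm (f (Q powi (- int k) / ta * Q ^ j)) \<le> K2"
    using isCont_0_lattice_bounded[OF assms] by blast
  have "norm (f Z) \<le> max K1 K2" if "Z \<in> lattice k" for Z
    using that K1 K2 by (auto simp: lattice_def le_max_iff_disj)
  then show thesis using K1 by (intro that[of "max K1 K2"]) auto
qed

subsection \<open>The Andrews-Askey \<open>q\<close>-beta integral\<close>

definition base_weight :: "complex \<Rightarrow> complex" where
  "base_weight Z = qpoch_inf (Z * Q) q * qpoch_inf (ta * Z * Q) q"

lemma isCont_base_weight: "isCont base_weight 0"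
  using isCont_qpoch_inf_mult[of Q] isCont_qpoch_inf_mult[of "ta * Q"]
  unfolding base_weight_def[abs_def] by (intro isCont_mult) (simp_all add: mult_ac)

lemma lattice0_nz:
  assumes "qpoch_inf c q \<noteq> 0" "qpoch_inf (c / ta) q \<noteq> 0" "Z \<in> lattice 0"
  shows "qpoch_inf (c * Z) q \<noteq> 0"
  using assms qpoch_inf_shift_nz[of c] qpoch_inf_shift_nz[of "c / ta"] by (auto simp: lattice_def)

definition qbeta :: "complex \<Rightarrow> complex \<Rightarrow> complex" where
  "qbeta c d = J 0 (\<lambda>Z. base_weight Z / (qpoch_inf (c * Z) q * qpoch_inf (d * Z) q))"

lemma qbeta_commute: "qbeta c d = qbeta d c"
  by (simp add: qbeta_def mult.commute)

lemma isCont_qbeta_integrand: "isCont (\<lambda>Z. base_weight Z / (qpoch_inf (c * Z) q * qpoch_inf (d * Z) q)) 0"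
  by (intro continuous_intros isCont_base_weight) simp

text \<open>With \<open>h\<close> the integrand, an exact q-difference gives one linear relation
  between the integrals of \<open>h\<close> and \<open>Z h\<close>. Since
  \<open>qbeta (c * Q) d\<close> is the integral of \<open>(1 - cZ) h\<close>, the integral of
  \<open>Z h\<close> can be eliminated.\<close>

lemma qbeta_rec:
  assumes c: "qpoch_inf c q \<noteq> 0" "qpoch_inf (c / ta) q \<noteq> 0"
    and d: "qpoch_inf d q \<noteq> 0" "qpoch_inf (d / ta) q \<noteq> 0"
  shows "qbeta c d * ((1 - c) * (1 - c / ta)) = qbeta (c * Q) d * (1 - c * d / ta)"
proof -
  define h where "h = (\<lambda>Z. base_weight Z / (qpoch_inf (c * Z) q * qpoch_inf (d * Z) q))"
  define g where "g = (\<lambda>Z. qpoch_inf Z q * qpoch_inf (ta * Z) q / (qpoch_inf (c * Z) q * qpoch_inf (d * Z) q))"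
  have h: "isCont h 0" unfolding h_def by (rule isCont_qbeta_integrand)
  have hz: "isCont (\<lambda>Z. Z * h Z) 0" using h by (intro continuous_intros)
  have g: "isCont g 0"
    unfolding g_def by (intro continuous_intros isCont_qpoch_inf_0) simp
  \<comment> \<open>The coefficients are those of
    \<open>(1 - Z)(1 - \<tau>Z) - (1 - cZ)(1 - dZ)\<close> divided by \<open>Z\<close>; the constant
    terms cancel.\<close>
  have "J 0 (\<lambda>Z. (c + d - 1 - ta) * h Z + (ta - c * d) * (Z * h Z)) = 0"
  proof (rule J_exact[OF g])
    fix Z assume Z: "Z \<in> lattice 0"
    note nz = lattice0_nz[OF c Z] lattice0_nz[OF d Z]
    have u: "qpoch_inf (x * Z) q = (1 - x * Z) * qpoch_inf (x * Z * Q) q" for x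
      by (rule qpoch_inf_unfold)
    have nz': "1 - c * Z \<noteq> 0" "1 - d * Z \<noteq> 0" "qpoch_inf (c * Z * Q) q \<noteq> 0" "qpoch_inf (d * Z * Q) q \<noteq> 0"
      using nz u[of c] u[of d] by auto
    have hC: "h Z = qpoch_inf (Z * Q) q * qpoch_inf (ta * Z * Q) q /
        ((1 - c * Z) * qpoch_inf (c * Z * Q) q * ((1 - d * Z) * qpoch_inf (d * Z * Q) q))"
      by (simp add: h_def base_weight_def u[of c] u[of d])
    have "g Z = (1 - Z) * (1 - ta * Z) * h Z"
      using u[of 1] u[of ta] by (simp add: g_def h_def base_weight_def)
    moreover have "g (Z * Q) = (1 - c * Z) * (1 - d * Z) * h Z"
      unfolding hC using nz' by (simp add: g_def mult_ac)
    ultimately show "((c + d - 1 - ta) * h Z + (ta - c * d) * (Z * h Z)) * Z = g Z - g (Z * Q)"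
      by (simp only:) (simp add: algebra_simps)
  next
    have 1: "qpoch_inf 1 q = 0" using qpoch_inf_unfold[of 1] by simp
    show "g (Q powi - int 0) = 0" "g (Q powi - int 0 / ta) = 0"
      by (simp_all add: g_def 1)
  qed
  then have M: "(c + d - 1 - ta) * J 0 h + (ta - c * d) * J 0 (\<lambda>Z. Z * h Z) = 0"
    using h hz by (simp add: J_add J_cmult)
  have "qbeta (c * Q) d = J 0 (\<lambda>Z. h Z - c * (Z * h Z))"
    unfolding qbeta_def
  proof (rule J_cong)
    fix Z assume Z: "Z \<in> lattice 0"
    have u: "qpoch_inf (c * Z) q = (1 - c * Z) * qpoch_inf (c * Q * Z) q"
      using qpoch_inf_unfold[of "c * Z"] by (simp add: mult_ac)
    with lattice0_nz[OF c Z] have "1 - c * Z \<noteq> 0" "qpoch_inf (c * Q * Z) q \<noteq> 0" by auto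
    then have "base_weight Z / (qpoch_inf (c * Q * Z) q * qpoch_inf (d * Z) q) = (1 - c * Z) * h Z"
      unfolding h_def u by simp
    then show "base_weight Z / (qpoch_inf (c * Q * Z) q * qpoch_inf (d * Z) q) = h Z - c * (Z * h Z)"
      by (simp only:) (simp add: algebra_simps)
  qed
  then have "qbeta (c * Q) d = J 0 h - c * J 0 (\<lambda>Z. Z * h Z)"
    using h hz by (simp add: J_diff J_cmult isCont_mult)
  moreover have "qbeta c d = J 0 h" by (simp add: qbeta_def h_def)
  moreover have "x * ((1 - c) * (1 - c / ta)) = (x - c * y) * (1 - c * d / ta)"
    if "(c + d - 1 - ta) * x + (ta - c * d) * y = 0" for x y
  proof -
    define v where "v = 1 / ta"
    have "ta * v = 1" by (simp add: v_def)
    then have "x * ((1 - c) * (1 - c * v)) = (x - c * y) * (1 - c * d * v)"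
      using that by algebra
    then show ?thesis by (simp add: v_def)
  qed
  ultimately show ?thesis using M by simp
qed

lemma qbeta_iterate:
  assumes c: "qpoch_inf c q \<noteq> 0" "qpoch_inf (c / ta) q \<noteq> 0"
    and d: "qpoch_inf d q \<noteq> 0" "qpoch_inf (d / ta) q \<noteq> 0"
  shows "qbeta c d * (qpoch c q n * qpoch (c / ta) q n) = qbeta (c * Q ^ n) d * qpoch (c * d / ta) q n"
proof (induction n)
  case (Suc n)
  have rec: "qbeta (c * Q ^ n) d * ((1 - c * Q ^ n) * (1 - c / ta * Q ^ n))
      = qbeta (c * Q ^ Suc n) d * (1 - c * d / ta * Q ^ n)"
    using qbeta_rec[of "c * Q ^ n" d] qpoch_inf_shift_nz[OF c(1), of n] qpoch_inf_shift_nz[OF c(2), of n] d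
    by (simp add: mult_ac)
  have "b * ((P * x) * (P' * y)) = q2 * (R * z)"
    if "b * (P * P') = q1 * R" "q1 * (x * y) = q2 * z" for b P P' x y q1 q2 R z :: complex
    using that by algebra
  from this[OF Suc rec] show ?case
    by (simp only: qpoch_Suc)
qed simp

text \<open>Limit of \<open>qbeta_iterate\<close> as \<open>c q^n\<close> tends to 0. Writing the
  shifted integrand as \<open>h Z * qpoch (c * Z) q n\<close> makes both the pointwise limit and the
  uniform bound visible.\<close>

lemma qbeta_to_0:
  assumes c: "qpoch_inf c q \<noteq> 0" "qpoch_inf (c / ta) q \<noteq> 0"
    and d: "qpoch_inf d q \<noteq> 0" "qpoch_inf (d / ta) q \<noteq> 0"
  shows "qbeta c d * (qpoch_inf c q * qpoch_inf (c / ta) q) = qbeta 0 d * qpoch_inf (c * d / ta) q"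
proof -
  define h where "h = (\<lambda>Z. base_weight Z / (qpoch_inf (c * Z) q * qpoch_inf (d * Z) q))"
  obtain K where K: "K > 0" "\<And>Z. Z \<in> lattice 0 \<Longrightarrow> norm (h Z) \<le> K"
    unfolding h_def using isCont_bounded_lattice[OF isCont_qbeta_integrand] by blast
  obtain R where R: "R > 0" "\<And>Z. Z \<in> lattice 0 \<Longrightarrow> norm (c * Z) \<le> R"
    using isCont_bounded_lattice[of "\<lambda>Z. c * Z"] by (auto intro!: continuous_intros)
  have eq: "base_weight Z / (qpoch_inf (c * Q ^ n * Z) q * qpoch_inf (d * Z) q) = h Z * qpoch (c * Z) q n"
    if "Z \<in> lattice 0" for Z n
  proof -
    have u: "qpoch_inf (c * Z) q = qpoch (c * Z) q n * qpoch_inf (c * Q ^ n * Z) q"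
      using qpoch_inf_split[of q "c * Z" n] by (simp add: mult_ac)
    with lattice0_nz[OF c that] have "qpoch (c * Z) q n \<noteq> 0" "qpoch_inf (c * Q ^ n * Z) q \<noteq> 0" by auto
    then show ?thesis unfolding h_def u by simp
  qed
  have "(\<lambda>n. J 0 (\<lambda>Z. h Z * qpoch (c * Z) q n)) \<longlonglongrightarrow> J 0 (\<lambda>Z. h Z * qpoch_inf (c * Z) q)"
  proof (rule J_tendsto)
    fix n Z assume Z: "Z \<in> lattice 0"
    have "norm (h Z * qpoch (c * Z) q n) \<le> K * exp (norm (c * Z) / (1 - q))"
      unfolding norm_mult using K(1) K(2)[OF Z] norm_qpoch_le[of "c * Z" n] by (intro mult_mono) (auto simp: norm_mult)
    also have "\<dots> \<le> K * exp (R / (1 - q))"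
      using K R(2)[OF Z] q_less_1 by (intro mult_left_mono) (auto simp: divide_right_mono)
    finally show "norm (h Z * qpoch (c * Z) q n) \<le> K * exp (R / (1 - q))" .
  qed (intro tendsto_intros qpoch_LIMSEQ)
  moreover have "J 0 (\<lambda>Z. h Z * qpoch (c * Z) q n) = qbeta (c * Q ^ n) d" for n
    unfolding qbeta_def by (intro J_cong) (simp add: eq)
  moreover have "J 0 (\<lambda>Z. h Z * qpoch_inf (c * Z) q) = qbeta 0 d"
    unfolding qbeta_def by (intro J_cong) (use lattice0_nz[OF c] in \<open>simp add: h_def\<close>)
  ultimately have "(\<lambda>n. qbeta (c * Q ^ n) d * qpoch (c * d / ta) q n) \<longlonglongrightarrow> qbeta 0 d * qpoch_inf (c * d / ta) q"
    by (intro tendsto_mult qpoch_LIMSEQ) simp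
  moreover have "(\<lambda>n. qbeta c d * (qpoch c q n * qpoch (c / ta) q n))
      \<longlonglongrightarrow> qbeta c d * (qpoch_inf c q * qpoch_inf (c / ta) q)"
    by (intro tendsto_mult tendsto_const qpoch_LIMSEQ)
  ultimately show ?thesis
    unfolding qbeta_iterate[OF assms] by (rule LIMSEQ_unique[symmetric])
qed

lemma qbeta_eq_qbeta_0_0:
  assumes c: "qpoch_inf c q \<noteq> 0" "qpoch_inf (c / ta) q \<noteq> 0"
    and d: "qpoch_inf d q \<noteq> 0" "qpoch_inf (d / ta) q \<noteq> 0"
  shows "qbeta c d * (qpoch_inf c q * qpoch_inf (c / ta) q * (qpoch_inf d q * qpoch_inf (d / ta) q))
    = qbeta 0 0 * qpoch_inf (c * d / ta) q"
proof -
  have "qbeta d 0 * (qpoch_inf d q * qpoch_inf (d / ta) q) = qbeta 0 0 * qpoch_inf 0 q"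
    using qbeta_to_0[OF d, of 0] by simp
  then have "qbeta 0 d * (qpoch_inf d q * qpoch_inf (d / ta) q) = qbeta 0 0"
    by (simp add: qbeta_commute[of 0 d])
  moreover have "x * (C * D) = z * P" if "x * C = y * P" "y * D = z" for x y z C D P :: complex
    using that by algebra
  ultimately show ?thesis
    using qbeta_to_0[OF c d] by blast
qed

text \<open>For \<open>c = q\<close> and \<open>d = q\<tau>\<close> the integrand is constant, which fixes the normalisation.\<close>

lemma qbeta_0_0:
  assumes "qpoch_inf (Q / ta) q \<noteq> 0" "qpoch_inf (Q * ta) q \<noteq> 0"
  shows "qbeta 0 0 = (1 / ta - 1) * qpoch_inf Q q * qpoch_inf (Q / ta) q * qpoch_inf (Q * ta) q"
proof -
  have "qbeta Q (Q * ta) = J 0 (\<lambda>_. 1)"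
    unfolding qbeta_def
  proof (rule J_cong)
    fix Z assume Z: "Z \<in> lattice 0"
    have "qpoch_inf (Q * Z) q \<noteq> 0" "qpoch_inf (Q * ta * Z) q \<noteq> 0"
      using lattice0_nz[OF _ _ Z, of Q] lattice0_nz[OF _ _ Z, of "Q * ta"] assms qpoch_inf_Q_nz by auto
    then show "base_weight Z / (qpoch_inf (Q * Z) q * qpoch_inf (Q * ta * Z) q) = 1"
      by (simp add: base_weight_def mult_ac)
  qed
  also have "\<dots> = (1 / ta - 1) / (1 - Q)"
  proof -
    have "norm Q < 1" using q_pos q_less_1 by simp
    then have "qsum (\<lambda>_. 1) a = a / (1 - Q)" for a
      unfolding qsum_def by (simp add: suminf_mult summable_geometric suminf_geometric)
    then show ?thesis by (simp add: J_def diff_divide_distrib)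
  qed
  finally have "(1 / ta - 1) / (1 - Q) * (qpoch_inf Q q * qpoch_inf (Q / ta) q * (qpoch_inf (Q * ta) q * qpoch_inf Q q))
    = qbeta 0 0 * qpoch_inf (Q * Q) q"
    using qbeta_eq_qbeta_0_0[of Q "Q * ta"] assms qpoch_inf_Q_nz by simp
  moreover have "qpoch_inf Q q = (1 - Q) * qpoch_inf (Q * Q) q"
    by (rule qpoch_inf_unfold)
  moreover from this qpoch_inf_Q_nz have "1 - Q \<noteq> 0" "qpoch_inf (Q * Q) q \<noteq> 0" by auto
  moreover have "z = A * P * a * b"
    if "A / N * (P * a * (b * P)) = z * B" "P = N * B" "N \<noteq> 0" "B \<noteq> 0" for A N P a b z B :: complex
  proof -
    have "A / N * (P * a * (b * P)) = (A * P * a * b) * B" using that(2,3) by simp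
    with that(1,4) show ?thesis by (metis mult_right_cancel)
  qed
  ultimately show ?thesis by blast
qed

end

subsection \<open>The normalised integral\<close>

text \<open>
  \<open>az\<close> and \<open>bz\<close> (\<open>ax\<close> and \<open>bx\<close>) are the parameters of \<open>p\<^sub>k\<close> (of \<open>p\<^sub>n\<close>) not depending on
  \<open>Z\<close> (on \<open>X\<close>). Their order depends on the choices of \<open>\<lambda>\<close> and \<open>\<xi>\<close>, so only the unordered pair is fixed.
\<close>

locale qmeix_full = qmeix +
  fixes az bz ax bx :: complex
  assumes qpoch_ta_nz: "qpoch_inf (of_real q / ta) q \<noteq> 0" "qpoch_inf (of_real q * ta) q \<noteq> 0"
    and qpoch_sg_nz: "qpoch_inf (of_real q * sg) q \<noteq> 0"
    and abz: "{az * ka, bz * ka} = {of_real q, of_real q * ta}"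
    and abx: "{ax * ka, bx * ka} = {of_real q, of_real q * sg}"
begin

lemma J_lincomb:
  assumes "isCont f 0" "isCont g 0"
  shows "J k (\<lambda>z. c * f z + d * g z) = c * J k f + d * J k g"
proof -
  have "isCont (\<lambda>z. c * f z) 0" "isCont (\<lambda>z. d * g z) 0"
    using assms by (auto intro!: continuous_intros)
  then show ?thesis using assms by (simp add: J_add J_cmult)
qed

lemma az_nz: "az \<noteq> 0" and ax_nz: "ax \<noteq> 0"
  using abz abx by (auto simp: doubleton_eq_iff)

lemma abz_prod: "(1 - az * (ka * Z) * Q ^ k) * (1 - bz * (ka * Z) * Q ^ k)
    = (1 - Z * Q ^ Suc k) * (1 - ta * Z * Q ^ Suc k)"
proof -
  have "(1 - az * (ka * Z) * Q ^ k) * (1 - bz * (ka * Z) * Q ^ k)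
     = (1 - az * ka * (Z * Q ^ k)) * (1 - bz * ka * (Z * Q ^ k))"
    by (simp add: mult_ac)
  also have "\<dots> = (1 - Q * (Z * Q ^ k)) * (1 - Q * ta * (Z * Q ^ k))"
    using abz by (auto simp: doubleton_eq_iff)
  finally show ?thesis by (simp add: mult_ac)
qed

lemma abx_prod: "(1 - ax * (ka * Z) * Q ^ k) * (1 - bx * (ka * Z) * Q ^ k)
    = (1 - Z * Q ^ Suc k) * (1 - sg * Z * Q ^ Suc k)"
proof -
  have "(1 - ax * (ka * Z) * Q ^ k) * (1 - bx * (ka * Z) * Q ^ k)
     = (1 - ax * ka * (Z * Q ^ k)) * (1 - bx * ka * (Z * Q ^ k))"
    by (simp add: mult_ac)
  also have "\<dots> = (1 - Q * (Z * Q ^ k)) * (1 - Q * sg * (Z * Q ^ k))"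
    using abx by (auto simp: doubleton_eq_iff)
  finally show ?thesis by (simp add: mult_ac)
qed

definition pz :: "nat \<Rightarrow> complex \<Rightarrow> complex" where
  "pz k Z = cdq_hahn k u az bz (ka * Z) q"

definition px :: "nat \<Rightarrow> complex \<Rightarrow> complex" where
  "px n X = cdq_hahn n u ax bx (ka * X) q"

lemma pz_raise: "(1 - Z * Q ^ Suc k) * (1 - ta * Z * Q ^ Suc k) * pz k Z
    - (1 - ka * Z * u) * (1 - ka * Z / u) * pz k (Z * Q) = ka * Z * pz (Suc k) Z"
  unfolding pz_def abz_prod[symmetric]
  using cdq_hahn_raise[OF az_nz u_nz, of "ka * Z" k bz] by (simp add: mult.assoc)

lemma px_raise: "(1 - X * Q ^ Suc n) * (1 - sg * X * Q ^ Suc n) * px n X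
    - (1 - ka * X * u) * (1 - ka * X / u) * px n (X * Q) = ka * X * px (Suc n) X"
  unfolding px_def abx_prod[symmetric]
  using cdq_hahn_raise[OF ax_nz u_nz, of "ka * X" n bx] by (simp add: mult.assoc)

text \<open>The infinite products vanish at \<open>q^(-k-1)\<close> and
  \<open>q^(-k-1)/\<tau>\<close>, one lattice step outside the range of \<open>J k\<close>. This is
  what suppresses the boundary terms when the sum for \<open>k + 1\<close> is taken by
  parts.\<close>

definition weighted_hahn :: "nat \<Rightarrow> complex \<Rightarrow> complex" where
  "weighted_hahn k Z = pz k Z * qpoch_inf (Z * Q ^ Suc k) q * qpoch_inf (ta * Z * Q ^ Suc k) q / pochpair Z"

lemma isCont_pochpair: "isCont pochpair 0"
  using isCont_pochpair_mult[of 1] by simp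

lemma isCont_weighted_hahn: "isCont (weighted_hahn k) 0"
proof -
  have "isCont (pz k) 0"
    unfolding pz_def[abs_def] cdq_hahn_alt
    by (intro continuous_intros) (simp_all add: continuous_intros)
  moreover have "isCont (\<lambda>Z. qpoch_inf (Z * Q ^ Suc k) q) 0" "isCont (\<lambda>Z. qpoch_inf (ta * Z * Q ^ Suc k) q) 0"
    using isCont_qpoch_inf_mult[of "Q ^ Suc k"] isCont_qpoch_inf_mult[of "ta * Q ^ Suc k"]
    by (simp_all add: mult_ac)
  ultimately show ?thesis
    unfolding weighted_hahn_def[abs_def] by (intro continuous_intros isCont_pochpair) simp_all
qed

lemma isCont_laguerre_sum: "isCont (\<lambda>Z. laguerre_sum \<tau> m n (Z * c)) 0"
  unfolding laguerre_sum_def by (intro continuous_intros)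

lemma isCont_psi_fst: "isCont (\<lambda>X. psi r X Z) 0"
  unfolding psi_commute[of r _ Z] by (rule isCont_psi)

text \<open>This is \<open>pz_raise\<close> divided by \<open>pochpair Z\<close>: passing from
  \<open>Z\<close> to \<open>Zq\<close> in \<open>1 / pochpair\<close> contributes the quadratic
  factor in front of \<open>pz k (Z * Q)\<close>, and the infinite products contribute the two
  linear factors in front of \<open>pz k Z\<close>.\<close>

lemma weighted_hahn_diff:
  assumes "pochpair Z \<noteq> 0"
  shows "weighted_hahn k Z - weighted_hahn k (Z * Q) = ka * weighted_hahn (Suc k) Z * Z"
proof -
  define A where "A = (1 - ka * Z * u) * (1 - ka * Z / u)"
  have G: "pochpair Z = A * pochpair (Z * Q)" unfolding A_def by (rule pochpair_unfold)
  with assms have nz: "A \<noteq> 0" "pochpair (Z * Q) \<noteq> 0" by auto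
  define a b where "a = qpoch_inf (Z * Q ^ Suc (Suc k)) q" and "b = qpoch_inf (ta * Z * Q ^ Suc (Suc k)) q"
  have a: "qpoch_inf (Z * Q ^ Suc k) q = (1 - Z * Q ^ Suc k) * a"
    using qpoch_inf_unfold[of "Z * Q ^ Suc k"] by (simp add: a_def mult_ac)
  have b: "qpoch_inf (ta * Z * Q ^ Suc k) q = (1 - ta * Z * Q ^ Suc k) * b"
    using qpoch_inf_unfold[of "ta * Z * Q ^ Suc k"] by (simp add: b_def mult_ac)
  have 1: "weighted_hahn k (Z * Q) = A * pz k (Z * Q) * a * b / pochpair Z"
    unfolding G using nz by (simp add: weighted_hahn_def a_def b_def mult_ac)
  have "weighted_hahn k Z - weighted_hahn k (Z * Q) = ((1 - Z * Q ^ Suc k) * (1 - ta * Z * Q ^ Suc k) * pz k Z - A * pz k (Z * Q)) * a * b / pochpair Z"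
  proof -
    have "p * (v * a) * (w * b) / g - A * p' * a * b / g = (v * w * p - A * p') * a * b / g" for p p' v w g
      by (simp add: diff_divide_distrib algebra_simps)
    then show ?thesis unfolding 1 unfolding weighted_hahn_def a b .
  qed
  also have "\<dots> = ka * Z * pz (Suc k) Z * a * b / pochpair Z"
    unfolding A_def pz_raise ..
  also have "\<dots> = ka * weighted_hahn (Suc k) Z * Z"
    by (simp add: weighted_hahn_def a_def b_def mult_ac)
  finally show ?thesis .
qed

section \<open>Constants of the claimed value, and the base case \<open>k = n = 0\<close>\<close>

definition base_const :: complex where
  "base_const = (1 / ta - 1) * qpoch_inf Q q * qpoch_inf (Q / ta) q * qpoch_inf (Q * ta) q / pochpair (1 / ta)"

text \<open>Determined by the value \<open>base_const\<close> at \<open>k = m = n = 0\<close> and by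
  the one-step ratios in the next lemmas. The triangular number comes from the power of
  \<open>q\<close> that grows linearly with \<open>r\<close> each time \<open>r\<close> rises;
  integers are used because \<open>r\<close> may be negative.\<close>

definition kernel_const :: "nat \<Rightarrow> nat \<Rightarrow> nat \<Rightarrow> complex" where
  "kernel_const k m n = base_const * (- ka) ^ (k + n) * (- 1 / ta) ^ m *
    Q powi (int m * (int n - int k) - int k - (int k - int m + int n) * (int k - int m + int n + 1) div 2)"

lemma triangle_step: "((r::int) + 1) * (r + 1 + 1) div 2 = r * (r + 1) div 2 + (r + 1)"
proof -
  have "(r + 1) * (r + 1 + 1) = r * (r + 1) + (r + 1) * 2" by (simp add: algebra_simps)
  then show ?thesis by simp
qed

lemma kernel_const_Suc_k: "kernel_const (Suc k) m n = - ka * Q powi (- int k - int n - 2) * kernel_const k m n"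
proof -
  define r where "r = int k - int m + int n"
  have r: "int (Suc k) - int m + int n = r + 1" "int k - int m + int n = r" by (simp_all add: r_def)
  have "int m * (int n - int (Suc k)) - int (Suc k) - (r * (r + 1) div 2 + (r + 1))
    = (- int k - int n - 2) + (int m * (int n - int k) - int k - r * (r + 1) div 2)"
    by (simp add: r_def algebra_simps)
  then show ?thesis
    unfolding kernel_const_def r triangle_step by (simp only: Q_powi_add) (simp add: mult_ac)
qed

lemma kernel_const_Suc_n: "kernel_const k m (Suc n) = - ka * Q powi (2 * int m - int k - int n - 1) * kernel_const k m n"
proof -
  define r where "r = int k - int m + int n"
  have r: "int k - int m + int (Suc n) = r + 1" "int k - int m + int n = r" by (simp_all add: r_def)
  have "int m * (int (Suc n) - int k) - int k - (r * (r + 1) div 2 + (r + 1))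
    = (2 * int m - int k - int n - 1) + (int m * (int n - int k) - int k - r * (r + 1) div 2)"
    by (simp add: r_def algebra_simps)
  then show ?thesis
    unfolding kernel_const_def r triangle_step by (simp only: Q_powi_add) (simp add: mult_ac)
qed

lemma kernel_const_Suc_m: "kernel_const k (Suc m) n = - (1 / ta) * Q powi (2 * int n - int m) * kernel_const k m n"
proof -
  define r where "r = int k - int (Suc m) + int n"
  have r: "int k - int (Suc m) + int n = r" "int k - int m + int n = r + 1" by (simp_all add: r_def)
  have "int (Suc m) * (int n - int k) - int k - r * (r + 1) div 2
    = (2 * int n - int m) + (int m * (int n - int k) - int k - (r * (r + 1) div 2 + (r + 1)))"
    by (simp add: r_def algebra_simps)
  then show ?thesis
    unfolding kernel_const_def r triangle_step by (simp only: Q_powi_add) (simp add: mult_ac)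
qed

text \<open>The integral for \<open>k = n = 0\<close>, where \<open>r = -m\<close>. There
  \<open>laguerre_fac ta 0 h\<close> vanishes for \<open>h > 0\<close>, so that, up to a constant,
  \<open>L_m\<close> collapses to the single product \<open>(Z q^(1-m); q)_m\<close>.\<close>

definition base_integral :: "nat \<Rightarrow> complex \<Rightarrow> complex" where
  "base_integral m X = J 0 (\<lambda>Z. base_weight Z / pochpair Z * qpoch (Z * Q powi (1 - int m)) q m * psi (- int m) X Z)"

lemma pochpair_lattice0:
  assumes "pochpair 1 \<noteq> 0" "pochpair (1 / ta) \<noteq> 0" "Z \<in> lattice 0"
  shows "pochpair Z \<noteq> 0"
proof -
  have "pochpair Z = qpoch_inf (ka * u * Z) q * qpoch_inf (ka / u * Z) q"
    by (simp add: pochpair_def mult_ac)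
  then show ?thesis
    using assms lattice0_nz[of "ka * u" Z] lattice0_nz[of "ka / u" Z] by (auto simp: pochpair_def mult_ac)
qed

lemma isCont_base_weight_pochpair: "isCont (\<lambda>Z. base_weight Z / pochpair Z) 0"
  by (intro isCont_divide isCont_base_weight isCont_pochpair) simp

text \<open>
  The difference of the two kernels is lowered in \<open>X\<close> and raised again in \<open>Z\<close>; the result is an
  exact \<open>q\<close>-difference in \<open>Z\<close>.
\<close>

lemma base_integral_0_step:
  assumes G: "pochpair 1 \<noteq> 0" "pochpair (1 / ta) \<noteq> 0"
  shows "base_integral 0 X = (1 - Q * sg * X) * base_integral 0 (X * Q)"
proof -
  define Y where "Y = X * Q"
  define h where "h = (\<lambda>Z. base_weight Z / pochpair Z)"
  define a where "a = (\<lambda>Z. h Z * psi 0 Y Z)"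
  define b where "b = (\<lambda>Z. h Z * ((1 - Z) * psi (- 1) Y Z))"
  have h: "isCont h 0" unfolding h_def by (rule isCont_base_weight_pochpair)
  have ab: "isCont a 0" "isCont b 0"
    unfolding a_def b_def by (intro continuous_intros h isCont_psi)+
  define g where "g = (\<lambda>Z. qpoch_inf Z q * qpoch_inf (ta * Z) q / pochpair Z * psi (- 1) Y Z)"
  have g: "isCont g 0"
    unfolding g_def by (intro continuous_intros isCont_pochpair isCont_qpoch_inf_0 isCont_psi) simp
  \<comment> \<open>By \<open>psi_raise\<close> in \<open>Z\<close> at level \<open>-1\<close>, the
    q-difference of \<open>g\<close> is \<open>-Z h psi_0 - \<tau> Z (1 - Z) h psi_(-1)\<close>.
    Division by \<open>Z\<close> leaves this combination of \<open>a\<close> and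
    \<open>b\<close>.\<close>
  have "J 0 (\<lambda>Z. (- 1) * a Z + (- ta) * b Z) = 0"
  proof (rule J_exact[OF g])
    fix Z assume "Z \<in> lattice 0"
    then have GZ: "pochpair Z \<noteq> 0" by (rule pochpair_lattice0[OF G])
    define A where "A = (1 - ka * Z * u) * (1 - ka * Z / u)"
    have GA: "pochpair Z = A * pochpair (Z * Q)" unfolding A_def by (rule pochpair_unfold)
    with GZ have nz: "A \<noteq> 0" "pochpair (Z * Q) \<noteq> 0" by auto
    have "g Z = (1 - Z) * (1 - ta * Z) * h Z * psi (- 1) Y Z"
      using qpoch_inf_unfold[of Z] qpoch_inf_unfold[of "ta * Z"] by (simp add: g_def h_def base_weight_def)
    moreover have "g (Z * Q) = A * h Z * psi (- 1) Y (Z * Q)"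
      unfolding h_def GA using nz by (simp add: g_def base_weight_def mult_ac)
    moreover have "(1 - Z) * psi (- 1) Y Z - A * psi (- 1) Y (Z * Q) = - Z * psi 0 Y Z"
      using psi_raise[of Z "- 1" Y] by (simp add: A_def psi_commute[of _ Y])
    ultimately show "((- 1) * a Z + (- ta) * b Z) * Z = g Z - g (Z * Q)"
      unfolding a_def b_def by (simp only:) algebra
  next
    have "qpoch_inf 1 q = 0" using qpoch_inf_unfold[of 1] by simp
    then show "g (Q powi - int 0) = 0" "g (Q powi - int 0 / ta) = 0"
      by (simp_all add: g_def)
  qed
  then have ab0: "J 0 a = - ta * J 0 b"
    using J_lincomb[OF ab, of 0 "- 1" "- ta"] by (simp only:) algebra
  have "base_integral 0 Y - base_integral 0 X = J 0 (\<lambda>Z. (- X * ka\<^sup>2) * b Z)"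
  proof -
    have "psi 0 Y Z - psi 0 X Z = - X * ka\<^sup>2 * ((1 - Z) * psi (- 1) Y Z)" for Z
    proof -
      have "Y * ((Z - 1) * (ka\<^sup>2 / Q) * v) = - X * ka\<^sup>2 * ((1 - Z) * v)" for v
        by (simp add: Y_def field_simps)
      moreover have "Y / Q = X" by (simp add: Y_def)
      ultimately show ?thesis
        using psi_lower[of 0 Z Y] by (simp add: psi_commute[of _ Z])
    qed
    then have "h Z * psi 0 Y Z - h Z * psi 0 X Z = (- X * ka\<^sup>2) * b Z" for Z
      unfolding b_def right_diff_distrib[symmetric] by (simp add: mult_ac)
    then have "J 0 (\<lambda>Z. h Z * psi 0 Y Z - h Z * psi 0 X Z) = J 0 (\<lambda>Z. (- X * ka\<^sup>2) * b Z)"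
      by simp
    moreover have "J 0 (\<lambda>Z. h Z * psi 0 Y Z - h Z * psi 0 X Z)
        = J 0 (\<lambda>Z. h Z * psi 0 Y Z) - J 0 (\<lambda>Z. h Z * psi 0 X Z)"
      by (intro J_diff continuous_intros h isCont_psi)
    moreover have "base_integral 0 X' = J 0 (\<lambda>Z. h Z * psi 0 X' Z)" for X'
      by (simp add: base_integral_def h_def)
    ultimately show ?thesis by simp
  qed
  also have "\<dots> = X * Q * sg * (- ta * J 0 b)"
    by (simp only: J_cmult[OF ab(2)] ka_sq) (simp add: mult_ac)
  also have "\<dots> = X * Q * sg * base_integral 0 Y"
    unfolding ab0[symmetric] by (simp add: base_integral_def a_def h_def)
  finally show ?thesis by (simp add: Y_def algebra_simps)
qed

lemma base_integral_0:
  assumes G: "pochpair 1 \<noteq> 0" "pochpair (1 / ta) \<noteq> 0"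
  shows "base_integral 0 X = base_const * qpoch_inf (Q * sg * X) q"
proof -
  have to0: "base_integral 0 X = qpoch_inf (Q * sg * X) q * base_integral 0 0" for X
  proof -
    have eq: "base_integral 0 X = qpoch (Q * sg * X) q n * base_integral 0 (X * Q ^ n)" for n
    proof (induction n)
      case (Suc n)
      show ?case
        unfolding Suc base_integral_0_step[OF G, of "X * Q ^ n"] qpoch_Suc by (simp add: mult_ac)
    qed simp
    obtain K1 where K1: "K1 > 0" "\<And>Z. Z \<in> lattice 0 \<Longrightarrow> norm (base_weight Z / pochpair Z) \<le> K1"
      using isCont_bounded_lattice[OF isCont_base_weight_pochpair] by blast
    obtain R where R: "R > 0" "\<And>Z. Z \<in> lattice 0 \<Longrightarrow> norm Z \<le> R"
      using isCont_bounded_lattice[of "\<lambda>Z. Z"] by (auto intro!: continuous_intros)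
    obtain K2 where K2: "K2 > 0" "\<And>Y Z. norm Y \<le> max R (norm X) \<Longrightarrow> norm Z \<le> max R (norm X) \<Longrightarrow> norm (psi 0 Y Z) \<le> K2"
      using psi_bounded by blast
    have "(\<lambda>n. base_integral 0 (X * Q ^ n)) \<longlonglongrightarrow> base_integral 0 0"
      unfolding base_integral_def
    proof (rule J_tendsto)
      fix Z
      show "(\<lambda>n. base_weight Z / pochpair Z * qpoch (Z * Q powi (1 - int 0)) q 0 * psi (- int 0) (X * Q ^ n) Z)
         \<longlonglongrightarrow> base_weight Z / pochpair Z * qpoch (Z * Q powi (1 - int 0)) q 0 * psi (- int 0) 0 Z"
        by (intro tendsto_mult tendsto_const isCont_0_lattice[where f = "\<lambda>X. psi (- int 0) X Z"] isCont_psi_fst)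
    next
      fix n Z assume Z: "Z \<in> lattice 0"
      have "norm (X * Q ^ n) \<le> norm X * 1"
        unfolding norm_mult norm_Q_power using q_pos q_less_1 by (intro mult_left_mono power_le_one) auto
      then have "norm (psi 0 (X * Q ^ n) Z) \<le> K2"
        using R(2)[OF Z] by (intro K2) auto
      then show "norm (base_weight Z / pochpair Z * qpoch (Z * Q powi (1 - int 0)) q 0 * psi (- int 0) (X * Q ^ n) Z) \<le> K1 * K2"
      proof -
        assume *: "norm (psi 0 (X * Q ^ n) Z) \<le> K2"
        have "norm (base_weight Z / pochpair Z * psi 0 (X * Q ^ n) Z) \<le> K1 * K2"
          unfolding norm_mult[of "base_weight Z / pochpair Z"] using K1(1) K1(2)[OF Z] K2(1) * by (intro mult_mono) auto
        then show ?thesis by simp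
      qed
    qed
    then have "(\<lambda>n. qpoch (Q * sg * X) q n * base_integral 0 (X * Q ^ n)) \<longlonglongrightarrow> qpoch_inf (Q * sg * X) q * base_integral 0 0"
      by (intro tendsto_mult qpoch_LIMSEQ)
    then show ?thesis
      unfolding eq[symmetric] by (simp add: LIMSEQ_const_iff)
  qed
  \<comment> \<open>For \<open>r = 0\<close> and \<open>X = 1\<close> the first factor of
    \<open>epol 0 l 1\<close> is \<open>1 - 1\<close>, so only the term \<open>l = 0\<close>
    survives and the kernel is constant in \<open>Z\<close>.\<close>
  have psi1: "psi 0 1 Z = pochpair 1" for Z
  proof -
    have "epol 0 l 1 = 0" if "l \<noteq> 0" for l
      unfolding epol_def using that by (intro prod_zero) (auto intro!: bexI[of _ 0])
    then have "psi 0 1 Z = (\<Sum>l\<in>{0}. pterm 0 1 Z l)"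
      unfolding psi_def by (intro suminf_finite) (auto simp: pterm_def)
    then show ?thesis by (simp add: pterm_def ccoef_def)
  qed
  have "qpoch_inf (Q * sg) q * base_integral 0 0 = J 0 (\<lambda>Z. pochpair 1 * (base_weight Z / pochpair Z))"
    using to0[of 1] by (simp add: base_integral_def psi1 mult_ac)
  also have "\<dots> = pochpair 1 * qbeta (ka * u) (ka / u)"
  proof -
    have "qbeta (ka * u) (ka / u) = J 0 (\<lambda>Z. base_weight Z / pochpair Z)"
      unfolding qbeta_def by (intro J_cong) (simp add: pochpair_def mult_ac)
    then show ?thesis by (simp only: J_cmult[OF isCont_base_weight_pochpair])
  qed
  finally have 1: "qpoch_inf (Q * sg) q * base_integral 0 0 = pochpair 1 * qbeta (ka * u) (ka / u)" .
  have "qbeta (ka * u) (ka / u) * (pochpair 1 * pochpair (1 / ta)) = qbeta 0 0 * qpoch_inf (Q * sg) q"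
  proof -
    \<comment> \<open>The choice of \<kappa> makes the numerator of the beta integral equal to
      \<open>(q\<sigma>; q)_\<infinity>\<close>, the factor that the functional equation yields at
      \<open>X = 1\<close>; the two cancel.\<close>
    have "ka * u * (ka / u) / ta = Q * sg"
      using ka_sq by (simp add: power2_eq_square field_simps)
    then show ?thesis
      using qbeta_eq_qbeta_0_0[of "ka * u" "ka / u"] G by (auto simp: pochpair_def mult_ac)
  qed
  then have "pochpair (1 / ta) * (qpoch_inf (Q * sg) q * base_integral 0 0) = qbeta 0 0 * qpoch_inf (Q * sg) q"
    unfolding 1 by (simp add: mult_ac)
  then have "base_integral 0 0 = base_const"
    using G qpoch_sg_nz unfolding base_const_def qbeta_0_0[OF qpoch_ta_nz, symmetric] by (simp add: field_simps)
  with to0[of X] show ?thesis by simp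
qed

text \<open>Lowering \<open>r = -m\<close> in \<open>X\<close> produces the factor
  \<open>Z - q^m\<close>, which extends \<open>(Z q^(1-m); q)_m\<close> to
  \<open>(Z q^(-m); q)_(m+1)\<close>. The difference of the integrals at \<open>X\<close> and
  \<open>X/q\<close> is thus a multiple of the integral for \<open>m + 1\<close>, and the same
  difference of \<open>(q\<sigma>X; q)_\<infinity>\<close> is elementary.\<close>

lemma base_integral_eq:
  assumes G: "pochpair 1 \<noteq> 0" "pochpair (1 / ta) \<noteq> 0" and X: "X \<noteq> 0"
  shows "base_integral m X = kernel_const 0 m 0 * qpoch_inf (Q * sg * X) q"
  using X
proof (induction m arbitrary: X)
  case 0
  then show ?case using base_integral_0[OF G] by (simp add: kernel_const_def)
next
  case (Suc m)
  define h where "h = (\<lambda>Z. base_weight Z / pochpair Z * qpoch (Z * Q powi (1 - int m)) q m)"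
  have h: "isCont h 0"
    unfolding h_def by (intro continuous_intros isCont_base_weight_pochpair)
  define p where "p = Q powi (int m)"
  have p: "p \<noteq> 0" "Q powi (- int m) = 1 / p" by (simp_all add: p_def power_int_minus_divide)
  have e: "h Z * psi (- int m) X Z - h Z * psi (- int m) (X / Q) Z
     = (- (X * p * (ka\<^sup>2 / Q))) * (base_weight Z / pochpair Z * qpoch (Z * Q powi (1 - int (Suc m))) q (Suc m) * psi (- int (Suc m)) X Z)" for Z
  proof -
    have "psi (- int m) X Z - psi (- int m) (X / Q) Z = X * ((Z - p) * (ka\<^sup>2 / Q) * psi (- int (Suc m)) X Z)"
    proof -
      have "- int m - 1 = - int (Suc m)" by simp
      then show ?thesis
        using psi_lower[of "- int m" Z X] by (simp only: psi_commute[of _ Z] p_def minus_minus)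
    qed
    moreover have "qpoch (Z * Q powi (1 - int (Suc m))) q (Suc m) = (1 - Z / p) * qpoch (Z * Q powi (1 - int m)) q m"
      using Q_powi_Suc[of "- int m"] p by (simp add: qpoch_Suc_left mult.assoc)
    moreover have "Z - p = - p * (1 - Z / p)" using p by (simp add: field_simps)
    ultimately show ?thesis
      unfolding right_diff_distrib[symmetric] h_def by (simp add: mult_ac)
  qed
  have "base_integral m X - base_integral m (X / Q) = J 0 (\<lambda>Z. h Z * psi (- int m) X Z - h Z * psi (- int m) (X / Q) Z)"
  proof -
    have "base_integral m X' = J 0 (\<lambda>Z. h Z * psi (- int m) X' Z)" for X'
      by (simp only: base_integral_def h_def)
    moreover have "J 0 (\<lambda>Z. h Z * psi (- int m) X Z - h Z * psi (- int m) (X / Q) Z)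
        = J 0 (\<lambda>Z. h Z * psi (- int m) X Z) - J 0 (\<lambda>Z. h Z * psi (- int m) (X / Q) Z)"
      by (intro J_diff continuous_intros h isCont_psi)
    ultimately show ?thesis by simp
  qed
  also have "\<dots> = (- (X * p * (ka\<^sup>2 / Q))) * base_integral (Suc m) X"
    unfolding e base_integral_def by (intro J_cmult continuous_intros isCont_base_weight_pochpair isCont_psi)
  finally have "(- (X * p * (sg * ta))) * base_integral (Suc m) X = base_integral m X - base_integral m (X / Q)"
    by (simp add: ka_sq)
  also have "\<dots> = kernel_const 0 m 0 * (qpoch_inf (Q * sg * X) q - qpoch_inf (sg * X) q)"
    using Suc.IH[of X] Suc.IH[of "X / Q"] Suc.prems by (simp add: right_diff_distrib)
  also have "\<dots> = kernel_const 0 m 0 * (sg * X) * qpoch_inf (Q * sg * X) q"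
  proof -
    have "qpoch_inf (sg * X) q = (1 - sg * X) * qpoch_inf (Q * sg * X) q"
      using qpoch_inf_unfold[of "sg * X"] by (simp add: mult_ac)
    then show ?thesis by (simp only:) (simp add: algebra_simps)
  qed
  finally have "X * sg * (p * (ta * base_integral (Suc m) X)) = X * sg * (- (kernel_const 0 m 0 * qpoch_inf (Q * sg * X) q))"
    by algebra
  then have "p * (ta * base_integral (Suc m) X) = - (kernel_const 0 m 0 * qpoch_inf (Q * sg * X) q)"
    using Suc.prems by (simp only: mult_cancel_left) simp
  then have "base_integral (Suc m) X = - (1 / ta) * (1 / p) * kernel_const 0 m 0 * qpoch_inf (Q * sg * X) q"
    using p by (simp add: field_simps)
  then show ?case
    unfolding kernel_const_Suc_m by (simp add: p)
qed


text \<open>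
  The integral divided by \<open>1 - q\<close> and with the normalised kernel; \<open>kernel_value\<close> below is its claimed value.
\<close>

definition kernel_integral :: "nat \<Rightarrow> nat \<Rightarrow> nat \<Rightarrow> int \<Rightarrow> complex \<Rightarrow> complex" where
  "kernel_integral k m n r X = J k (\<lambda>Z. weighted_hahn k Z * (laguerre_sum ta m n (Z * Q powi (1 + r)) * psi r X Z))"

lemma isCont_kernel_integral_integrand:
  "isCont (\<lambda>Z. weighted_hahn k Z * (laguerre_sum ta m n (Z * c) * psi r X Z)) 0"
  by (intro continuous_intros isCont_weighted_hahn isCont_laguerre_sum isCont_psi)

text \<open>In the q-Leibniz rule the difference of \<open>psi\<close> meets
  \<open>laguerre_sum\<close> at \<open>Z/q\<close>, whose argument is the one belonging to
  \<open>r - 1\<close>; the difference of \<open>laguerre_sum\<close> keeps \<open>r\<close> and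
  lowers \<open>m\<close>. If \<open>r = (k+1) - m + n\<close>, both integrals on the right again
  have \<open>r\<close> tied to their own parameters. For \<open>m = 0\<close> the coefficient of
  the second one is 0, so the truncated \<open>m - 1\<close> is harmless.\<close>

lemma kernel_integral_Suc_k:
  assumes "\<And>Z. Z \<in> lattice (Suc k) \<Longrightarrow> pochpair Z \<noteq> 0"
  shows "ka * kernel_integral (Suc k) m n r X = (X - Q powi (- r)) * (ka\<^sup>2 / Q) * kernel_integral k m n (r - 1) X
    + Q powi (1 + r) * (1 - Q powi (- int m)) * kernel_integral k (m - 1) n r X"
proof -
  define g where "g = (\<lambda>Z. laguerre_sum ta m n (Z * Q powi (1 + r)) * psi r X Z)"
  define c where "c = (X - Q powi (- r)) * (ka\<^sup>2 / Q)"
  define d where "d = Q powi (1 + r) * (1 - Q powi (- int m))"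
  define a where "a = (\<lambda>Z. laguerre_sum ta m n (Z * Q powi (1 + (r - 1))) * psi (r - 1) X Z)"
  define b where "b = (\<lambda>Z. laguerre_sum ta (m - 1) n (Z * Q powi (1 + r)) * psi r X Z)"
  have cont: "isCont g 0" "isCont a 0" "isCont b 0"
    unfolding g_def a_def b_def by (intro continuous_intros isCont_laguerre_sum isCont_psi)+
  have "J (Suc k) (\<lambda>Z. ka * weighted_hahn (Suc k) Z * g Z) = J k (\<lambda>Z. weighted_hahn k Z * (c * a Z + d * b Z))"
  proof (rule J_by_parts)
    show "isCont (\<lambda>Z. c * a Z + d * b Z) 0" "isCont (\<lambda>Z. ka * weighted_hahn (Suc k) Z) 0"
      by (intro continuous_intros isCont_weighted_hahn cont)+
    show "ka * weighted_hahn (Suc k) Z * Z = weighted_hahn k Z - weighted_hahn k (Z * Q)" if "Z \<in> lattice (Suc k)" for Z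
      using weighted_hahn_diff[OF assms[OF that], of k] by simp
    show "(c * a Z + d * b Z) * Z = g Z - g (Z / Q)" for Z
    proof -
      define y where "y = Z * Q powi (1 + r)"
      have y: "Z / Q * Q powi (1 + r) = y / Q" "Z * Q powi r = y / Q"
        using Q_powi_Suc[of r] by (simp_all add: y_def add.commute)
      have "g Z - g (Z / Q) = laguerre_sum ta m n (y / Q) * (psi r X Z - psi r X (Z / Q))
          + (laguerre_sum ta m n y - laguerre_sum ta m n (y / Q)) * psi r X Z"
        by (simp add: g_def y y_def[symmetric] algebra_simps)
      also have "\<dots> = laguerre_sum ta m n (y / Q) * (Z * (c * psi (r - 1) X Z)) + Z * d * laguerre_sum ta (m - 1) n y * psi r X Z"
        unfolding psi_lower laguerre_sum_diff by (simp add: c_def d_def y_def mult_ac)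
      also have "\<dots> = (c * a Z + d * b Z) * Z"
        by (simp add: a_def b_def y y_def[symmetric] algebra_simps)
      finally show ?thesis ..
    qed
    have "Q powi (- int (Suc k)) * Q ^ Suc k = 1"
      using Q_power_powi_minus[of "Suc k"] by (simp only: mult.commute)
    moreover have "qpoch_inf 1 q = 0" using qpoch_inf_unfold[of 1] by simp
    ultimately show "weighted_hahn k (Q powi (- int (Suc k))) = 0" "weighted_hahn k (Q powi (- int (Suc k)) / ta) = 0"
      by (simp_all add: weighted_hahn_def del: power_Suc of_nat_Suc)
  qed (use cont isCont_weighted_hahn in auto)
  also have "\<dots> = J k (\<lambda>Z. c * (weighted_hahn k Z * a Z) + d * (weighted_hahn k Z * b Z))"
    by (simp add: algebra_simps)
  also have "\<dots> = c * J k (\<lambda>Z. weighted_hahn k Z * a Z) + d * J k (\<lambda>Z. weighted_hahn k Z * b Z)"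
    by (intro J_lincomb continuous_intros isCont_weighted_hahn cont)
  finally show ?thesis
    using J_cmult[of "\<lambda>Z. weighted_hahn (Suc k) Z * g Z" "Suc k" ka] cont
    by (simp add: kernel_integral_def g_def a_def b_def c_def d_def mult.assoc isCont_weighted_hahn isCont_mult)
qed

text \<open>\<open>psi_raise\<close> at level \<open>r - 1\<close>, integrated against the rest. At
  that level \<open>laguerre_sum\<close> has the argument \<open>Z q^(1+r) / q\<close>, to which
  \<open>laguerre_sum_contiguous\<close> applies; this is where \<open>n\<close> rises.\<close>

lemma kernel_integral_raise:
  "(1 - X * Q powi r) * kernel_integral k m n (r - 1) X
     - (1 - ka * X * u) * (1 - ka * X / u) * kernel_integral k m n (r - 1) (X * Q)
   = - (Q powi r) * X * Q powi (- int m) *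
     (kernel_integral k m (Suc n) r X - (1 - Q powi (- int m)) * (Q ^ (2 * Suc n) / ta) * kernel_integral k (m - 1) n r X)"
proof -
  define A where "A = (1 - ka * X * u) * (1 - ka * X / u)"
  define B where "B = 1 - X * Q powi r"
  define \<gamma> where "\<gamma> = (1 - Q powi (- int m)) * (Q ^ (2 * Suc n) / ta)"
  define C where "C = - (Q powi r) * X * Q powi (- int m)"
  have yq: "Z * Q powi (1 + (r - 1)) = (Z * Q powi (1 + r)) / Q" for Z
    using Q_powi_Suc[of r] by (simp add: add.commute)
  have e: "B * (weighted_hahn k Z * (laguerre_sum ta m n (Z * Q powi (1 + (r - 1))) * psi (r - 1) X Z))
      + - A * (weighted_hahn k Z * (laguerre_sum ta m n (Z * Q powi (1 + (r - 1))) * psi (r - 1) (X * Q) Z))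
    = C * (weighted_hahn k Z * (laguerre_sum ta m (Suc n) (Z * Q powi (1 + r)) * psi r X Z))
     + (- C * \<gamma>) * (weighted_hahn k Z * (laguerre_sum ta (m - 1) n (Z * Q powi (1 + r)) * psi r X Z))" for Z
  proof -
    define P L where "P = weighted_hahn k Z" and "L = laguerre_sum ta m n (Z * Q powi (1 + (r - 1)))"
    have "Q ^ m * L = laguerre_sum ta m (Suc n) (Z * Q powi (1 + r)) - \<gamma> * laguerre_sum ta (m - 1) n (Z * Q powi (1 + r))"
      unfolding L_def yq \<gamma>_def by (rule laguerre_sum_contiguous) simp
    then have "L = Q powi (- int m) * (laguerre_sum ta m (Suc n) (Z * Q powi (1 + r)) - \<gamma> * laguerre_sum ta (m - 1) n (Z * Q powi (1 + r)))"
      using Q_power_powi_minus[of m] by (simp add: power_int_minus field_simps)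
    moreover have "B * psi (r - 1) X Z - A * psi (r - 1) (X * Q) Z = - (Q powi r) * X * psi r X Z"
      using psi_raise[of X "r - 1" Z] by (simp add: A_def B_def)
    moreover have "B * (P * (L * p1)) + - A * (P * (L * p2))
        = - w * c * q' * (P * (x * p3)) + (- (- w * c * q') * \<gamma>) * (P * (y * p3))"
      if "L = q' * (x - \<gamma> * y)" "B * p1 - A * p2 = - w * c * p3" for p1 p2 p3 w x y c q' :: complex
      using that by algebra
    ultimately show ?thesis
      unfolding P_def[symmetric] L_def[symmetric] C_def by blast
  qed
  have c: "isCont (\<lambda>Z. weighted_hahn k Z * (laguerre_sum ta m' n' (Z * c) * psi r' X' Z)) 0" for m' n' c r' X'
    by (rule isCont_kernel_integral_integrand)
  have "B * kernel_integral k m n (r - 1) X + - A * kernel_integral k m n (r - 1) (X * Q)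
      = C * kernel_integral k m (Suc n) r X + (- C * \<gamma>) * kernel_integral k (m - 1) n r X"
    unfolding kernel_integral_def J_lincomb[OF c c, symmetric] e ..
  then show ?thesis
    unfolding A_def[symmetric] B_def[symmetric] \<gamma>_def[symmetric] C_def[symmetric] by (simp add: algebra_simps)
qed

section \<open>The same recurrences for the claimed value\<close>

definition kernel_value :: "nat \<Rightarrow> nat \<Rightarrow> nat \<Rightarrow> complex \<Rightarrow> complex" where
  "kernel_value k m n X = kernel_const k m n * (qpoch_inf (sg * X * Q ^ Suc n) q * px n X * laguerre_quot sg k m (X * Q ^ Suc n))"

text \<open>Only \<open>laguerre_quot\<close> and the constant depend on \<open>k\<close>. With
  \<open>w = X q^(n+1)\<close> the factor \<open>X - q^(-r)\<close> is
  \<open>-q^(-r) (1 - w q^(k-m))\<close>, so the recurrence is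
  \<open>laguerre_quot_contiguous\<close>; \<open>c1\<close> and \<open>c2\<close> compare the
  constants.\<close>

lemma kernel_value_Suc_k:
  fixes k m n :: nat and X :: complex
  defines "r \<equiv> int (Suc k) - int m + int n"
  shows "ka * kernel_value (Suc k) m n X = (X - Q powi (- r)) * (ka\<^sup>2 / Q) * kernel_value k m n X
    + Q powi (1 + r) * (1 - Q powi (- int m)) * kernel_value k (m - 1) n X"
proof -
  define \<pi> where "\<pi> = qpoch_inf (sg * X * Q ^ Suc n) q * px n X"
  define w where "w = X * Q ^ Suc n"
  have "Q ^ Suc n * Q powi (int k - int m) = Q powi r"
    unfolding r_def by (simp add: algebra_simps flip: power_int_of_nat Q_powi_add)
  then have wr: "w * Q powi (int k - int m) = X * Q powi r"
    by (simp only: w_def mult.assoc)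
  have Xr: "X - Q powi (- r) = - (Q powi (- r)) * (1 - X * Q powi r)"
    by (simp add: power_int_minus field_simps)
  have H: "laguerre_quot sg (Suc k) m w = Q ^ m * (1 - X * Q powi r) * laguerre_quot sg k m w
      + (1 - Q powi (- int m)) * (Q ^ (2 * Suc k) / sg) * laguerre_quot sg k (m - 1) w"
    using laguerre_quot_contiguous[of sg m w k] unfolding wr by simp
  have c1: "ka * kernel_const (Suc k) m n * Q ^ m = - (Q powi (- r)) * (ka\<^sup>2 / Q) * kernel_const k m n"
  proof -
    have "Q powi (- int k - int n - 2) * Q ^ m = Q powi (- r) / Q"
      unfolding r_def by (simp add: algebra_simps flip: power_int_of_nat Q_powi_add Q_powi_pred)
    then have "Q powi (- int k - int n - 2) * Q ^ m * (- (ka\<^sup>2) * kernel_const k m n) = Q powi (- r) / Q * (- (ka\<^sup>2) * kernel_const k m n)"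
      by simp
    then show ?thesis unfolding kernel_const_Suc_k by (simp add: power2_eq_square mult_ac)
  qed
  have c2: "ka * kernel_const (Suc k) m n * ((1 - Q powi (- int m)) * (Q ^ (2 * Suc k) / sg))
      = Q powi (1 + r) * (1 - Q powi (- int m)) * kernel_const k (m - 1) n"
  proof (cases m)
    case (Suc M)
    have "Q powi (- int k - int n - 2) * Q powi (2 * int n - int M) * Q ^ (2 * Suc k) * Q = Q powi (1 + r)"
    proof -
      have "(- int k - int n - 2) + (2 * int n - int M) + int (2 * Suc k) + 1 = 1 + r"
        by (simp add: r_def Suc)
      then show ?thesis
        using Q_powi_add[of "(- int k - int n - 2) + (2 * int n - int M) + int (2 * Suc k)" 1]
        by (simp only: Q_powi_add power_int_of_nat power_int_1_right)
    qed
    moreover have "ka * (- ka * x * (- (1 / ta) * y * C)) * (p * (z / sg)) = (x * y * z * Q) * p * C"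
      for x y z p C
      using ka_sq by (simp add: power2_eq_square field_simps)
    ultimately show ?thesis
      unfolding kernel_const_Suc_k by (simp only: Suc kernel_const_Suc_m diff_Suc_1)
  qed simp
  have "ka * kernel_value (Suc k) m n X = (ka * kernel_const (Suc k) m n * Q ^ m) * (1 - X * Q powi r) * (\<pi> * laguerre_quot sg k m w)
     + (ka * kernel_const (Suc k) m n * ((1 - Q powi (- int m)) * (Q ^ (2 * Suc k) / sg))) * (\<pi> * laguerre_quot sg k (m - 1) w)"
    unfolding kernel_value_def \<pi>_def[symmetric] w_def[symmetric] H by (simp add: distrib_left mult_ac)
  also have "\<dots> = (X - Q powi (- r)) * (ka\<^sup>2 / Q) * kernel_value k m n X
    + Q powi (1 + r) * (1 - Q powi (- int m)) * kernel_value k (m - 1) n X"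
    unfolding c1 c2 Xr kernel_value_def \<pi>_def[symmetric] w_def[symmetric] by (simp add: mult_ac)
  finally show ?thesis .
qed

text \<open>A product rule in \<open>X\<close>: \<open>px_raise\<close> handles the continuous dual
  q-Hahn factor and \<open>laguerre_quot_diff\<close> the Laguerre factor.\<close>

lemma kernel_value_raise:
  fixes k m n :: nat and X :: complex
  defines "r \<equiv> int k - int m + int (Suc n)"
  shows "(1 - X * Q powi r) * kernel_value k m n X - (1 - ka * X * u) * (1 - ka * X / u) * kernel_value k m n (X * Q)
   = - (Q powi r) * X * Q powi (- int m) *
     (kernel_value k m (Suc n) X - (1 - Q powi (- int m)) * (Q ^ (2 * Suc n) / ta) * kernel_value k (m - 1) n X)"
proof -
  define A where "A = (1 - ka * X * u) * (1 - ka * X / u)"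
  define \<pi> where "\<pi> = qpoch_inf (sg * X * Q ^ Suc (Suc n)) q"
  define w where "w = X * Q ^ Suc n"
  define g where "g = 1 - Q powi (- int m)"
  have w1: "qpoch_inf (sg * X * Q ^ Suc n) q = (1 - sg * w) * \<pi>"
    using qpoch_inf_unfold[of "sg * X * Q ^ Suc n"] by (simp add: w_def \<pi>_def mult_ac)
  have w2: "qpoch_inf (sg * (X * Q) * Q ^ Suc n) q = \<pi>" "X * Q * Q ^ Suc n = w * Q"
     "X * Q ^ Suc (Suc n) = w * Q"
    by (simp_all add: w_def \<pi>_def mult_ac)
  have "Q ^ Suc n * Q powi (int k - int m) = Q powi r"
    unfolding r_def by (simp add: algebra_simps flip: power_int_of_nat Q_powi_add)
  then have wr: "w * Q powi (int k - int m) = X * Q powi r"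
    by (simp only: w_def mult.assoc)
  have wr1: "w * Q powi (int k - int m + 1) = X * Q powi r * Q"
    unfolding Q_powi_Suc by (simp only: mult.assoc[symmetric] wr)
  have D: "(1 - X * Q powi r) * laguerre_quot sg k m w - (1 - w) * laguerre_quot sg k m (w * Q) = - (X * Q powi r * Q) * g * laguerre_quot sg k (m - 1) w"
    using laguerre_quot_diff[of w k m sg] unfolding wr g_def by (simp add: wr1)
  have P: "(1 - w) * (1 - sg * w) * px n X - A * px n (X * Q) = ka * X * px (Suc n) X"
    using px_raise[of X n] by (simp add: A_def w_def mult.assoc)
  have c1: "ka * kernel_const k m n = - (Q powi r) * Q powi (- int m) * kernel_const k m (Suc n)"
  proof -
    have "r + - int m + (2 * int m - int k - int n - 1) = 0" by (simp add: r_def)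
    then have "Q powi r * Q powi (- int m) * Q powi (2 * int m - int k - int n - 1) = 1"
      by (simp only: Q_powi_add[symmetric] power_int_0_right)
    then have "ka * kernel_const k m n * (Q powi r * Q powi (- int m) * Q powi (2 * int m - int k - int n - 1)) = ka * kernel_const k m n"
      by simp
    then show ?thesis unfolding kernel_const_Suc_n by (simp add: mult_ac)
  qed
  have c2: "- (kernel_const k m n * Q * g) = Q powi (- int m) * (g * (Q ^ (2 * Suc n) / ta)) * kernel_const k (m - 1) n"
  proof (cases m)
    case (Suc M)
    have "Q powi (- int m) * Q ^ (2 * Suc n) = Q powi (2 * int n - int M) * Q"
    proof -
      have "- int m + int (2 * Suc n) = (2 * int n - int M) + 1" by (simp add: Suc)
      from arg_cong[OF this, of "\<lambda>i. Q powi i"] show ?thesis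
        by (simp only: Q_powi_add power_int_of_nat power_int_1_right)
    qed
    then have "g * (1 / ta) * kernel_const k M n * (Q powi (- int m) * Q ^ (2 * Suc n))
        = g * (1 / ta) * kernel_const k M n * (Q powi (2 * int n - int M) * Q)" by simp
    then show ?thesis
      by (auto simp: Suc kernel_const_Suc_m mult_ac simp del: of_nat_Suc)
  qed (simp add: g_def)
  define H H1 Hq where "H = laguerre_quot sg k m w" and "H1 = laguerre_quot sg k (m - 1) w" and "Hq = laguerre_quot sg k m (w * Q)"
  define C C1 C' where "C = kernel_const k m n" and "C1 = kernel_const k m (Suc n)" and "C' = kernel_const k (m - 1) n"
  define p p1 pq where "p = px n X" and "p1 = px (Suc n) X" and "pq = px n (X * Q)"
  define R M where "R = Q powi r" and "M = Q powi (- int m)"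
  define G where "G = g * (Q ^ (2 * Suc n) / ta)"
  have D': "(1 - X * R) * H - (1 - w) * Hq = - (X * R * Q) * g * H1"
    using D by (simp only: H_def Hq_def H1_def R_def)
  have P': "(1 - w) * (1 - sg * w) * p - A * pq = ka * X * p1"
    using P by (simp only: p_def p1_def pq_def)
  have c1': "ka * C = - R * M * C1" using c1 by (simp only: C_def C1_def R_def M_def)
  have c2': "- (C * Q * g) = M * G * C'" using c2 by (simp only: C_def C'_def G_def M_def)
  \<comment> \<open>The term \<open>(1 - w)(1 - \<sigma>w) p Hq\<close> is added and subtracted,
    which separates the two difference relations.\<close>
  have "(1 - X * R) * (C * ((1 - sg * w) * \<pi> * p * H)) - A * (C * (\<pi> * pq * Hq))
     = C * \<pi> * ((1 - sg * w) * p * ((1 - X * R) * H - (1 - w) * Hq) + ((1 - w) * (1 - sg * w) * p - A * pq) * Hq)"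
    by algebra
  also have "\<dots> = C * \<pi> * ((1 - sg * w) * p * (- (X * R * Q) * g * H1) + ka * X * p1 * Hq)"
    unfolding D' P' ..
  also have "\<dots> = \<pi> * X * ((1 - sg * w) * p * R * H1 * (- (C * Q * g)) + (ka * C) * p1 * Hq)"
    by algebra
  also have "\<dots> = - R * X * M * (C1 * (\<pi> * p1 * Hq) - G * (C' * ((1 - sg * w) * \<pi> * p * H1)))"
    unfolding c1' c2' by algebra
  finally show ?thesis
    unfolding kernel_value_def w1 w2 w_def[symmetric] g_def[symmetric] A_def[symmetric] \<pi>_def[symmetric]
    by (simp only: H_def Hq_def H1_def C_def C1_def C'_def p_def p1_def pq_def R_def M_def G_def mult.assoc)
qed

section \<open>Induction on \<open>k\<close>, and on \<open>n\<close> when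
  \<open>k = 0\<close>\<close>

lemma px_0: "px 0 X = 1" and pz_0: "pz 0 Z = 1"
  by (simp_all add: px_def pz_def cdq_hahn_alt)

theorem kernel_integral_eq_kernel_value:
  assumes "\<And>Z. Z \<in> lattice k \<Longrightarrow> pochpair Z \<noteq> 0" and "X \<noteq> 0"
  shows "kernel_integral k m n (int k - int m + int n) X = kernel_value k m n X"
  using assms
proof (induction k arbitrary: m n X)
  case (Suc k)
  have nz: "pochpair Z \<noteq> 0" if "Z \<in> lattice k" for Z
    using Suc.prems(1) that lattice_mono by blast
  define r where "r = int (Suc k) - int m + int n"
  have 1: "kernel_integral k m n (r - 1) X = kernel_value k m n X"
    using Suc.IH[OF nz Suc.prems(2), of m n] by (simp add: r_def algebra_simps)
  \<comment> \<open>The prefactor is kept so that the equation holds trivially at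
    \<open>m = 0\<close>, where \<open>m - 1\<close> is truncated and \<open>r\<close> does not
    match.\<close>
  have 2: "(1 - Q powi (- int m)) * kernel_integral k (m - 1) n r X = (1 - Q powi (- int m)) * kernel_value k (m - 1) n X"
    using Suc.IH[OF nz Suc.prems(2), of "m - 1" n] by (cases m) (simp_all add: r_def algebra_simps)
  have "ka * kernel_integral (Suc k) m n r X = ka * kernel_value (Suc k) m n X"
    using kernel_integral_Suc_k[OF Suc.prems(1), where m = m and n = n and r = r and X = X] kernel_value_Suc_k[where k = k and m = m and n = n and X = X] 1 2
    unfolding r_def[symmetric] by (simp add: mult.assoc)
  then show ?case by (simp add: r_def)
next
  case 0
  then show ?case
  proof (induction n arbitrary: m X)
    case 0
    have "Q powi (- int 0) * Q ^ 0 \<in> lattice 0" "Q powi (- int 0) / ta * Q ^ 0 \<in> lattice 0"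
      unfolding lattice_def by blast+
    then have G: "pochpair 1 \<noteq> 0" "pochpair (1 / ta) \<noteq> 0"
      using 0(1) by simp_all
    have L: "laguerre_sum ta m 0 y = laguerre_coef m 0 * qpoch y q m" for y
      unfolding laguerre_sum_def by (subst sum.atMost_shift) (simp add: laguerre_fac_eq_0)
    have H: "laguerre_quot sg 0 m w = laguerre_coef m 0" for w
      unfolding laguerre_quot_def by (subst sum.atMost_shift) (simp add: laguerre_fac_eq_0)
    have "kernel_integral 0 m 0 (- int m) X = J 0 (\<lambda>Z. laguerre_coef m 0 * (base_weight Z / pochpair Z * qpoch (Z * Q powi (1 - int m)) q m * psi (- int m) X Z))"
      unfolding kernel_integral_def L weighted_hahn_def pz_0 base_weight_def by (simp add: mult_ac)
    also have "\<dots> = laguerre_coef m 0 * base_integral m X"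
      unfolding base_integral_def by (intro J_cmult continuous_intros isCont_base_weight_pochpair isCont_psi)
    also have "\<dots> = kernel_value 0 m 0 X"
      using base_integral_eq[OF G 0(2), of m] by (simp add: kernel_value_def H px_0 mult_ac)
    finally show ?case by simp
  next
    case (Suc n)
    define r where "r = int 0 - int m + int (Suc n)"
    have XQ: "X * Q \<noteq> 0" using Suc.prems by simp
    have 1: "kernel_integral 0 m n (r - 1) Y = kernel_value 0 m n Y" if "Y \<noteq> 0" for Y
      using Suc.IH[OF Suc.prems(1) that, of m] by (simp add: r_def)
    have 2: "(1 - Q powi (- int m)) * kernel_integral 0 (m - 1) n r X = (1 - Q powi (- int m)) * kernel_value 0 (m - 1) n X"
      using Suc.IH[OF Suc.prems(1) Suc.prems(2), of "m - 1"] by (cases m) (simp_all add: r_def algebra_simps)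
    define c where "c = - (Q powi r) * X * Q powi (- int m)"
    have c: "c \<noteq> 0" using Suc.prems by (simp add: c_def)
    define s where "s = (1 - Q powi (- int m)) * (Q ^ (2 * Suc n) / ta) * kernel_integral 0 (m - 1) n r X"
    have s': "(1 - Q powi (- int m)) * (Q ^ (2 * Suc n) / ta) * kernel_value 0 (m - 1) n X = s"
      unfolding s_def using arg_cong[OF 2, of "\<lambda>v. Q ^ (2 * Suc n) / ta * v"] by (simp only: mult_ac)
    have "c * (kernel_integral 0 m (Suc n) r X - s) = c * (kernel_value 0 m (Suc n) X - s)"
      using kernel_integral_raise[where X = X and r = r and k = 0 and m = m and n = n]
        kernel_value_raise[where k = 0 and m = m and n = n and X = X]
      unfolding r_def[symmetric] 1[OF Suc.prems(2)] 1[OF XQ] c_def[symmetric] s_def[symmetric] s' by auto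
    with c show ?case by (simp add: r_def)
  qed
qed

end

context qbase
begin

subsection \<open>Return to the original variables\<close>

lemma qpoch_pair_eq_laguerre_fac:
  assumes ab: "{a, b} = {Q powi (int n - int m), Q powi (int n - int m) / \<tau>}" and "h \<le> m"
  shows "qpochs [a * Q ^ (m - h + 1), b * Q ^ (m - h + 1)] q h = laguerre_fac \<tau> n h"
proof -
  have *: "qpoch (Q powi (int n - int m) * c * Q ^ (m - h + 1)) q h = (\<Prod>j<h. 1 - Q powi (int n - int j) * c)" for c
  proof -
    have "qpoch (Q powi (int n - int m) * c * Q ^ (m - h + 1)) q h
        = (\<Prod>j<h. 1 - Q powi (int n - int (h - Suc j)) * c)"
      unfolding qpoch_def
    proof (intro prod.cong refl)
      fix j assume "j \<in> {..<h}"
      then have "int n - int (h - Suc j) = (int n - int m) + int (m - h + 1) + int j"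
        using assms(2) by (simp add: of_nat_diff)
      then have "Q powi (int n - int (h - Suc j)) = Q powi (int n - int m) * Q ^ (m - h + 1) * Q ^ j"
        by (simp only: Q_powi_add power_int_of_nat)
      then show "1 - Q powi (int n - int m) * c * Q ^ (m - h + 1) * Q ^ j = 1 - Q powi (int n - int (h - Suc j)) * c"
        by (simp only: mult_ac)
    qed
    also have "\<dots> = (\<Prod>j<h. 1 - Q powi (int n - int j) * c)"
      by (rule prod.nat_diff_reindex)
    finally show ?thesis .
  qed
  have "qpoch (Q powi (int n - int m) * Q ^ (m - h + 1)) q h * qpoch (Q powi (int n - int m) / \<tau> * Q ^ (m - h + 1)) q h = laguerre_fac \<tau> n h"
    using *[of 1] *[of "1 / \<tau>"] by (simp add: laguerre_fac_def prod.distrib)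
  then show ?thesis
    using ab unfolding doubleton_eq_iff qpochs_def by (auto simp: mult.commute)
qed

lemma big_q_laguerre_cleared_eq_laguerre_sum:
  assumes ab: "{a, b} = {Q powi (int n - int m), Q powi (int n - int m) / \<tau>}"
  shows "big_q_laguerre_cleared m y a b q = laguerre_sum \<tau> m n y"
  unfolding big_q_laguerre_cleared_def laguerre_sum_def
proof (rule sum.reindex_bij_witness[where i = "\<lambda>h. m - h" and j = "\<lambda>i. m - i"])
  fix i assume "i \<in> {..m}"
  then have i: "m - (m - i) = i" "m - i \<le> m" by auto
  show "laguerre_coef m (m - i) * laguerre_fac \<tau> n (m - i) * qpoch y q (m - (m - i)) =
    qpochs [of_real (q powi (- int m)), y] q i / qpoch Q q i * Q ^ i * qpochs [a * Q ^ (i + 1), b * Q ^ (i + 1)] q (m - i)"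
    unfolding laguerre_coef_def i qpoch_pair_eq_laguerre_fac[OF ab i(2), symmetric] by (simp add: qpochs_def)
qed auto

text \<open>With \<open>h = m - i\<close>, the denominator of the \<open>i\<close>-th term is the
  tail of \<open>(X q^(n+1); q)_\<infinity>\<close> from index \<open>k - h\<close> on, and the
  quotient is the finite symbol in \<open>laguerre_quot\<close>. If \<open>h > k\<close>, the
  coefficient is 0, so the term vanishes whatever the denominator is.\<close>

lemma big_q_laguerre_cleared_quot_eq_laguerre_quot:
  assumes ab: "{a, b} = {Q powi (int k - int m), Q powi (int k - int m) / \<sigma>}"
    and X: "qpoch_inf (X * Q ^ Suc n) q \<noteq> 0"
  shows "qpoch_inf (X * Q ^ Suc n) q *
    big_q_laguerre_cleared_quot m (X * Q powi (1 + (int k - int m + int n))) a b q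
    = laguerre_quot \<sigma> k m (X * Q ^ Suc n)"
  unfolding big_q_laguerre_cleared_quot_def laguerre_quot_def sum_distrib_left
proof (rule sum.reindex_bij_witness[where i = "\<lambda>h. m - h" and j = "\<lambda>i. m - i"])
  fix i assume "i \<in> {..m}"
  then have i: "m - (m - i) = i" "m - i \<le> m" by auto
  define W where "W = X * Q ^ Suc n"
  have V: "qpochs [a * Q ^ (i + 1), b * Q ^ (i + 1)] q (m - i) = laguerre_fac \<sigma> k (m - i)"
    using qpoch_pair_eq_laguerre_fac[OF ab i(2)] by (simp only: i)
  show "laguerre_coef m (m - i) * laguerre_fac \<sigma> k (m - i) * qpoch (X * Q ^ Suc n) q (k - (m - i)) =
    qpoch_inf (X * Q ^ Suc n) q * (qpoch (of_real (q powi (- int m))) q i / qpoch Q q i * Q ^ i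
      * qpochs [a * Q ^ (i + 1), b * Q ^ (i + 1)] q (m - i)
      / qpoch_inf (X * Q powi (1 + (int k - int m + int n)) * Q ^ i) q)"
  proof (cases "m - i \<le> k")
    case True
    have "1 + (int k - int m + int n) + int i = int (Suc n) + int (k - (m - i))"
      using True \<open>i \<in> {..m}\<close> by (simp add: of_nat_diff)
    then have "Q powi (1 + (int k - int m + int n)) * Q ^ i = Q ^ Suc n * Q ^ (k - (m - i))"
      by (metis Q_powi_add power_int_of_nat)
    then have e: "X * Q powi (1 + (int k - int m + int n)) * Q ^ i = W * Q ^ (k - (m - i))"
      by (simp only: W_def mult.assoc)
    have "qpoch_inf W q = qpoch W q (k - (m - i)) * qpoch_inf (W * Q ^ (k - (m - i))) q"
      by (rule qpoch_inf_split) simp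
    with X show ?thesis
      unfolding V e laguerre_coef_def i W_def[symmetric] by (auto simp: field_simps)
  next
    case False
    then show ?thesis unfolding V by (simp add: laguerre_fac_eq_0)
  qed
qed auto

lemma qpoch_inf_neg_nz:
  assumes "a < 0"
  shows "qpoch_inf (of_real a) q \<noteq> 0"
proof (rule qpoch_inf_nz)
  fix j
  have "a * q ^ j < 0" using assms q_pos by (simp add: mult_neg_pos)
  then have "a * q ^ j \<noteq> 1" by linarith
  then show "of_real a * Q ^ j \<noteq> 1" by (metis of_real_1 of_real_eq_iff of_real_mult of_real_power)
qed

end

context qmeix
begin

lemma epol_eq_qpoch:
  assumes "Z \<noteq> 0"
  shows "epol r l Z = qpoch (Q powi (- r) / Z) q l * Z ^ l"
proof (induction l)
  case (Suc l)
  have "Q powi (int l - r) = Q powi (- r) * Q ^ l"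
    by (metis Q_powi_add add.commute diff_conv_add_uminus power_int_of_nat mult.commute)
  then show ?case
    unfolding epol_Suc Suc qpoch_Suc using assms by (simp add: field_simps)
qed simp

lemma ccoef_eq: "ccoef l = (- 1) ^ l * Q ^ (l * (l - 1) div 2) * (ka\<^sup>2) ^ l / qpoch Q q l"
proof (induction l)
  case (Suc l)
  have "Suc l * (Suc l - 1) div 2 = l * (l - 1) div 2 + l"
  proof -
    have "Suc l * (Suc l - 1) = l * (l - 1) + l * 2" by (cases l) simp_all
    then show ?thesis by simp
  qed
  then show ?case
    unfolding ccoef_Suc Suc qpoch_Suc by (simp add: power_add)
qed (simp add: ccoef_def)

lemma pochpair_split: "pochpair x = qpoch (ka * x * u) q l * qpoch (ka * x / u) q l * pochpair (x * Q ^ l)"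
  unfolding pochpair_def
  by (subst qpoch_inf_split[of q "ka * x * u" l], simp, subst qpoch_inf_split[of q "ka * x / u" l], simp)
    (simp add: mult_ac)

text \<open>\<open>pochpair (Q powi (- r))\<close> cancels the denominators
  \<open>(a, b; q)_l\<close> of the series and leaves the shifted \<open>pochpair\<close>. The
  argument collapses to \<kappa> squared times \<open>X Z\<close>, whose powers are those absorbed
  in \<open>ccoef\<close> and the two \<open>epol\<close>.\<close>

lemma psi_eq_q_meixner:
  assumes "X \<noteq> 0" "Z \<noteq> 0" and G: "pochpair (Q powi (- r)) \<noteq> 0"
  shows "psi r X Z = pochpair (Q powi (- r)) *
    q_meixner (- (X * Q powi r)) (- (Z * Q powi r)) (ka * Q powi (- r) * u) (ka * Q powi (- r) / u) q"
proof -
  define a b where "a = ka * Q powi (- r) * u" and "b = ka * Q powi (- r) / u"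
  have args: "- 1 / - (Z * Q powi r) = Q powi (- r) / Z" "- 1 / - (X * Q powi r) = Q powi (- r) / X"
    by (simp_all add: power_int_minus field_simps)
  have z: "a * b * - (X * Q powi r) * - (Z * Q powi r) = ka\<^sup>2 * X * Z"
  proof -
    have "Q powi (- r) * Q powi r = 1" by (simp add: power_int_minus)
    then show ?thesis by (simp add: a_def b_def power2_eq_square power_int_minus field_simps)
  qed
  define t where "t = (\<lambda>l. qpochs [Q powi (- r) / Z, Q powi (- r) / X] q l / qpochs [Q, a, b] q l
      * ((- 1) ^ l * Q ^ (l * (l - 1) div 2)) powi (1 + int (length [a, b]) - int (length [Q powi (- r) / Z, Q powi (- r) / X]))
      * (ka\<^sup>2 * X * Z) ^ l)"
  have t: "pterm r X Z l = pochpair (Q powi (- r)) * t l" for l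
  proof -
    have "Q powi (int l - r) = Q powi (- r) * Q ^ l"
      by (metis Q_powi_add add.commute diff_conv_add_uminus power_int_of_nat mult.commute)
    then have Gl: "pochpair (Q powi (- r)) = qpoch a q l * qpoch b q l * pochpair (Q powi (int l - r))"
      using pochpair_split[of "Q powi (- r)" l] by (simp add: a_def b_def)
    with G have "qpoch a q l \<noteq> 0" "qpoch b q l \<noteq> 0" by auto
    then show ?thesis
      unfolding t_def pterm_def ccoef_eq epol_eq_qpoch[OF assms(1)] epol_eq_qpoch[OF assms(2)] Gl
      by (simp add: qpochs_def power_mult_distrib)
  qed
  have "summable (\<lambda>l. pochpair (Q powi (- r)) * t l)"
    unfolding t[symmetric] by (rule summable_pterm)
  then have "summable t" using G by (simp add: summable_cmult_iff)
  then have "psi r X Z = pochpair (Q powi (- r)) * suminf t"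
    unfolding psi_def t by (rule suminf_mult)
  also have "suminf t = q_meixner (- (X * Q powi r)) (- (Z * Q powi r)) a b q"
    unfolding q_meixner_def qhyp_def args z t_def ..
  finally show ?thesis by (simp add: a_def b_def)
qed

end

text \<open>Treats both choices of a sign parameter \<open>e\<close> at once. With
  \<open>Z = -we/p\<close> and ratio \<open>-p/e^2\<close>, the weight factors are those at
  \<open>Z c\<close> and at the ratio times \<open>Z c\<close>: in the given order for
  \<open>e = p\<close>, interchanged for \<open>e = -1\<close>.\<close>

lemma sign_lattice_product:
  fixes h :: "real \<Rightarrow> 'a::comm_monoid_mult" and e p w c :: real
  assumes "e \<in> {-1, p}" "0 < p"
  shows "h (- w * c) * h (w * c / p) = h (- (w * e / p) * c) * h (- p / e\<^sup>2 * - (w * e / p) * c)"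
proof (cases "e = - 1")
  case True
  then show ?thesis using assms by (simp add: mult.commute)
next
  case False
  then have "e = p" using assms by simp
  then show ?thesis using assms by (simp add: power2_eq_square)
qed

lemma sign_pair:
  fixes e p c :: real
  assumes "e \<in> {-1, p}" "0 < p"
  shows "{- e * c, e * c / p} = {c, c / (- p / e\<^sup>2)}"
proof (cases "e = - 1")
  case False
  then have "e = p" using assms by simp
  then show ?thesis using assms by (auto simp: power2_eq_square)
qed (use assms in \<open>auto simp: field_simps\<close>)

lemma of_real_doubleton: "{a, b} = {c, d} \<Longrightarrow> {of_real a, of_real b :: complex} = {of_real c, of_real d}"
  by (auto simp: doubleton_eq_iff)

text \<open>The half-integral powers combine into \<open>(k + n)\<close>-th powers of square roots,
  that is, of \<open>-\<kappa>\<close>, because the exponents of \<open>q\<close> add up to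
  \<open>(k + n)/2\<close> plus an integer. What remains is the scalar part of
  \<open>kernel_const\<close>, with \<open>lam^2/t = -1/\<tau>\<close>.\<close>

lemma power_constant_eq:
  fixes q s t lam \<xi> :: real and k m n :: nat and r :: int
  assumes q: "0 < q" and st: "0 < s" "0 < t" and nz: "lam \<noteq> 0" "\<xi> \<noteq> 0"
    and r: "r = int k - int m + int n"
  shows "q powr ((real m + 1 / 2) * (real n - real k)) * q powr (- 1 / 2 * (r * (r + 1)))
      * (lam * \<xi>) powi (- r) * (lam / \<xi>) ^ m * (s * t) powr (r / 2) * (s / t) powr (m / 2)
    = (sqrt (q * s * t) / (lam * \<xi>)) ^ (k + n) * (lam\<^sup>2 / t) ^ m
      * q powi (int m * (int n - int k) - int k - r * (r + 1) div 2)"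
proof -
  define L where "L = lam * \<xi>"
  have L: "L \<noteq> 0" using nz by (simp add: L_def)
  define E where "E = int m * (int n - int k) - int k - r * (r + 1) div 2"
  have "even (r * (r + 1))" by simp
  then have "real_of_int (r * (r + 1) div 2) = real_of_int (r * (r + 1)) / 2"
    by (simp add: real_of_int_div)
  then have E: "real_of_int E = real m * (real n - real k) - real k - real_of_int (r * (r + 1)) / 2"
    by (simp add: E_def)
  have sq: "a powr (real N / 2) = sqrt a ^ N" if "a > 0" for a N
    using that by (simp add: powr_half_sqrt[symmetric] powr_powr flip: powr_realpow)
  have rr: "real_of_int r = real k - real m + real n" by (simp add: r)
  have "(real m + 1 / 2) * (real n - real k) + - 1 / 2 * (r * (r + 1)) = real (k + n) / 2 + real_of_int E"
    unfolding E by (simp add: field_simps)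
  then have "q powr ((real m + 1 / 2) * (real n - real k)) * q powr (- 1 / 2 * (r * (r + 1)))
      = q powr ((real (k + n)) / 2 + real_of_int E)"
    by (simp only: powr_add[symmetric])
  also have "\<dots> = sqrt q ^ (k + n) * q powi E"
    unfolding powr_add using q by (simp add: sq powr_real_of_int' del: of_nat_add)
  finally have 1: "q powr ((real m + 1 / 2) * (real n - real k)) * q powr (- 1 / 2 * (r * (r + 1))) = sqrt q ^ (k + n) * q powi E" .
  have 2: "L powi (- r) * (lam / \<xi>) ^ m = (lam\<^sup>2) ^ m / L ^ (k + n)"
  proof -
    have "- r = int m - int (k + n)" by (simp add: r)
    then have "L powi (- r) = L ^ m / L ^ (k + n)"
      using L power_int_diff[of L "int m" "int (k + n)"] by (simp only: power_int_of_nat) simp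
    moreover have "L * (lam / \<xi>) = lam\<^sup>2" using nz by (simp add: L_def power2_eq_square)
    ultimately show ?thesis by (simp add: power_mult_distrib[symmetric])
  qed
  have 3: "(s * t) powr (r / 2) * (s / t) powr (m / 2) = sqrt (s * t) ^ (k + n) * (1 / t) ^ m"
  proof -
    have "real_of_int r / 2 = real (k + n) / 2 - real m / 2"
      by (simp add: rr field_simps)
    then have "(s * t) powr (r / 2) = sqrt (s * t) ^ (k + n) / (s * t) powr (m / 2)"
      using st by (simp only: powr_diff sq mult_pos_pos)
    moreover have "(s / t) powr (m / 2) / (s * t) powr (m / 2) = (1 / t) ^ m"
    proof -
      have "(s / t) powr (m / 2) / (s * t) powr (m / 2) = (s / t / (s * t)) powr (m / 2)"
        by (rule powr_divide[symmetric])
      also have "s / t / (s * t) = (1 / t)\<^sup>2"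
        using st by (simp add: power2_eq_square)
      also have "(1 / t)\<^sup>2 powr (m / 2) = sqrt ((1 / t)\<^sup>2) ^ m"
        using st by (intro sq) simp
      also have "sqrt ((1 / t)\<^sup>2) = 1 / t"
        using st by (intro real_sqrt_unique) auto
      finally show ?thesis .
    qed
    ultimately show ?thesis by (metis times_divide_eq_left times_divide_eq_right)
  qed
  have "q powr ((real m + 1 / 2) * (real n - real k)) * q powr (- 1 / 2 * (r * (r + 1)))
      * L powi (- r) * (lam / \<xi>) ^ m * (s * t) powr (r / 2) * (s / t) powr (m / 2)
    = (q powr ((real m + 1 / 2) * (real n - real k)) * q powr (- 1 / 2 * (r * (r + 1))))
      * (L powi (- r) * (lam / \<xi>) ^ m) * ((s * t) powr (r / 2) * (s / t) powr (m / 2))"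
    by (simp only: mult.assoc)
  also have "\<dots> = (sqrt q ^ (k + n) * q powi E) * ((lam\<^sup>2) ^ m / L ^ (k + n)) * (sqrt (s * t) ^ (k + n) * (1 / t) ^ m)"
    unfolding 1 2 3 ..
  also have "\<dots> = (sqrt (q * s * t) / L) ^ (k + n) * (lam\<^sup>2 / t) ^ m * q powi E"
    by (simp add: real_sqrt_mult power_mult_distrib power_divide mult_ac)
  finally show ?thesis unfolding L_def E_def .
qed


context qbase
begin

lemma jackson_integral0_eq_qsum:
  assumes l: "l \<noteq> 0" and f: "\<And>j. f (\<alpha> * q ^ j) = F (of_real (\<alpha> / l) * Q ^ j)" and F: "isCont F 0"
  shows "jackson_integral0 q f \<alpha> = of_real ((1 - q) * l) * qsum F (of_real (\<alpha> / l))"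
    and "summable (\<lambda>j. norm (f (\<alpha> * q ^ j) * of_real (\<alpha> * q ^ j)))"
proof -
  have e: "f (\<alpha> * q ^ j) * of_real (\<alpha> * q ^ j)
      = of_real l * (F (of_real (\<alpha> / l) * Q ^ j) * (of_real (\<alpha> / l) * Q ^ j))" for j
    using l by (simp add: f)
  show "jackson_integral0 q f \<alpha> = of_real ((1 - q) * l) * qsum F (of_real (\<alpha> / l))"
    unfolding jackson_integral0_def e qsum_def suminf_mult[OF qsum_summable[OF F]] by simp
  show "summable (\<lambda>j. norm (f (\<alpha> * q ^ j) * of_real (\<alpha> * q ^ j)))"
    unfolding e norm_mult[of "of_real l"] by (intro summable_mult qsum_abs_summable F)
qed

lemma qpochs_pair_nz:
  assumes ab: "{a, b} = {Q powi (int n - int m + 1), Q powi (int n - int m + 1) / of_real \<tau>}"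
    and "m \<le> n" "\<tau> < 0"
  shows "qpochs [a, b] q m \<noteq> 0"
proof -
  have e: "Q powi (int n - int m + 1) = Q ^ Suc (n - m)"
    using assms(2) by (metis Suc_eq_plus1 of_nat_1 of_nat_add of_nat_diff power_int_of_nat)
  have 1: "qpoch (Q ^ Suc (n - m)) q m \<noteq> 0"
    using qpoch_inf_shift_nz[OF qpoch_inf_Q_nz, of "n - m"] qpoch_inf_split[of q "Q ^ Suc (n - m)" m] by auto
  have "q ^ Suc (n - m) / \<tau> < 0"
    using q_pos assms(3) by (simp add: divide_pos_neg)
  then have 2: "qpoch (Q ^ Suc (n - m) / of_real \<tau>) q m \<noteq> 0"
    using qpoch_inf_neg_nz[of "q ^ Suc (n - m) / \<tau>"] qpoch_inf_split[of q "Q ^ Suc (n - m) / of_real \<tau>" m]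
    by auto
  show ?thesis
    using ab 1 2 unfolding e doubleton_eq_iff qpochs_def by auto
qed

end

theorem theorem6p6:
  fixes q s t x \<xi> lam :: real and u :: complex and k m n :: nat and r :: int
  assumes q: "0 < q" "q < 1"
    and u: "norm u = 1"
    and st: "0 < s" "0 < t"
    and x: "x \<in> uminus ` qlattice q n \<union> (\<lambda>y. s * y) ` qlattice q n"
    and \<xi>: "\<xi> \<in> {-1, s}"
    and lam: "lam \<in> {-1, t}"
    and r: "r = int k - int m + int n"
    \<comment> \<open>The denominators on the two sides do not vanish (automatic for \<open>u \<noteq> 1, -1\<close>).\<close>
    and weight_nz: "\<And>z. z \<in> uminus ` qlattice q k \<union> (\<lambda>y. t * y) ` qlattice q k \<Longrightarrow>
      qpochs_inf [of_real (z / \<xi> * sqrt (q * s / t)) * u, of_real (z / \<xi> * sqrt (q * s / t)) / u] q \<noteq> 0"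
    and meixner_nz:
      "qpochs_inf [- u * of_real (q powi (- r) / (lam * \<xi>) * sqrt (q * s * t)),
                   - of_real (q powi (- r) / (lam * \<xi>) * sqrt (q * s * t)) / u] q \<noteq> 0"
  shows "
    let pk = (\<lambda>z::real. cdq_hahn k u (of_real (- \<xi> * sqrt (q * t / s))) (of_real (\<xi> * sqrt (q / (s * t))))
                (of_real (z / \<xi> * sqrt (q * s / t))) q);
        phi = (\<lambda>z::real. q_meixner (of_real (\<xi> * x * q powi r / s)) (of_real (lam * z * q powi r / t))
                (- u * of_real (q powi (- r) / (lam * \<xi>) * sqrt (q * s * t)))
                (- of_real (q powi (- r) / (lam * \<xi>) * sqrt (q * s * t)) / u) q);
        w = (\<lambda>z::real. qpochs_inf [of_real (- z * q ^ (1 + k)), of_real (z * q ^ (1 + k) / t)] q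
              / qpochs_inf [of_real (z / \<xi> * sqrt (q * s / t)) * u,
                            of_real (z / \<xi> * sqrt (q * s / t)) / u] q);
        const = complex_of_real ((1 - q) * \<bar>lam\<bar> * q powr ((real m + 1 / 2) * (real n - real k))
              * q powr (- 1 / 2 * (r * (r + 1))) * (lam * \<xi>) powi (- r) * (lam / \<xi>) ^ m
              * (s * t) powr (r / 2) * (s / t) powr (m / 2));
        numer = qpochs_inf [of_real q, of_real (x * q ^ (1 + n) / s), of_real (- x * q ^ (1 + n))] q
              * qtheta (of_real (- (lam\<^sup>2) * q / t)) q;
        pn = cdq_hahn n u (of_real (- lam * sqrt (q * s / t))) (of_real (lam * sqrt (q / (s * t))))
                (of_real (x / lam * sqrt (q * t / s))) q
    in
    \<comment> \<open>The identity as displayed. The two conditions say exactly that both polynomials \<open>L\<^sub>m\<close> exist.\<close>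
    (m \<le> n \<longrightarrow> m \<le> k \<longrightarrow>
      (let f = (\<lambda>z::real. pk z
            * big_q_laguerre m (of_real (- lam * z * q powi (1 + r) / t))
                (of_real (- lam * q powi (int n - int m))) (of_real (lam * q powi (int n - int m) / t)) q
            * phi z * w z)
       in jackson_integrable q f (- (q powi (- int k))) (t * q powi (- int k)) \<and>
          jackson_integral q f (- (q powi (- int k))) (t * q powi (- int k)) =
            const
            * (numer
               / qpochs_inf [of_real (- \<xi> * x * q powi (1 + r) / s),
                   of_real (lam / \<xi> * sqrt (q * s / t)) * u, of_real (lam / \<xi> * sqrt (q * s / t)) / u,
                   - u * of_real (q powi (- r) / (lam * \<xi>) * sqrt (q * s * t)),
                   - of_real (q powi (- r) / (lam * \<xi>) * sqrt (q * s * t)) / u] q)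
            * (qpochs [of_real (- \<xi> * q powi (int k - int m + 1)), of_real (\<xi> * q powi (int k - int m + 1) / s)] q m
               / qpochs [of_real (- lam * q powi (int n - int m + 1)), of_real (lam * q powi (int n - int m + 1) / t)] q m)
            * pn
            * big_q_laguerre m (of_real (- \<xi> * x * q powi (1 + r) / s))
                (of_real (- \<xi> * q powi (int k - int m))) (of_real (\<xi> * q powi (int k - int m) / s)) q))
    \<and>
    \<comment> \<open>All \<open>k, m, n\<close>: the identity multiplied by \<open>(-lamq\<^sup>n\<^sup>-\<^sup>m\<^sup>+\<^sup>1, lamq\<^sup>n\<^sup>-\<^sup>m\<^sup>+\<^sup>1/t; q)\<^sub>m\<close>, each \<open>L\<^sub>m\<close> being
       merged with the shifted factorials next to it.\<close>
    (let f = (\<lambda>z::real. pk z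
            * big_q_laguerre_cleared m (of_real (- lam * z * q powi (1 + r) / t))
                (of_real (- lam * q powi (int n - int m))) (of_real (lam * q powi (int n - int m) / t)) q
            * phi z * w z)
     in jackson_integrable q f (- (q powi (- int k))) (t * q powi (- int k)) \<and>
        jackson_integral q f (- (q powi (- int k))) (t * q powi (- int k)) =
            const
            * (numer
               / qpochs_inf [of_real (lam / \<xi> * sqrt (q * s / t)) * u, of_real (lam / \<xi> * sqrt (q * s / t)) / u,
                   - u * of_real (q powi (- r) / (lam * \<xi>) * sqrt (q * s * t)),
                   - of_real (q powi (- r) / (lam * \<xi>) * sqrt (q * s * t)) / u] q)
            * pn
            * big_q_laguerre_cleared_quot m (of_real (- \<xi> * x * q powi (1 + r) / s))
                (of_real (- \<xi> * q powi (int k - int m))) (of_real (\<xi> * q powi (int k - int m) / s)) q)"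
proof -
  define lam' where "lam' = - t / lam"
  define sgr where "sgr = - s / \<xi>\<^sup>2"
  define tar where "tar = - t / lam\<^sup>2"
  define S where "S = sqrt (q * s * t)"
  define kar where "kar = - (S / (lam * \<xi>))"
  define Xr where "Xr = - (x * \<xi> / s)"
  define zz where "zz = (\<lambda>z. - (z * lam / t))"
  have nz: "lam \<noteq> 0" "\<xi> \<noteq> 0" "s \<noteq> 0" "t \<noteq> 0" "u \<noteq> 0" "lam' \<noteq> 0" "sgr \<noteq> 0" "tar \<noteq> 0"
    using lam \<xi> st u by (auto simp: lam'_def sgr_def tar_def)
  \<comment> \<open>Negativity makes \<open>(q/\<tau>; q)_\<infinity>\<close>,
    \<open>(q\<tau>; q)_\<infinity>\<close> and \<open>(q\<sigma>; q)_\<infinity>\<close> products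
    of positive factors, which discharges the nonvanishing assumptions of the locale.\<close>
  have neg: "sgr < 0" "tar < 0" using st nz by (simp_all add: sgr_def tar_def)
  have S: "S > 0" "S\<^sup>2 = q * s * t" using q st by (simp_all add: S_def)
  have roots: "sqrt (q * s / t) = S / t" "sqrt (q * t / s) = S / s" "sqrt (q / (s * t)) = S / (s * t)"
    using q st S by (auto intro!: real_sqrt_unique simp: power_divide power2_eq_square[of s] power2_eq_square[of t] power_mult_distrib)
  have kar2: "kar\<^sup>2 = q * sgr * tar"
    using nz S by (simp add: kar_def sgr_def tar_def power_divide power_mult_distrib)
  have abz: "{- \<xi> * sqrt (q * t / s) * kar, \<xi> * sqrt (q / (s * t)) * kar} = {q, q * tar}"
  proof -
    have "- \<xi> * sqrt (q * t / s) * kar = q * t / lam" "\<xi> * sqrt (q / (s * t)) * kar = - (q / lam)"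
      unfolding roots kar_def using nz S by (simp_all add: power2_eq_square field_simps)
    then show ?thesis using lam nz by (auto simp: tar_def power2_eq_square)
  qed
  have abx: "{- lam * sqrt (q * s / t) * kar, lam * sqrt (q / (s * t)) * kar} = {q, q * sgr}"
  proof -
    have "- lam * sqrt (q * s / t) * kar = q * s / \<xi>" "lam * sqrt (q / (s * t)) * kar = - (q / \<xi>)"
      unfolding roots kar_def using nz S by (simp_all add: power2_eq_square field_simps)
    then show ?thesis using \<xi> nz by (auto simp: sgr_def power2_eq_square)
  qed
  note neg_nz = qbase.qpoch_inf_neg_nz[OF qbase.intro[OF q]]
  interpret M: qmeix_full q "of_real kar" "of_real sgr" "of_real tar" u
    "of_real (- \<xi> * sqrt (q * t / s))" "of_real (\<xi> * sqrt (q / (s * t)))"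
    "of_real (- lam * sqrt (q * s / t))" "of_real (lam * sqrt (q / (s * t)))"
  proof unfold_locales
    show "(complex_of_real kar)\<^sup>2 = of_real q * of_real sgr * of_real tar"
      using arg_cong[OF kar2, of complex_of_real] by simp
    have "q / tar < 0" "q * tar < 0" "q * sgr < 0"
      using q neg by (simp_all add: divide_pos_neg mult_pos_neg)
    from this[THEN neg_nz]
    show "qpoch_inf (of_real q / of_real tar) q \<noteq> 0" "qpoch_inf (of_real q * of_real tar) q \<noteq> 0"
      "qpoch_inf (of_real q * of_real sgr) q \<noteq> 0" by simp_all
    show "{complex_of_real (- \<xi> * sqrt (q * t / s)) * of_real kar, of_real (\<xi> * sqrt (q / (s * t))) * of_real kar}
      = {of_real q, of_real q * of_real tar}"
      using of_real_doubleton[OF abz] by simp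
    show "{complex_of_real (- lam * sqrt (q * s / t)) * of_real kar, of_real (lam * sqrt (q / (s * t))) * of_real kar}
      = {of_real q, of_real q * of_real sgr}"
      using of_real_doubleton[OF abx] by simp
  qed (use nz q in auto)
  define pk where "pk = (\<lambda>z::real. cdq_hahn k u (of_real (- \<xi> * sqrt (q * t / s))) (of_real (\<xi> * sqrt (q / (s * t))))
                (of_real (z / \<xi> * sqrt (q * s / t))) q)"
  define phi where "phi = (\<lambda>z::real. q_meixner (of_real (\<xi> * x * q powi r / s)) (of_real (lam * z * q powi r / t))
                (- u * of_real (q powi (- r) / (lam * \<xi>) * sqrt (q * s * t)))
                (- of_real (q powi (- r) / (lam * \<xi>) * sqrt (q * s * t)) / u) q)"
  define w where "w = (\<lambda>z::real. qpochs_inf [of_real (- z * q ^ (1 + k)), of_real (z * q ^ (1 + k) / t)] q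
              / qpochs_inf [of_real (z / \<xi> * sqrt (q * s / t)) * u,
                            of_real (z / \<xi> * sqrt (q * s / t)) / u] q)"
  define const where "const = complex_of_real ((1 - q) * \<bar>lam\<bar> * q powr ((real m + 1 / 2) * (real n - real k))
              * q powr (- 1 / 2 * (r * (r + 1))) * (lam * \<xi>) powi (- r) * (lam / \<xi>) ^ m
              * (s * t) powr (r / 2) * (s / t) powr (m / 2))"
  define numer where "numer = qpochs_inf [of_real q, of_real (x * q ^ (1 + n) / s), of_real (- x * q ^ (1 + n))] q
              * qtheta (of_real (- (lam\<^sup>2) * q / t)) q"
  define pn where "pn = cdq_hahn n u (of_real (- lam * sqrt (q * s / t))) (of_real (lam * sqrt (q / (s * t))))
                (of_real (x / lam * sqrt (q * t / s))) q"
  define La where "La = complex_of_real (- lam * q powi (int n - int m))"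
  define Lb where "Lb = complex_of_real (lam * q powi (int n - int m) / t)"
  define Lz where "Lz = (\<lambda>z::real. complex_of_real (- lam * z * q powi (1 + r) / t))"
  define Ra where "Ra = complex_of_real (- \<xi> * q powi (int k - int m))"
  define Rb where "Rb = complex_of_real (\<xi> * q powi (int k - int m) / s)"
  define Ry where "Ry = complex_of_real (- \<xi> * x * q powi (1 + r) / s)"
  define D1 where "D1 = qpochs_inf [of_real (lam / \<xi> * sqrt (q * s / t)) * u, of_real (lam / \<xi> * sqrt (q * s / t)) / u,
                   - u * of_real (q powi (- r) / (lam * \<xi>) * sqrt (q * s * t)),
                   - of_real (q powi (- r) / (lam * \<xi>) * sqrt (q * s * t)) / u] q"
  define f where "f = (\<lambda>z. pk z * big_q_laguerre_cleared m (Lz z) La Lb q * phi z * w z)"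

  define G where "G = M.pochpair (M.Q powi (- r))"
  have mx: "- u * of_real (q powi (- r) / (lam * \<xi>) * sqrt (q * s * t)) = of_real kar * M.Q powi (- r) * u"
    "- of_real (q powi (- r) / (lam * \<xi>) * sqrt (q * s * t)) / u = of_real kar * M.Q powi (- r) / u"
    by (simp_all add: kar_def S_def)
  have G: "G \<noteq> 0"
    using meixner_nz unfolding mx by (simp add: G_def M.pochpair_def qpochs_inf_def)
  have cz: "of_real (z / \<xi> * sqrt (q * s / t)) = of_real kar * complex_of_real (zz z)" for z
  proof -
    have "z / \<xi> * sqrt (q * s / t) = kar * zz z"
      unfolding roots kar_def zz_def using nz by (simp add: field_simps)
    then show ?thesis by simp
  qed
  have cx: "of_real (x / lam * sqrt (q * t / s)) = of_real kar * complex_of_real Xr"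
  proof -
    have "x / lam * sqrt (q * t / s) = kar * Xr"
      unfolding roots kar_def Xr_def using nz by (simp add: field_simps)
    then show ?thesis by simp
  qed
  \<comment> \<open>The lattice of \<open>x\<close> becomes the alternative that \<open>Xr\<close>
    is negative or \<open>Xr = q^(j-n)\<close>. In either case \<open>Xr q^(n+1)\<close> is not a
    power \<open>q^(-i)\<close> with \<open>i\<close> a natural number.\<close>
  have x0: "Xr \<noteq> 0" and X1: "qpoch_inf (of_real Xr * M.Q ^ Suc n) q \<noteq> 0"
  proof -
    have *: "Xr < 0 \<or> (\<exists>j. Xr = q powi (int j - int n))"
      using x \<xi> st q unfolding Xr_def qlattice_def
      by (auto simp: zero_less_power_int divide_less_0_iff mult_less_0_iff)
    then show "Xr \<noteq> 0" using q by auto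
    from * show "qpoch_inf (of_real Xr * M.Q ^ Suc n) q \<noteq> 0"
    proof
      assume "Xr < 0"
      then have "Xr * q ^ Suc n < 0" using q by (simp add: mult_neg_pos)
      from M.qpoch_inf_neg_nz[OF this] show ?thesis by simp
    next
      assume "\<exists>j. Xr = q powi (int j - int n)"
      then obtain j where "Xr = q powi (int j - int n)" ..
      then have "complex_of_real Xr * M.Q ^ Suc n = M.Q * M.Q ^ j"
        using q by (simp add: power_int_diff)
      then show ?thesis
        using M.qpoch_inf_shift_nz[OF M.qpoch_inf_Q_nz, of j] by (simp only: not_False_eq_True)
    qed
  qed
  have pk_eq: "pk z = M.pz k (of_real (zz z))" for z
    unfolding pk_def M.pz_def cz ..
  have pn_eq: "pn = M.px n (of_real Xr)"
    unfolding pn_def M.px_def cx ..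
  have phi_eq: "phi z = M.psi r (of_real Xr) (of_real (zz z)) / G" if "z \<noteq> 0" for z
  proof -
    have "complex_of_real (\<xi> * x * q powi r / s) = - (of_real Xr * M.Q powi r)"
      "complex_of_real (lam * z * q powi r / t) = - (of_real (zz z) * M.Q powi r)"
      by (simp_all add: Xr_def zz_def)
    moreover have "complex_of_real (zz z) \<noteq> 0" "complex_of_real Xr \<noteq> 0"
      using that nz x0 by (simp_all add: zz_def)
    ultimately show ?thesis
      using M.psi_eq_q_meixner[of "of_real Xr" "of_real (zz z)" r] G unfolding phi_def mx G_def[symmetric] by simp
  qed
  have w_eq: "w z = qpoch_inf (of_real (zz z) * M.Q ^ Suc k) q * qpoch_inf (of_real tar * of_real (zz z) * M.Q ^ Suc k) q
      / M.pochpair (of_real (zz z))" for z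
    unfolding w_def cz using sign_lattice_product[OF lam st(2), of "\<lambda>c. qpoch_inf (of_real c) q" z "q ^ Suc k"]
    by (simp add: qpochs_inf_def M.pochpair_def zz_def tar_def)
  have Lab: "{La, Lb} = {M.Q powi (int n - int m), M.Q powi (int n - int m) / of_real tar}"
    using of_real_doubleton[OF sign_pair[OF lam st(2), of "q powi (int n - int m)"]]
    by (simp add: La_def Lb_def tar_def)
  have Rab: "{Ra, Rb} = {M.Q powi (int k - int m), M.Q powi (int k - int m) / of_real sgr}"
    using of_real_doubleton[OF sign_pair[OF \<xi> st(1), of "q powi (int k - int m)"]]
    by (simp add: Ra_def Rb_def sgr_def)
  have Lz: "Lz z = of_real (zz z) * M.Q powi (1 + r)" for z
    by (simp add: Lz_def zz_def)
  have Ry: "Ry = of_real Xr * M.Q powi (1 + r)"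
    by (simp add: Ry_def Xr_def)
  \<comment> \<open>The integrand in the variable \<open>Z\<close>, with the Meixner function
    replaced by \<open>psi / G\<close>. In this form it is continuous at 0, whereas
    \<open>q_meixner\<close> has a parameter \<open>-1/x\<close> that degenerates there.\<close>
  define F where "F = (\<lambda>Z. 1 / G * (M.weighted_hahn k Z * (M.laguerre_sum (of_real tar) m n (Z * M.Q powi (1 + r)) * M.psi r (of_real Xr) Z)))"
  have F: "isCont F 0"
    unfolding F_def by (intro continuous_intros M.isCont_kernel_integral_integrand)
  have f_eq: "f z = F (of_real (zz z))" if "z \<noteq> 0" for z
    unfolding f_def F_def pk_eq phi_eq[OF that] w_eq Lz M.big_q_laguerre_cleared_eq_laguerre_sum[OF Lab] M.weighted_hahn_def by simp
  have zz_lam': "zz z = z / lam'" for z by (simp add: zz_def lam'_def)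
  have ends: "of_real (t * q powi (- int k) / lam') = (if lam = - 1 then M.Q powi (- int k) else M.Q powi (- int k) / of_real tar)"
    "of_real (- (q powi (- int k)) / lam') = (if lam = - 1 then M.Q powi (- int k) / of_real tar else M.Q powi (- int k))"
    using lam nz by (auto simp: lam'_def tar_def power2_eq_square)
  have fF: "f (\<alpha> * q ^ j) = F (of_real (\<alpha> / lam') * M.Q ^ j)" if "\<alpha> \<noteq> 0" for \<alpha> j
    using f_eq[of "\<alpha> * q ^ j"] that q by (simp add: zz_lam')
  have \<alpha>0: "t * q powi (- int k) \<noteq> 0" "- (q powi (- int k)) \<noteq> 0" using nz q by auto
  note J0 = M.jackson_integral0_eq_qsum[OF nz(6) fF[OF \<alpha>0(1)] F] M.jackson_integral0_eq_qsum[OF nz(6) fF[OF \<alpha>0(2)] F]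
  have f_int: "jackson_integrable q f (- (q powi (- int k))) (t * q powi (- int k))"
    unfolding jackson_integrable_def using J0(2,4) by blast
  \<comment> \<open>For \<open>lam = t\<close> the end points correspond in order to those of
    \<open>J\<close> and \<open>lam'\<close> is negative; for \<open>lam = -1\<close> they are
    interchanged and \<open>lam'\<close> is positive. Both cases give the same negative
    prefactor.\<close>
  have "jackson_integral q f (- (q powi (- int k))) (t * q powi (- int k))
      = of_real (- ((1 - q) * (t / \<bar>lam\<bar>))) * M.J k F"
    unfolding jackson_integral_def J0(1,3) ends M.J_def
    using lam st by (auto simp: lam'_def algebra_simps)
  also have "M.J k F = 1 / G * M.kernel_integral k m n r (of_real Xr)"
    unfolding F_def M.kernel_integral_def by (intro M.J_cmult M.isCont_kernel_integral_integrand)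
  also have "M.kernel_integral k m n r (of_real Xr) = M.kernel_value k m n (of_real Xr)"
    unfolding r
  proof (rule M.kernel_integral_eq_kernel_value)
    fix Z assume "Z \<in> M.lattice k"
    then obtain j where "Z = of_real (q powi (- int k) * q ^ j) \<or> Z = of_real (q powi (- int k) / tar * q ^ j)"
      unfolding M.lattice_def by auto
    moreover have qq: "q powi (- int k) * q ^ j = q powi (int j - int k)"
      using q by (simp add: power_int_diff power_int_minus field_simps)
    \<comment> \<open>Since \<open>lam * lam' = -t\<close>, the numbers \<open>lam\<close> and
      \<open>lam'\<close> are \<open>-1\<close> and \<open>t\<close> in some order, and
      \<open>zz lam = 1/\<tau>\<close>. So the two branches of the \<open>Z\<close>-lattice are the
      two branches of the \<open>z\<close>-lattice.\<close>
    ultimately obtain z where z: "z = lam' * q powi (int j - int k) \<or> z = lam * q powi (int j - int k)"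
      and Z: "Z = of_real (zz z)"
    proof (elim disjE)
      assume a: "Z = of_real (q powi (- int k) * q ^ j)"
      show thesis
        by (rule that[of "lam' * q powi (int j - int k)"]) (use a qq nz in \<open>simp_all add: zz_lam'\<close>)
    next
      assume a: "Z = of_real (q powi (- int k) / tar * q ^ j)"
      have "zz (lam * q powi (int j - int k)) = q powi (- int k) / tar * q ^ j"
        using nz unfolding qq[symmetric] by (simp add: zz_def tar_def power2_eq_square field_simps)
      then show thesis
        by (intro that[of "lam * q powi (int j - int k)"]) (use a in simp_all)
    qed
    have "z \<in> uminus ` qlattice q k \<union> (\<lambda>y. t * y) ` qlattice q k"
    proof -
      have "q powi (int j - int k) \<in> qlattice q k" by (auto simp: qlattice_def)
      moreover have "z = - (q powi (int j - int k)) \<or> z = t * q powi (int j - int k)"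
        using z lam nz by (auto simp: lam'_def)
      ultimately show ?thesis by blast
    qed
    from weight_nz[OF this] show "M.pochpair Z \<noteq> 0"
      unfolding cz Z by (simp add: qpochs_inf_def M.pochpair_def)
  qed (use x0 in simp)
  also have "of_real (- ((1 - q) * (t / \<bar>lam\<bar>))) * (1 / G * M.kernel_value k m n (of_real Xr))
      = const * (numer / D1) * pn * big_q_laguerre_cleared_quot m Ry Ra Rb q"
  proof -
    define c0 where "c0 = (- kar) ^ (k + n) * (- 1 / tar) ^ m * q powi (int m * (int n - int k) - int k - r * (r + 1) div 2)"
    have const: "const = of_real ((1 - q) * \<bar>lam\<bar> * c0)"
    proof -
      have "- kar = S / (lam * \<xi>)" "- 1 / tar = lam\<^sup>2 / t"
        by (simp_all add: kar_def tar_def)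
      then show ?thesis
        unfolding const_def c0_def S_def using power_constant_eq[OF q(1) st nz(1,2) r]
        by (simp only: mult.assoc)
    qed
    have kernel_const: "M.kernel_const k m n = M.base_const * of_real c0"
      unfolding M.kernel_const_def r[symmetric] c0_def by simp
    have D1: "D1 = M.pochpair (1 / of_real tar) * G"
    proof -
      have "lam / \<xi> * sqrt (q * s / t) = kar / tar"
        unfolding roots kar_def tar_def using nz by (simp add: field_simps power2_eq_square)
      then have "complex_of_real (lam / \<xi> * sqrt (q * s / t)) = of_real kar / of_real tar"
        by simp
      then show ?thesis
        unfolding D1_def mx by (simp add: qpochs_inf_def M.pochpair_def G_def)
    qed
    have numer: "numer = qpoch_inf M.Q q * (qpoch_inf (of_real Xr * M.Q ^ Suc n) q * qpoch_inf (of_real sgr * of_real Xr * M.Q ^ Suc n) q)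
        * ((1 - of_real tar) * (qpoch_inf (M.Q / of_real tar) q * qpoch_inf (M.Q * of_real tar) q))"
    proof -
      have "- (lam\<^sup>2) * q / t = q / tar" by (simp add: tar_def)
      then have "qtheta (of_real (- (lam\<^sup>2) * q / t)) q = qpoch_inf (M.Q / of_real tar) q * qpoch_inf (of_real tar) q"
        using nz q by (simp add: qtheta_def)
      moreover have "qpoch_inf (of_real tar) q = (1 - of_real tar) * qpoch_inf (M.Q * of_real tar) q"
        using M.qpoch_inf_unfold[of "of_real tar"] by (simp add: mult.commute)
      ultimately show ?thesis
        using sign_lattice_product[OF \<xi> st(1), of "\<lambda>c. qpoch_inf (of_real c) q" x "q ^ Suc n"]
        unfolding numer_def by (simp add: qpochs_inf_def Xr_def sgr_def mult_ac)
    qed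
    have H: "M.laguerre_quot (of_real sgr) k m (of_real Xr * M.Q ^ Suc n)
      = qpoch_inf (of_real Xr * M.Q ^ Suc n) q * big_q_laguerre_cleared_quot m Ry Ra Rb q"
      using M.big_q_laguerre_cleared_quot_eq_laguerre_quot[OF Rab X1] unfolding Ry r by simp
    \<comment> \<open>The orientation sign and the factor \<open>1/\<tau> - 1\<close> from the beta
      integral merge into \<open>|lam|\<close> and \<open>1 - \<tau>\<close>, the latter being the
      leading factor of \<open>(\<tau>; q)_\<infinity>\<close> in the theta function.\<close>
    have pre: "complex_of_real (- ((1 - q) * (t / \<bar>lam\<bar>))) * (1 / of_real tar - 1) = of_real ((1 - q) * \<bar>lam\<bar>) * (1 - of_real tar)"
    proof -
      have "- (t / \<bar>lam\<bar>) * (1 / tar - 1) = \<bar>lam\<bar> * (1 - tar)"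
        using nz by (simp add: tar_def field_simps power2_eq_square)
      then have "- ((1 - q) * (t / \<bar>lam\<bar>)) * (1 / tar - 1) = (1 - q) * \<bar>lam\<bar> * (1 - tar)"
        by (metis mult.assoc mult_minus_right)
      from arg_cong[OF this, of complex_of_real] show ?thesis by simp
    qed
    have "of_real (- ((1 - q) * (t / \<bar>lam\<bar>))) * (1 / G * M.kernel_value k m n (of_real Xr))
      = (complex_of_real (- ((1 - q) * (t / \<bar>lam\<bar>))) * (1 / of_real tar - 1)) * of_real c0 *
        (qpoch_inf M.Q q * (qpoch_inf (of_real Xr * M.Q ^ Suc n) q * qpoch_inf (of_real sgr * of_real Xr * M.Q ^ Suc n) q)
        * (qpoch_inf (M.Q / of_real tar) q * qpoch_inf (M.Q * of_real tar) q) / D1)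
        * M.px n (of_real Xr) * big_q_laguerre_cleared_quot m Ry Ra Rb q"
      unfolding M.kernel_value_def kernel_const M.base_const_def H D1
      by (simp only: times_divide_eq_left times_divide_eq_right divide_divide_eq_left mult_1 mult_ac)
    also have "\<dots> = const * (numer / D1) * pn * big_q_laguerre_cleared_quot m Ry Ra Rb q"
      unfolding pre const numer pn_eq of_real_mult[of "(1 - q) * \<bar>lam\<bar>" c0]
      by (simp only: times_divide_eq_left times_divide_eq_right mult_ac)
    finally show ?thesis .
  qed
  finally have f_val: "jackson_integral q f (- (q powi (- int k))) (t * q powi (- int k))
      = const * (numer / D1) * pn * big_q_laguerre_cleared_quot m Ry Ra Rb q" .
  define DL where "DL = qpochs [complex_of_real (- lam * q powi (int n - int m + 1)), of_real (lam * q powi (int n - int m + 1) / t)] q m"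
  define DR where "DR = qpochs [complex_of_real (- \<xi> * q powi (int k - int m + 1)), of_real (\<xi> * q powi (int k - int m + 1) / s)] q m"
  define g where "g = (\<lambda>z. pk z * big_q_laguerre m (Lz z) La Lb q * phi z * w z)"
  have uncleared: "jackson_integrable q g (- (q powi (- int k))) (t * q powi (- int k)) \<and>
      jackson_integral q g (- (q powi (- int k))) (t * q powi (- int k))
        = const * (numer / (qpoch_inf Ry q * D1)) * (DR / DL) * pn * big_q_laguerre m Ry Ra Rb q"
    if mn: "m \<le> n" and mk: "m \<le> k"
  proof -
    have q_Suc: "q powi (i + 1) = q powi i * q" for i
      using q by (simp add: power_int_add)
    have DL: "DL = qpochs [La * M.Q, Lb * M.Q] q m" and DR: "DR = qpochs [Ra * M.Q, Rb * M.Q] q m"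
      by (simp_all add: DL_def DR_def La_def Lb_def Ra_def Rb_def q_Suc mult_ac)
    have DL0: "DL \<noteq> 0" and DR0: "DR \<noteq> 0"
      unfolding DL_def DR_def
      using of_real_doubleton[OF sign_pair[OF lam st(2), of "q powi (int n - int m + 1)"]]
        of_real_doubleton[OF sign_pair[OF \<xi> st(1), of "q powi (int k - int m + 1)"]]
      by (intro M.qpochs_pair_nz[OF _ mn neg(2)] M.qpochs_pair_nz[OF _ mk neg(1)]; simp add: tar_def sgr_def)+
    have g: "g z = 1 / DL * f z" for z
      using DL0 big_q_laguerre_cleared_eq[of q La Lb m "Lz z"] q by (simp add: g_def f_def DL)
    have "M.Q powi (1 + r) = M.Q ^ Suc n * M.Q ^ (k - m)"
    proof -
      have "1 + r = int (Suc n) + int (k - m)" using mk by (simp add: r of_nat_diff)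
      then show ?thesis by (simp only: M.Q_powi_add power_int_of_nat)
    qed
    then have Ry0: "qpoch_inf Ry q \<noteq> 0"
      using M.qpoch_inf_shift_nz[OF X1, of "k - m"] by (simp add: Ry mult.assoc)
    have quot: "big_q_laguerre_cleared_quot m Ry Ra Rb q = DR * big_q_laguerre m Ry Ra Rb q / qpoch_inf Ry q"
      using big_q_laguerre_cleared_quot_eq[OF M.abs_q_less_1 Ry0, of m Ra Rb] big_q_laguerre_cleared_eq[of q Ra Rb m Ry] DR0 q
      by (simp add: DR)
    have "jackson_integrable q g (- (q powi (- int k))) (t * q powi (- int k))"
      using f_int unfolding jackson_integrable_def g mult.assoc norm_mult[of "1 / DL"]
      by (intro ballI summable_mult) auto
    moreover have "jackson_integral q g (- (q powi (- int k))) (t * q powi (- int k))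
       = 1 / DL * jackson_integral q f (- (q powi (- int k))) (t * q powi (- int k))"
    proof -
      have "jackson_integral0 q g \<gamma> = 1 / DL * jackson_integral0 q f \<gamma>"
        if "summable (\<lambda>j. norm (f (\<gamma> * q ^ j) * of_real (\<gamma> * q ^ j)))" for \<gamma>
        unfolding jackson_integral0_def g mult.assoc[of "1 / DL"] suminf_mult[OF summable_norm_cancel[OF that]]
        by (rule mult.left_commute)
      from this[OF J0(2)] this[OF J0(4)] show ?thesis
        unfolding jackson_integral_def by (simp only: right_diff_distrib)
    qed
    moreover have "1 / DL * (const * (numer / D1) * pn * big_q_laguerre_cleared_quot m Ry Ra Rb q)
        = const * (numer / (qpoch_inf Ry q * D1)) * (DR / DL) * pn * big_q_laguerre m Ry Ra Rb q"
      unfolding quot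
      by (simp only: times_divide_eq_left times_divide_eq_right divide_divide_eq_left mult_1 mult_ac)
    ultimately show ?thesis
      unfolding f_val by metis
  qed
  define D0 where "D0 = qpochs_inf [Ry, of_real (lam / \<xi> * sqrt (q * s / t)) * u, of_real (lam / \<xi> * sqrt (q * s / t)) / u,
                   - u * of_real (q powi (- r) / (lam * \<xi>) * sqrt (q * s * t)),
                   - of_real (q powi (- r) / (lam * \<xi>) * sqrt (q * s * t)) / u] q"
  have "D0 = qpoch_inf Ry q * D1"
    unfolding D0_def D1_def qpochs_inf_def by (simp only: list.map prod_list.Cons)
  with uncleared f_int f_val
  have "(m \<le> n \<longrightarrow> m \<le> k \<longrightarrow>
        jackson_integrable q g (- (q powi (- int k))) (t * q powi (- int k)) \<and>
        jackson_integral q g (- (q powi (- int k))) (t * q powi (- int k))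
          = const * (numer / D0) * (DR / DL) * pn * big_q_laguerre m Ry Ra Rb q) \<and>
      jackson_integrable q f (- (q powi (- int k))) (t * q powi (- int k)) \<and>
      jackson_integral q f (- (q powi (- int k))) (t * q powi (- int k))
        = const * (numer / D1) * pn * big_q_laguerre_cleared_quot m Ry Ra Rb q"
    by simp
  then show ?thesis
    unfolding Let_def g_def f_def D0_def D1_def DL_def DR_def pk_def phi_def w_def const_def numer_def pn_def
      La_def Lb_def Lz_def Ra_def Rb_def Ry_def .
qed

end
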